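(* Let $G, H$ be compact Lie groups acting smoothly, with finite isotropy groups, on smooth manifolds $X$ and $Y$ respectively, and let $\varphi=(\varphi,f)\colon G\ltimes X\to H\ltimes Y$ be an equivariant essential equivalence of smooth translation groupoids. Then the induced functor between the discrete equivariant fundamental categories $$\Pi^d(\varphi)\colon \Pi^d_G(X)\to \Pi^d_H(Y)$$ is a weak equivalence of categories (i.e. it is full, faithful and essentially surjective on objects).
   Context: **Translation groupoids.** For a Lie group $G$ acting smoothly on the left on a manifold $X$, $G\ltimes X$ is the Lie groupoid with object space $X$ and arrow space $G\times X$, where $(g,x)$ is an arrow from $x$ to $gx$ and $(g',gx)\circ(g,x)=(g'g,x)$. An equivariant map $G\ltimes X\to H\ltimes Y$ is a pair $(\varphi,f)$ with $\varphi\colon G\to H$ a homomorphism of Lie groups and $f\colon X\to Y$ smooth with $f(gx)=\varphi(g)f(x)$. It is an equivariant essential equivalence if, as a functor of Lie groupoids, it is an essential equivalence: (i) the map $H\times X\to Y$, $(h,x)\mapsto h f(x)$, is a surjective submersion; (ii) the square with $G\times X\to H\times Y$, $(g,x)\mapsto(\varphi(g),f(x))$, over $f\times f\colon X\times X\to Y\times Y$ (via source and target) is a pullback of manifolds, i.e. $(g,x)\mapsto (x,gx,\varphi(g))$ is a diffeomorphism from $G\times X$ onto $\{(x,x',h)\in X\times X\times H: hf(x)=f(x')\}$. **The category $\Pi^d_G(X)$.** Let $G$ be a compact Lie group acting on $X$; $X^H=\{x: hx=x\ \forall h\in H\}$. The orbit category $\mathcal O_G$ has objects $G/H$ for closed subgroups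 $H\le G$; an arrow $G/H\to G/K$ is a $G$-map, equivalently a coset $\alpha K\in (G/K)^H$ (i.e. $H\le \alpha K\alpha^{-1}$), written $\alpha$, sending $gH\mapsto g\alpha K$. For $y\in X^K$, $\alpha y\in X^H$ is well defined. Write $*$ for concatenation of paths. First, the 2-category $\Pi_G(X)$ is: - Objects: pairs $(G/H,x)$ with $H\le G$ closed, $x\in X^H$. - Arrows $(G/H,x)\to(G/K,y)$: pairs $(\alpha,[\gamma])$ with $\alpha\colon G/H\to G/K$ in $\mathcal O_G$ and $[\gamma]$ a homotopy class rel endpoints of paths in $X^H$ from $x$ to $\alpha y$. The composite of $(\alpha,[\gamma])\colon(G/H,x)\to(G/K,y)$ followed by $(\beta,[\zeta])\colon (G/K,y)\to(G/L,z)$ is $(\alpha\beta,[\gamma*\alpha\zeta])$. - 2-cells $(\alpha,[\gamma])\Rightarrow(\alpha',[\gamma'])$: homotopy classes rel endpoints $[\sigma]$ of paths $\sigma$ in $(G/K)^H$ from $\alpha$ to $\alpha'$ such that $\gamma*\sigma y$ is homotopic rel endpoints to $\gamma'$ in $X^H$. $\Pi^d_G(X)$ is the category obtained from $\Pi_G(X)$ by identifying any two arrows connected by a 2-cell (same objects; arrows are equivalence classes). This is tom Dieck's discrete fundamental group category $\pi_1^d(G,X)$. **Induced functor.** For $(\varphi,f)\colon G_1\ltimes X_1\to G_2\ltimes X_2$, $\Pi^d(\varphi,f)\colon\Pi^d_{G_1}(X_1)\to\Pi^d_{G_2}(X_2)$ sends $(G_1/H,x)\mapsto(G_2/\varphi(H),f(x))$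 and the class of $(\alpha,[\gamma])$ to the class of $(\varphi(\alpha),[f\gamma])$. *)

theory Defs
  imports "HOL-Analysis.Analysis" "HOL-Algebra.Group_Action" "HOL-Algebra.Left_Coset"
begin

section \<open>Smooth manifolds\<close>

text \<open>
  A manifold is a subset of a topological space, with the subspace topology, together with an atlas.
  Charts take values in a Euclidean space \<open>'e\<close>; the image of a chart is relatively open in the linear
  subspace that it spans. As types of class \<open>euclidean_space\<close> have positive dimension, charts
  onto open subsets of \<open>'e\<close> itself would exclude manifolds of dimension 0, such as finite groups.
  The dimension may differ from one component to another, up to the dimension of \<open>'e\<close>.
\<close>

record ('a, 'e) manifold =
  points :: "'a set"
  charts :: "('a set \<times> ('a \<Rightarrow> 'e)) set"

primrec Ck_on :: "nat \<Rightarrow> 'a::real_normed_vector set \<Rightarrow> ('a \<Rightarrow> 'b::real_normed_vector) \<Rightarrow> bool" where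
  "Ck_on 0 U f \<longleftrightarrow> continuous_on U f"
| "Ck_on (Suc k) U f \<longleftrightarrow>
     f differentiable_on U \<and> (\<forall>v. Ck_on k U (\<lambda>x. frechet_derivative f (at x) v))"

text \<open>
  A function on an arbitrary subset of a Euclidean space is smooth if near each point of the subset
  it extends to a \<open>C\<^sup>\<infinity>\<close> function on an open set. On a relatively open
  subset of a linear subspace this is the usual notion.
\<close>

definition smooth_on :: "'a::real_normed_vector set \<Rightarrow> ('a \<Rightarrow> 'b::real_normed_vector) \<Rightarrow> bool" where
  "smooth_on S f \<longleftrightarrow>
     (\<forall>x\<in>S. \<exists>U F. open U \<and> x \<in> U \<and> (\<forall>k. Ck_on k U F) \<and> (\<forall>y\<in>S \<inter> U. F y = f y))"

definition smooth_manifold :: "('a::topological_space, 'e::euclidean_space) manifold \<Rightarrow> bool" where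
  "smooth_manifold M \<longleftrightarrow>
     Hausdorff_space (top_of_set (points M)) \<and>
     second_countable (top_of_set (points M)) \<and>
     (\<Union>(U, \<kappa>)\<in>charts M. U) = points M \<and>
     (\<forall>(U, \<kappa>)\<in>charts M.
        openin (top_of_set (points M)) U \<and>
        openin (top_of_set (span (\<kappa> ` U))) (\<kappa> ` U) \<and>
        homeomorphism U (\<kappa> ` U) \<kappa> (inv_into U \<kappa>)) \<and>
     (\<forall>(U, \<kappa>)\<in>charts M. \<forall>(W, \<mu>)\<in>charts M. smooth_on (\<kappa> ` (U \<inter> W)) (\<mu> \<circ> inv_into U \<kappa>))"

definition prod_manifold ::
    "('a, 'e) manifold \<Rightarrow> ('b, 'f) manifold \<Rightarrow> ('a \<times> 'b, 'e \<times> 'f) manifold" where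
  "prod_manifold M N =
     \<lparr>points = points M \<times> points N,
      charts = {(U \<times> W, map_prod \<kappa> \<mu>) | U \<kappa> W \<mu>. (U, \<kappa>) \<in> charts M \<and> (W, \<mu>) \<in> charts N}\<rparr>"

text \<open>
  Here \<open>S\<close> is any subset of \<open>M\<close>. If \<open>S\<close> is an embedded submanifold, this is smoothness of \<open>f\<close>
  for the submanifold structure of \<open>S\<close>.
\<close>

definition smooth_map_on ::
    "'a set \<Rightarrow> ('a::topological_space, 'e::euclidean_space) manifold \<Rightarrow>
     ('b::topological_space, 'f::euclidean_space) manifold \<Rightarrow> ('a \<Rightarrow> 'b) \<Rightarrow> bool" where
  "smooth_map_on S M N f \<longleftrightarrow>
     S \<subseteq> points M \<and> f ` S \<subseteq> points N \<and> continuous_on S f \<and>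
     (\<forall>(U, \<kappa>)\<in>charts M. \<forall>(W, \<mu>)\<in>charts N.
        smooth_on (\<kappa> ` (U \<inter> S \<inter> f -` W)) (\<mu> \<circ> f \<circ> inv_into U \<kappa>))"

abbreviation smooth_map ::
    "('a::topological_space, 'e::euclidean_space) manifold \<Rightarrow>
     ('b::topological_space, 'f::euclidean_space) manifold \<Rightarrow> ('a \<Rightarrow> 'b) \<Rightarrow> bool" where
  "smooth_map M N f \<equiv> smooth_map_on (points M) M N f"

text \<open>
  In charts \<open>\<kappa>\<close> at \<open>p\<close> and \<open>\<mu>\<close> at \<open>f p\<close> the tangent spaces are \<open>span (\<kappa> ` U)\<close> and \<open>span (\<mu> ` W)\<close>.
  Only the restriction of \<open>D\<close> to \<open>span (\<kappa> ` U)\<close> is determined by the local representative.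
\<close>

definition submersion ::
    "('a::topological_space, 'e::euclidean_space) manifold \<Rightarrow>
     ('b::topological_space, 'f::euclidean_space) manifold \<Rightarrow> ('a \<Rightarrow> 'b) \<Rightarrow> bool" where
  "submersion M N f \<longleftrightarrow>
     smooth_map M N f \<and>
     (\<forall>p\<in>points M. \<forall>(U, \<kappa>)\<in>charts M. \<forall>(W, \<mu>)\<in>charts N. p \<in> U \<and> f p \<in> W \<longrightarrow>
        (\<exists>D. ((\<mu> \<circ> f \<circ> inv_into U \<kappa>) has_derivative D) (at (\<kappa> p) within \<kappa> ` (U \<inter> f -` W)) \<and>
             D ` span (\<kappa> ` U) = span (\<mu> ` W)))"

definition diffeomorphism_onto ::
    "('a::topological_space, 'e::euclidean_space) manifold \<Rightarrow>
     ('b::topological_space, 'f::euclidean_space) manifold \<Rightarrow> 'b set \<Rightarrow> ('a \<Rightarrow> 'b) \<Rightarrow> bool" where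
  "diffeomorphism_onto M N E F \<longleftrightarrow>
     smooth_map M N F \<and> bij_betw F (points M) E \<and>
     smooth_map_on E N M (inv_into (points M) F)"


section \<open>Lie groups, actions and translation groupoids\<close>

record ('g, 'e) lie_group = "'g monoid" +
  group_charts :: "('g set \<times> ('g \<Rightarrow> 'e)) set"

definition group_manifold :: "('g, 'e) lie_group \<Rightarrow> ('g, 'e) manifold" where
  "group_manifold G = \<lparr>points = carrier G, charts = group_charts G\<rparr>"

definition is_lie_group :: "('g::topological_space, 'e::euclidean_space) lie_group \<Rightarrow> bool" where
  "is_lie_group G \<longleftrightarrow>
     group G \<and> smooth_manifold (group_manifold G) \<and>
     smooth_map (prod_manifold (group_manifold G) (group_manifold G)) (group_manifold G)
       (\<lambda>(g, g'). g \<otimes>\<^bsub>G\<^esub> g') \<and>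
     smooth_map (group_manifold G) (group_manifold G) (\<lambda>g. inv\<^bsub>G\<^esub> g)"

definition smooth_action ::
    "('g::topological_space, 'e::euclidean_space) lie_group \<Rightarrow>
     ('x::topological_space, 'f::euclidean_space) manifold \<Rightarrow> ('g \<Rightarrow> 'x \<Rightarrow> 'x) \<Rightarrow> bool" where
  "smooth_action G X act \<longleftrightarrow>
     group_action G (points X) act \<and>
     smooth_map (prod_manifold (group_manifold G) X) X (\<lambda>(g, x). act g x)"

definition equivariant_map ::
    "('g::topological_space, 'd::euclidean_space) lie_group \<Rightarrow>
     ('x::topological_space, 'e::euclidean_space) manifold \<Rightarrow> ('g \<Rightarrow> 'x \<Rightarrow> 'x) \<Rightarrow>
     ('h::topological_space, 'b::euclidean_space) lie_group \<Rightarrow>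
     ('y::topological_space, 'c::euclidean_space) manifold \<Rightarrow> ('h \<Rightarrow> 'y \<Rightarrow> 'y) \<Rightarrow>
     ('g \<Rightarrow> 'h) \<Rightarrow> ('x \<Rightarrow> 'y) \<Rightarrow> bool" where
  "equivariant_map G X actX H Y actY \<phi> f \<longleftrightarrow>
     \<phi> \<in> hom G H \<and> smooth_map (group_manifold G) (group_manifold H) \<phi> \<and>
     smooth_map X Y f \<and>
     (\<forall>g\<in>carrier G. \<forall>x\<in>points X. f (actX g x) = actY (\<phi> g) (f x))"

text \<open>
  By the first condition the set in the second one, the pullback of
  \<open>H \<times> Y \<rightarrow> Y \<times> Y\<close> along \<open>f \<times> f\<close>, is an embedded submanifold of \<open>X \<times> X \<times> H\<close>.
\<close>

definition equivariant_essential_equivalence ::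
    "('g::topological_space, 'd::euclidean_space) lie_group \<Rightarrow>
     ('x::topological_space, 'e::euclidean_space) manifold \<Rightarrow> ('g \<Rightarrow> 'x \<Rightarrow> 'x) \<Rightarrow>
     ('h::topological_space, 'b::euclidean_space) lie_group \<Rightarrow>
     ('y::topological_space, 'c::euclidean_space) manifold \<Rightarrow> ('h \<Rightarrow> 'y \<Rightarrow> 'y) \<Rightarrow>
     ('g \<Rightarrow> 'h) \<Rightarrow> ('x \<Rightarrow> 'y) \<Rightarrow> bool" where
  "equivariant_essential_equivalence G X actX H Y actY \<phi> f \<longleftrightarrow>
     equivariant_map G X actX H Y actY \<phi> f \<and>
     submersion (prod_manifold (group_manifold H) X) Y (\<lambda>(h, x). actY h (f x)) \<and>
     (\<lambda>(h, x). actY h (f x)) ` (carrier H \<times> points X) = points Y \<and>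
     diffeomorphism_onto
       (prod_manifold (group_manifold G) X)
       (prod_manifold X (prod_manifold X (group_manifold H)))
       {(x, x', h). x \<in> points X \<and> x' \<in> points X \<and> h \<in> carrier H \<and> actY h (f x) = f x'}
       (\<lambda>(g, x). (x, actX g x, \<phi> g))"


section \<open>Categories\<close>

text \<open>Composition is written in diagrammatic order; it and the arrow part of a functor take the
  objects as arguments, and distinct hom-sets need not be disjoint.\<close>

record ('o, 'm) category =
  Obj :: "'o set"
  Hom :: "'o \<Rightarrow> 'o \<Rightarrow> 'm set"
  Comp :: "'o \<Rightarrow> 'o \<Rightarrow> 'o \<Rightarrow> 'm \<Rightarrow> 'm \<Rightarrow> 'm"
  Ident :: "'o \<Rightarrow> 'm"

definition is_category :: "('o, 'm) category \<Rightarrow> bool" where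
  "is_category C \<longleftrightarrow>
     (\<forall>a\<in>Obj C. Ident C a \<in> Hom C a a) \<and>
     (\<forall>a\<in>Obj C. \<forall>b\<in>Obj C. \<forall>c\<in>Obj C. \<forall>u\<in>Hom C a b. \<forall>v\<in>Hom C b c.
        Comp C a b c u v \<in> Hom C a c) \<and>
     (\<forall>a\<in>Obj C. \<forall>b\<in>Obj C. \<forall>u\<in>Hom C a b.
        Comp C a a b (Ident C a) u = u \<and> Comp C a b b u (Ident C b) = u) \<and>
     (\<forall>a\<in>Obj C. \<forall>b\<in>Obj C. \<forall>c\<in>Obj C. \<forall>d\<in>Obj C.
        \<forall>u\<in>Hom C a b. \<forall>v\<in>Hom C b c. \<forall>w\<in>Hom C c d.
          Comp C a c d (Comp C a b c u v) w = Comp C a b d u (Comp C b c d v w))"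

definition is_functor ::
    "('o, 'm) category \<Rightarrow> ('p, 'n) category \<Rightarrow> ('o \<Rightarrow> 'p) \<Rightarrow> ('o \<Rightarrow> 'o \<Rightarrow> 'm \<Rightarrow> 'n) \<Rightarrow> bool" where
  "is_functor C D Fo Fa \<longleftrightarrow>
     is_category C \<and> is_category D \<and>
     (\<forall>a\<in>Obj C. Fo a \<in> Obj D) \<and>
     (\<forall>a\<in>Obj C. \<forall>b\<in>Obj C. \<forall>u\<in>Hom C a b. Fa a b u \<in> Hom D (Fo a) (Fo b)) \<and>
     (\<forall>a\<in>Obj C. Fa a a (Ident C a) = Ident D (Fo a)) \<and>
     (\<forall>a\<in>Obj C. \<forall>b\<in>Obj C. \<forall>c\<in>Obj C. \<forall>u\<in>Hom C a b. \<forall>v\<in>Hom C b c.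
        Fa a c (Comp C a b c u v) = Comp D (Fo a) (Fo b) (Fo c) (Fa a b u) (Fa b c v))"

definition isomorphic_objects :: "('o, 'm) category \<Rightarrow> 'o \<Rightarrow> 'o \<Rightarrow> bool" where
  "isomorphic_objects C a b \<longleftrightarrow>
     (\<exists>u\<in>Hom C a b. \<exists>v\<in>Hom C b a.
        Comp C a b a u v = Ident C a \<and> Comp C b a b v u = Ident C b)"

definition weak_equivalence ::
    "('o, 'm) category \<Rightarrow> ('p, 'n) category \<Rightarrow> ('o \<Rightarrow> 'p) \<Rightarrow> ('o \<Rightarrow> 'o \<Rightarrow> 'm \<Rightarrow> 'n) \<Rightarrow> bool" where
  "weak_equivalence C D Fo Fa \<longleftrightarrow>
     is_functor C D Fo Fa \<and>
     (\<forall>a\<in>Obj C. \<forall>b\<in>Obj C. \<forall>w\<in>Hom D (Fo a) (Fo b). \<exists>u\<in>Hom C a b. Fa a b u = w) \<and>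
     (\<forall>a\<in>Obj C. \<forall>b\<in>Obj C. inj_on (Fa a b) (Hom C a b)) \<and>
     (\<forall>d\<in>Obj D. \<exists>a\<in>Obj C. isomorphic_objects D (Fo a) d)"


section \<open>The discrete fundamental group category\<close>

definition fixed_points :: "'x set \<Rightarrow> ('g \<Rightarrow> 'x \<Rightarrow> 'x) \<Rightarrow> 'g set \<Rightarrow> 'x set" where
  "fixed_points X act K = {x \<in> X. \<forall>k\<in>K. act k x = x}"

text \<open>The arrows \<open>G/K \<rightarrow> G/L\<close> of the orbit category, as the set \<open>(G/L)\<^sup>K\<close> of cosets.\<close>

definition orbit_arrows :: "('g, 'm) monoid_scheme \<Rightarrow> 'g set \<Rightarrow> 'g set \<Rightarrow> 'g set set" where
  "orbit_arrows G K L = {C \<in> lcosets\<^bsub>G\<^esub> L. \<forall>k\<in>K. k <#\<^bsub>G\<^esub> C = C}"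

definition coset_topology ::
    "('g::topological_space, 'm) monoid_scheme \<Rightarrow> 'g set \<Rightarrow> 'g set topology" where
  "coset_topology G L =
     topology (\<lambda>\<U>. \<U> \<subseteq> lcosets\<^bsub>G\<^esub> L \<and>
       openin (top_of_set (carrier G)) {g \<in> carrier G. g <#\<^bsub>G\<^esub> L \<in> \<U>})"

lemma openin_coset_topology:
  "openin (coset_topology G L) \<U> \<longleftrightarrow>
     \<U> \<subseteq> lcosets\<^bsub>G\<^esub> L \<and> openin (top_of_set (carrier G)) {g \<in> carrier G. g <#\<^bsub>G\<^esub> L \<in> \<U>}"
proof -
  let ?P = "\<lambda>\<U>. {g \<in> carrier G. g <#\<^bsub>G\<^esub> L \<in> \<U>}"
  have int: "?P (S \<inter> T) = ?P S \<inter> ?P T" for S T by auto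
  have un: "?P (\<Union>\<K>) = \<Union>(?P ` \<K>)" for \<K> by auto
  have "istopology (\<lambda>\<U>. \<U> \<subseteq> lcosets\<^bsub>G\<^esub> L \<and> openin (top_of_set (carrier G)) (?P \<U>))"
    unfolding istopology_def int un by (auto intro!: openin_Int openin_Union)
  then show ?thesis
    unfolding coset_topology_def by (simp add: topology_inverse')
qed

text \<open>\<open>\<alpha>L \<cdot> y = \<alpha>y\<close>, for \<open>y\<close> fixed by \<open>L\<close>.\<close>

definition coset_act :: "('g \<Rightarrow> 'x \<Rightarrow> 'x) \<Rightarrow> 'g set \<Rightarrow> 'x \<Rightarrow> 'x" where
  "coset_act act C y = the_elem ((\<lambda>g. act g y) ` C)"

definition path_class :: "'x::topological_space set \<Rightarrow> (real \<Rightarrow> 'x) \<Rightarrow> (real \<Rightarrow> 'x) set" where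
  "path_class S p = {q. homotopic_paths S p q}"

text \<open>The object \<open>(G/K, x)\<close> is represented by \<open>(K, x)\<close>.\<close>

definition Pi_obj ::
    "('g::topological_space, 'm) monoid_scheme \<Rightarrow> 'x set \<Rightarrow> ('g \<Rightarrow> 'x \<Rightarrow> 'x) \<Rightarrow> ('g set \<times> 'x) set" where
  "Pi_obj G X act =
     {(K, x). subgroup K G \<and> closedin (top_of_set (carrier G)) K \<and> x \<in> fixed_points X act K}"

definition Pi_arr ::
    "('g, 'm) monoid_scheme \<Rightarrow> 'x::topological_space set \<Rightarrow> ('g \<Rightarrow> 'x \<Rightarrow> 'x) \<Rightarrow>
     'g set \<times> 'x \<Rightarrow> 'g set \<times> 'x \<Rightarrow> ('g set \<times> (real \<Rightarrow> 'x) set) set" where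
  "Pi_arr G X act = (\<lambda>(K, x) (L, y).
     {(C, path_class (fixed_points X act K) p) | C p.
        C \<in> orbit_arrows G K L \<and> path p \<and> path_image p \<subseteq> fixed_points X act K \<and>
        pathstart p = x \<and> pathfinish p = coset_act act C y})"

text \<open>The coset \<open>\<alpha>\<beta>M\<close> is the product of the subsets \<open>\<alpha>L\<close> and \<open>\<beta>M\<close> of \<open>G\<close>.\<close>

definition Pi_comp ::
    "('g, 'm) monoid_scheme \<Rightarrow> 'x::topological_space set \<Rightarrow> ('g \<Rightarrow> 'x \<Rightarrow> 'x) \<Rightarrow>
     'g set \<times> 'x \<Rightarrow> 'g set \<times> (real \<Rightarrow> 'x) set \<Rightarrow> 'g set \<times> (real \<Rightarrow> 'x) set \<Rightarrow>
     'g set \<times> (real \<Rightarrow> 'x) set" where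
  "Pi_comp G X act = (\<lambda>(K, x) (C, P) (D, Q).
     (C <#>\<^bsub>G\<^esub> D,
      \<Union>p\<in>P. \<Union>q\<in>Q. path_class (fixed_points X act K) (p +++ (\<lambda>t. coset_act act C (q t)))))"

text \<open>
  Two arrows of \<open>\<Pi>\<^sub>G(X)\<close> are related if there is a 2-cell from the first to the second,
  represented by the path \<open>\<sigma>\<close>.
\<close>

definition Pi_rel ::
    "('g::topological_space, 'm) monoid_scheme \<Rightarrow> 'x::topological_space set \<Rightarrow> ('g \<Rightarrow> 'x \<Rightarrow> 'x) \<Rightarrow>
     'g set \<times> 'x \<Rightarrow> 'g set \<times> 'x \<Rightarrow> ('g set \<times> (real \<Rightarrow> 'x) set) rel" where
  "Pi_rel G X act = (\<lambda>(K, x) (L, y).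
     {((C, P), (C', P')).
        (C, P) \<in> Pi_arr G X act (K, x) (L, y) \<and> (C', P') \<in> Pi_arr G X act (K, x) (L, y) \<and>
        (\<exists>\<sigma>. pathin (subtopology (coset_topology G L) (orbit_arrows G K L)) \<sigma> \<and>
             \<sigma> 0 = C \<and> \<sigma> 1 = C' \<and>
             (\<exists>p\<in>P. \<exists>p'\<in>P'. homotopic_paths (fixed_points X act K)
                (p +++ (\<lambda>t. coset_act act (\<sigma> t) y)) p'))})"

definition Pi_d ::
    "('g::topological_space, 'm) monoid_scheme \<Rightarrow> 'x::topological_space set \<Rightarrow> ('g \<Rightarrow> 'x \<Rightarrow> 'x) \<Rightarrow>
     ('g set \<times> 'x, ('g set \<times> (real \<Rightarrow> 'x) set) set) category" where
  "Pi_d G X act =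
     \<lparr>Obj = Pi_obj G X act,
      Hom = (\<lambda>a b. Pi_arr G X act a b // Pi_rel G X act a b),
      Comp = (\<lambda>a b c A B. \<Union>u\<in>A. \<Union>v\<in>B. Pi_rel G X act a c `` {Pi_comp G X act a u v}),
      Ident = (\<lambda>a. Pi_rel G X act a a ``
        {(fst a, path_class (fixed_points X act (fst a)) (\<lambda>_. snd a))})\<rparr>"

definition Pi_d_obj :: "('g \<Rightarrow> 'h) \<Rightarrow> ('x \<Rightarrow> 'y) \<Rightarrow> 'g set \<times> 'x \<Rightarrow> 'h set \<times> 'y" where
  "Pi_d_obj \<phi> f = (\<lambda>(K, x). (\<phi> ` K, f x))"

text \<open>The coset \<open>\<phi>(\<alpha>)\<phi>(L)\<close> is the image of \<open>\<alpha>L\<close> under \<open>\<phi>\<close>.\<close>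

definition Pi_d_arr ::
    "('h::topological_space, 'm) monoid_scheme \<Rightarrow> 'y::topological_space set \<Rightarrow> ('h \<Rightarrow> 'y \<Rightarrow> 'y) \<Rightarrow>
     ('g \<Rightarrow> 'h) \<Rightarrow> ('x \<Rightarrow> 'y) \<Rightarrow> 'g set \<times> 'x \<Rightarrow> 'g set \<times> 'x \<Rightarrow>
     ('g set \<times> (real \<Rightarrow> 'x) set) set \<Rightarrow> ('h set \<times> (real \<Rightarrow> 'y) set) set" where
  "Pi_d_arr H Y actY \<phi> f a b A =
     (\<Union>(C, P)\<in>A. Pi_rel H Y actY (Pi_d_obj \<phi> f a) (Pi_d_obj \<phi> f b) ``
        {(\<phi> ` C, \<Union>p\<in>P. path_class (fixed_points Y actY (\<phi> ` fst a)) (f \<circ> p))})"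

end

theory Submission
  imports Defs
begin

text \<open>
  Let \<open>x\<close> be fixed by \<open>K\<close>, which is finite as it lies in the isotropy group of \<open>x\<close>. A path of cosets
  in \<open>(G/L)\<^sup>K\<close>, with \<open>L\<close> finite, lifts to \<open>G\<close>, and a lift starting at \<open>\<alpha>\<close> has the form \<open>c(t) \<alpha>\<close> with \<open>c\<close> a path
  in the centralizer of \<open>K\<close>. Hence two arrows \<open>(\<alpha>, [\<gamma>])\<close> and \<open>(\<alpha>', [\<gamma>'])\<close> become equal in the discrete
  category if and only if \<open>\<alpha>' L = c(1) \<alpha> L\<close> and \<open>\<gamma>' \<simeq> c \<cdot> \<gamma>\<close> (pointwise) for such a path \<open>c\<close> with \<open>c(0) = 1\<close>.

  An essential equivalence makes \<open>(h, x) \<mapsto> h f(x)\<close> a principal \<open>G\<close>-bundle \<open>H \<times> X \<rightarrow> Y\<close>. By an averaging argument and the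
  inverse function theorem it has local sections that are equivariant under \<open>K\<close>, so that
  paths and squares in \<open>Y\<^sup>\<phi>\<^sup>K\<close> lift to pairs \<open>(h, \<xi>)\<close> with \<open>\<xi>\<close> in \<open>X\<^sup>K\<close> and \<open>h\<close> in the centralizer of \<open>\<phi>(K)\<close>.
  Lifting a path \<open>\<gamma>\<close> exhibits it as \<open>h \<cdot> f \<xi>\<close>, which is fullness; lifting a homotopy
  gives faithfulness. Essential surjectivity is the surjectivity of \<open>H \<times> X \<rightarrow> Y\<close>.
\<close>

no_notation subset_mset (infix "<#" 50)

section \<open>Bundles over the square\<close>

text \<open>Over a point of Y fixed by \<phi>(K), a point (h, x) of H \<times> X need not involve a
  fixed point of K. What holds is \<phi>(k) h = h \<phi>(\<rho>(k)) with \<rho>(k) in the isotropy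
  group of x, for a homomorphism \<rho> that depends on (h, x). This shapes the lifting: local
  sections come with varying \<rho>, elements of the structure group G conjugate one \<rho> into
  another, and a global section is normalized only at the end, at a corner of the square where
  \<rho> can be made the inclusion. Paths are lifted as squares that are constant in one direction,
  so that one lifting statement serves both fullness and faithfulness.

  Finite isotropy makes averages over K finite sums, lets paths lift along the quotient map from G
  to G/L, and forces a path in L to be constant. The last fact puts every 2-cell into the
  centralizer of K. Since the centralizer acts pointwise on paths, inverses and composites of
  2-cells become pointwise inverses and products, with no concatenation.\<close>

lemma glue_sections:
  fixes h :: "real \<times> real \<Rightarrow> real" and s s' :: "real \<times> real \<Rightarrow> 'e::topological_space"
    and F :: "'i \<Rightarrow> real \<times> real \<Rightarrow> 'e set" and T :: "'e \<Rightarrow> 'e \<Rightarrow> 'e \<Rightarrow> 'e"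
  assumes s: "continuous_on {v \<in> S. h v \<le> b} s" "\<And>v. v \<in> S \<Longrightarrow> h v \<le> b \<Longrightarrow> s v \<in> F i v"
    and s': "continuous_on {v \<in> S. b \<le> h v} s'" "\<And>v. v \<in> S \<Longrightarrow> b \<le> h v \<Longrightarrow> s' v \<in> F j v"
    and SQ: "S \<subseteq> Q"
    and h: "continuous_on S h"
    and r: "continuous_on {v \<in> S. b \<le> h v} r" "\<And>v. v \<in> S \<Longrightarrow> b \<le> h v \<Longrightarrow> r v \<in> S \<and> h (r v) = b"
      "\<And>v. v \<in> S \<Longrightarrow> h v = b \<Longrightarrow> r v = v"
    and T_mem: "\<And>i j u v z z' w. \<lbrakk>u \<in> Q; v \<in> Q; z \<in> F i u; z' \<in> F j u; w \<in> F i v\<rbrakk> \<Longrightarrow> T z z' w \<in> F j v"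
    and T_eq: "\<And>i j u z z'. \<lbrakk>u \<in> Q; z \<in> F i u; z' \<in> F j u\<rbrakk> \<Longrightarrow> T z z' z = z'"
    and T_cont: "continuous_on {(z, z', w). \<exists>i j u v. u \<in> Q \<and> v \<in> Q \<and> z \<in> F i u \<and> z' \<in> F j u \<and> w \<in> F i v}
      (\<lambda>(z, z', w). T z z' w)"
  shows "\<exists>s. continuous_on S s \<and> (\<forall>v\<in>S. s v \<in> F i v)"
proof -
  \<comment> \<open>\<open>r\<close> retracts the upper half onto the seam \<open>h v = b\<close>.
    The group element that carries \<open>s'\<close> to \<open>s\<close> at \<open>r v\<close> is
    applied to \<open>s'\<close> at \<open>v\<close>. On the seam this gives \<open>s\<close>, by
    \<open>T_eq\<close>; on the whole upper half it turns type \<open>j\<close> into type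
    \<open>i\<close>.\<close>
  define s'' where "s'' v = T (s' (r v)) (s (r v)) (s' v)" for v
  let ?R = "{v \<in> S. b \<le> h v}"
  have sub: "r ` ?R \<subseteq> {v \<in> S. h v \<le> b}" "r ` ?R \<subseteq> ?R" using r(2) by auto
  have "continuous_on ?R (\<lambda>v. (s' (r v), s (r v), s' v))"
    by (intro continuous_on_Pair s'(1) continuous_on_compose2[OF s'(1) r(1) sub(2)]
        continuous_on_compose2[OF s(1) r(1) sub(1)])
  moreover have "(\<lambda>v. (s' (r v), s (r v), s' v)) ` ?R \<subseteq>
      {(z, z', w). \<exists>i j u v. u \<in> Q \<and> v \<in> Q \<and> z \<in> F i u \<and> z' \<in> F j u \<and> w \<in> F i v}"
  (is "_ \<subseteq> ?D")
  proof
    fix y assume "y \<in> (\<lambda>v. (s' (r v), s (r v), s' v)) ` ?R"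
    then obtain v where v: "v \<in> S" "b \<le> h v" "y = (s' (r v), s (r v), s' v)" by blast
    then have "r v \<in> Q \<and> v \<in> Q \<and> s' (r v) \<in> F j (r v) \<and> s (r v) \<in> F i (r v) \<and> s' v \<in> F j v"
      using r(2)[of v] s(2)[of "r v"] s'(2)[of "r v"] s'(2)[of v] SQ by auto
    then show "y \<in> ?D" unfolding v(3) mem_Collect_eq prod.case by blast
  qed
  ultimately have "continuous_on ?R s''"
    using continuous_on_compose2[OF T_cont, of ?R "\<lambda>v. (s' (r v), s (r v), s' v)"]
    unfolding s''_def prod.case by blast
  moreover have "s v = s'' v" if "v \<in> S" "h v = b" for v
    using T_eq[of v "s' v" j "s v" i] s(2)[of v] s'(2)[of v] r(3)[of v] that SQ unfolding s''_def by auto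
  ultimately have "continuous_on S (\<lambda>v. if h v \<le> b then s v else s'' v)"
    using continuous_on_cases_le[OF s(1) _ h] by blast
  moreover have "(if h v \<le> b then s v else s'' v) \<in> F i v" if "v \<in> S" for v
    using that s(2)[of v] s(2)[of "r v"] s'(2)[of v] s'(2)[of "r v"] r(2)[of v] SQ[THEN subsetD, of v] SQ[THEN subsetD, of "r v"]
      T_mem[of "r v" v "s' (r v)" j "s (r v)" i "s' v"]
    unfolding s''_def by auto
  ultimately show ?thesis by (intro exI[of _ "\<lambda>v. if h v \<le> b then s v else s'' v"]) auto
qed

text \<open>
  A bundle over the square whose structure group acts simply transitively on the fibres is trivial.
  The group enters only through the operation \<open>T z z' w = g w\<close>, where \<open>g z = z'\<close>. The fibres come
  in several types \<open>F i\<close>, because it is not known in advance which of them is inhabited where.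
\<close>

lemma section_on_square:
  fixes F :: "'i \<Rightarrow> real \<times> real \<Rightarrow> 'e::topological_space set" and T :: "'e \<Rightarrow> 'e \<Rightarrow> 'e \<Rightarrow> 'e"
  defines "Q \<equiv> {0..1} \<times> {0..1}"
  assumes local: "\<And>v. v \<in> Q \<Longrightarrow>
      \<exists>N i s. open N \<and> v \<in> N \<and> continuous_on (N \<inter> Q) s \<and> (\<forall>w\<in>N \<inter> Q. s w \<in> F i w)"
    and T_mem: "\<And>i j u v z z' w. \<lbrakk>u \<in> Q; v \<in> Q; z \<in> F i u; z' \<in> F j u; w \<in> F i v\<rbrakk> \<Longrightarrow> T z z' w \<in> F j v"
    and T_eq: "\<And>i j u z z'. \<lbrakk>u \<in> Q; z \<in> F i u; z' \<in> F j u\<rbrakk> \<Longrightarrow> T z z' z = z'"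
    and T_cont: "continuous_on {(z, z', w). \<exists>i j u v. u \<in> Q \<and> v \<in> Q \<and> z \<in> F i u \<and> z' \<in> F j u \<and> w \<in> F i v}
      (\<lambda>(z, z', w). T z z' w)"
  shows "\<exists>i s. continuous_on Q s \<and> (\<forall>v\<in>Q. s v \<in> F i v)"
proof -
  define sec where "sec S \<longleftrightarrow> (\<exists>i s. continuous_on S s \<and> (\<forall>v\<in>S. s v \<in> F i v))" for S
  have sec_subset: "sec S" if "sec S'" "S \<subseteq> S'" for S S'
    using that unfolding sec_def by (meson continuous_on_subset subset_iff)
  have strip: "\<exists>\<epsilon>>0. sec (({0..1} \<times> {t-\<epsilon><..<t+\<epsilon>}) \<inter> Q)" if t: "0 \<le> t" "t \<le> 1" for t
  proof -
    \<comment> \<open>\<open>Bolzano\<close> is bisection: \<open>P\<close> passes to unions of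
      adjacent intervals and holds for all short intervals around each point. The premise inside
      \<open>P\<close> makes it vacuous for intervals that leave \<open>{0..1}\<close>. The height
      \<open>\<epsilon>\<close> is existential because it shrinks at each gluing.\<close>
    define P where "P a b \<longleftrightarrow> (0 \<le> a \<and> a \<le> b \<and> b \<le> 1 \<longrightarrow> (\<exists>\<epsilon>>0. sec (({a..b} \<times> {t-\<epsilon><..<t+\<epsilon>}) \<inter> Q)))" for a b
    have "(0::real) \<le> 1" by simp
    then have "P 0 1"
    proof (induction rule: Bolzano)
      case (trans a b c)
      show ?case unfolding P_def
      proof
        assume ac: "0 \<le> a \<and> a \<le> c \<and> c \<le> 1"
        obtain \<epsilon> \<epsilon>' where e: "\<epsilon> > 0" "\<epsilon>' > 0" "sec (({a..b} \<times> {t-\<epsilon><..<t+\<epsilon>}) \<inter> Q)"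
          "sec (({b..c} \<times> {t-\<epsilon>'<..<t+\<epsilon>'}) \<inter> Q)"
          using trans ac unfolding P_def by auto
        define \<delta> where "\<delta> = min \<epsilon> \<epsilon>'"
        define S where "S = ({a..c} \<times> {t-\<delta><..<t+\<delta>}) \<inter> Q"
        have "sec {v \<in> S. fst v \<le> b}" "sec {v \<in> S. b \<le> fst v}"
          by (rule sec_subset[OF e(3)], force simp: S_def \<delta>_def)
            (rule sec_subset[OF e(4)], force simp: S_def \<delta>_def)
        then obtain i s j s' where 
          s: "continuous_on {v \<in> S. fst v \<le> b} s" "\<forall>v\<in>{v \<in> S. fst v \<le> b}. s v \<in> F i v" and
          s': "continuous_on {v \<in> S. b \<le> fst v} s'" "\<forall>v\<in>{v \<in> S. b \<le> fst v}. s' v \<in> F j v"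
          unfolding sec_def by blast
        have "\<exists>s. continuous_on S s \<and> (\<forall>v\<in>S. s v \<in> F i v)"
        proof (rule glue_sections[OF s(1) _ s'(1), where j = j and r = "\<lambda>v. (b, snd v)" and Q = Q])
          show "continuous_on S fst" "continuous_on {v \<in> S. b \<le> fst v} (\<lambda>v. (b, snd v))"
            by (intro continuous_intros)+
        qed (use s(2) s'(2) trans ac T_mem T_eq T_cont in \<open>auto simp: S_def Q_def\<close>)
        then have "sec S" unfolding sec_def by blast
        moreover have "\<delta> > 0" using e by (simp add: \<delta>_def)
        ultimately show "\<exists>\<epsilon>>0. sec (({a..c} \<times> {t-\<epsilon><..<t+\<epsilon>}) \<inter> Q)" unfolding S_def by blast
      qed
    next
      case (local x)
      then have "(x, t) \<in> Q" using t by (auto simp: Q_def)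
      then obtain N i s where N: "open N" "(x, t) \<in> N" "continuous_on (N \<inter> Q) s" "\<forall>w\<in>N \<inter> Q. s w \<in> F i w"
        using assms(2) by blast
      obtain A B where AB: "open A" "open B" "x \<in> A" "t \<in> B" "A \<times> B \<subseteq> N"
        using N(1,2) by (metis open_prod_elim mem_Sigma_iff)
      obtain d where d: "d > 0" "ball x d \<subseteq> A" using AB open_contains_ball by metis
      obtain \<epsilon> where \<epsilon>: "\<epsilon> > 0" "ball t \<epsilon> \<subseteq> B" using AB open_contains_ball by metis
      have N': "sec (N \<inter> Q)" using N(3,4) unfolding sec_def by blast
      show ?case
      proof (intro exI conjI allI impI)
        fix a b assume ab: "a \<le> x \<and> x \<le> b \<and> b - a < d"
        then have "{a..b} \<subseteq> ball x d" by (auto simp: dist_real_def)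
        moreover have "{t-\<epsilon><..<t+\<epsilon>} \<subseteq> ball t \<epsilon>" by (auto simp: dist_real_def)
        ultimately have "({a..b} \<times> {t-\<epsilon><..<t+\<epsilon>}) \<inter> Q \<subseteq> N \<inter> Q" using d \<epsilon> AB(5) by blast
        then show "P a b" unfolding P_def using sec_subset[OF N'] \<epsilon>(1) by blast
      qed (rule d)
    qed
    then show ?thesis unfolding P_def by simp
  qed
  \<comment> \<open>The same bisection in the other coordinate: strips of full width are now glued
    along horizontal segments.\<close>
  define P where "P a b \<longleftrightarrow> (0 \<le> a \<and> a \<le> b \<and> b \<le> 1 \<longrightarrow> sec ({0..1} \<times> {a..b}))" for a b
  have "(0::real) \<le> 1" by simp
    then have "P 0 1"
  proof (induction rule: Bolzano)
    case (trans a b c)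
    show ?case unfolding P_def
    proof
      assume ac: "0 \<le> a \<and> a \<le> c \<and> c \<le> 1"
      then have e: "sec ({0..1} \<times> {a..b})" "sec ({0..1} \<times> {b..c})"
        using trans unfolding P_def by auto
      define S where "S = {0..1::real} \<times> {a..c}"
      have "sec {v \<in> S. snd v \<le> b}" "sec {v \<in> S. b \<le> snd v}"
        by (rule sec_subset[OF e(1)], force simp: S_def) (rule sec_subset[OF e(2)], force simp: S_def)
      then obtain i s j s' where 
        s: "continuous_on {v \<in> S. snd v \<le> b} s" "\<forall>v\<in>{v \<in> S. snd v \<le> b}. s v \<in> F i v" and
        s': "continuous_on {v \<in> S. b \<le> snd v} s'" "\<forall>v\<in>{v \<in> S. b \<le> snd v}. s' v \<in> F j v"
        unfolding sec_def by blast
      have "\<exists>s. continuous_on S s \<and> (\<forall>v\<in>S. s v \<in> F i v)"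
      proof (rule glue_sections[OF s(1) _ s'(1), where j = j and r = "\<lambda>v. (fst v, b)" and Q = Q])
        show "continuous_on S snd" "continuous_on {v \<in> S. b \<le> snd v} (\<lambda>v. (fst v, b))"
          by (intro continuous_intros)+
      qed (use s(2) s'(2) trans ac T_mem T_eq T_cont in \<open>auto simp: S_def Q_def\<close>)
      then show "sec ({0..1} \<times> {a..c})" unfolding sec_def S_def by blast
    qed
  next
    case (local t)
    obtain \<epsilon> where \<epsilon>: "\<epsilon> > 0" "sec (({0..1} \<times> {t-\<epsilon><..<t+\<epsilon>}) \<inter> Q)" using strip local by blast
    show ?case
    proof (intro exI conjI allI impI)
      fix a b assume ab: "a \<le> t \<and> t \<le> b \<and> b - a < \<epsilon>"
      show "P a b" unfolding P_def
      proof
        assume "0 \<le> a \<and> a \<le> b \<and> b \<le> 1"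
        then have "{0..1} \<times> {a..b} \<subseteq> ({0..1} \<times> {t-\<epsilon><..<t+\<epsilon>}) \<inter> Q" using ab by (auto simp: Q_def)
        then show "sec ({0..1} \<times> {a..b})" using sec_subset[OF \<epsilon>(2)] by blast
      qed
    qed (rule \<epsilon>)
  qed
  then show ?thesis unfolding P_def sec_def Q_def by simp
qed

section \<open>\<open>C\<^sup>1\<close> functions\<close>

text \<open>Shaped after the premises of \<open>inverse_function_theorem\<close>, which wants the
  derivative as a continuous map into the bounded linear maps. As a property of germs it composes
  without bookkeeping of domains.\<close>

definition C1_at :: "('a::real_normed_vector \<Rightarrow> 'b::real_normed_vector) \<Rightarrow> 'a \<Rightarrow> bool" where
  "C1_at f x \<longleftrightarrow> (\<exists>U f'. open U \<and> x \<in> U \<and> continuous_on U f' \<and>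
     (\<forall>v\<in>U. (f has_derivative blinfun_apply (f' v)) (at v)))"

lemma C1_at_imp_has_derivative: "C1_at f x \<Longrightarrow> \<exists>D. (f has_derivative D) (at x)"
  unfolding C1_at_def by blast

lemma C1_at_imp_continuous:
  assumes "C1_at f x"
  obtains U where "open U" "x \<in> U" "continuous_on U f"
  using assms unfolding C1_at_def
  by (metis continuous_at_imp_continuous_on has_derivative_continuous)

lemma C1_at_bounded_linear: "bounded_linear f \<Longrightarrow> C1_at f x"
  unfolding C1_at_def
  by (rule exI[of _ UNIV], rule exI[of _ "\<lambda>_. Blinfun f"])
    (auto simp: bounded_linear_Blinfun_apply bounded_linear_imp_has_derivative)

lemma C1_at_const: "C1_at (\<lambda>_. c) x"
  unfolding C1_at_def
  by (rule exI[of _ UNIV], rule exI[of _ "\<lambda>_. 0"]) (auto simp: zero_blinfun.rep_eq)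

lemma C1_at_id: "C1_at (\<lambda>v. v) x"
  by (intro C1_at_bounded_linear bounded_linear_ident)

lemma C1_at_add:
  assumes "C1_at f x" "C1_at g x"
  shows "C1_at (\<lambda>v. f v + g v) x"
proof -
  obtain U f' where U: "open U" "x \<in> U" "continuous_on U f'"
    "\<forall>v\<in>U. (f has_derivative blinfun_apply (f' v)) (at v)"
    using assms(1) unfolding C1_at_def by blast
  obtain V g' where V: "open V" "x \<in> V" "continuous_on V g'"
    "\<forall>v\<in>V. (g has_derivative blinfun_apply (g' v)) (at v)"
    using assms(2) unfolding C1_at_def by blast
  have "((\<lambda>v. f v + g v) has_derivative blinfun_apply (f' v + g' v)) (at v)" if "v \<in> U \<inter> V" for v
    using has_derivative_add[of f _ "at v" g] U V that by (simp add: plus_blinfun.rep_eq)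
  moreover have "open (U \<inter> V)" "x \<in> U \<inter> V" "continuous_on (U \<inter> V) (\<lambda>v. f' v + g' v)"
    using U V continuous_on_subset by (blast, blast, auto intro!: continuous_intros elim: continuous_on_subset)
  ultimately show ?thesis unfolding C1_at_def by (intro exI[of _ "U \<inter> V"] exI[of _ "\<lambda>v. f' v + g' v"]) blast
qed

lemma C1_at_compose:
  assumes "C1_at f x" "C1_at g (f x)"
  shows "C1_at (\<lambda>v. g (f v)) x"
proof -
  obtain U f' where U: "open U" "x \<in> U" "continuous_on U f'"
    "\<forall>v\<in>U. (f has_derivative blinfun_apply (f' v)) (at v)"
    using assms(1) unfolding C1_at_def by blast
  obtain V g' where V: "open V" "f x \<in> V" "continuous_on V g'"
    "\<forall>v\<in>V. (g has_derivative blinfun_apply (g' v)) (at v)"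
    using assms(2) unfolding C1_at_def by blast
  have contf: "continuous_on U f"
    using U by (meson continuous_at_imp_continuous_on has_derivative_continuous)
  define W where "W = f -` V \<inter> U"
  have W: "open W" "x \<in> W" "W \<subseteq> U" "f ` W \<subseteq> V"
    using contf U V by (auto simp: W_def continuous_on_open_vimage)
  have "((\<lambda>v. g (f v)) has_derivative blinfun_apply (g' (f v) o\<^sub>L f' v)) (at v)" if "v \<in> W" for v
    using diff_chain_at[of f "f' v" v g "g' (f v)"] U(4) V(4) W(3,4) that
    by (auto simp: o_def blinfun_compose.rep_eq image_subset_iff subset_iff)
  moreover have "continuous_on W (\<lambda>v. g' (f v))"
    by (rule continuous_on_compose2[OF V(3) continuous_on_subset[OF contf W(3)] W(4)])
  then have "continuous_on W (\<lambda>v. g' (f v) o\<^sub>L f' v)"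
    by (intro continuous_intros continuous_on_subset[OF U(3) W(3)])
  ultimately show ?thesis unfolding C1_at_def
    using W by (intro exI[of _ W] exI[of _ "\<lambda>v. g' (f v) o\<^sub>L f' v"]) blast
qed

lemma C1_at_linear_compose: "C1_at f x \<Longrightarrow> bounded_linear L \<Longrightarrow> C1_at (\<lambda>v. L (f v)) x"
  using C1_at_compose C1_at_bounded_linear by blast

lemma C1_at_diff: "C1_at f x \<Longrightarrow> C1_at g x \<Longrightarrow> C1_at (\<lambda>v. f v - g v) x"
  using C1_at_add[of f x "\<lambda>v. - g v"] C1_at_linear_compose[of g x uminus]
  by (simp add: bounded_linear_minus bounded_linear_ident)

lemma C1_at_sum: "(\<And>i. i \<in> I \<Longrightarrow> C1_at (f i) x) \<Longrightarrow> C1_at (\<lambda>v. \<Sum>i\<in>I. f i v) x"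
  by (induction I rule: infinite_finite_induct) (auto intro: C1_at_add C1_at_const)

lemma C1_at_Pair:
  assumes "C1_at f x" "C1_at g x"
  shows "C1_at (\<lambda>v. (f v, g v)) x"
proof -
  have "C1_at (\<lambda>v. (f v, 0) + (0, g v)) x"
    by (intro C1_at_add C1_at_linear_compose[OF assms(1), of "\<lambda>a. (a, 0)"]
        C1_at_linear_compose[OF assms(2), of "\<lambda>b. (0, b)"] bounded_linear_Pair
        bounded_linear_ident bounded_linear_zero)
  then show ?thesis by simp
qed

text \<open>\<open>Ck_on\<close> controls the derivative one direction at a time. In finite
  dimension, continuity in each basis direction is continuity in the operator norm.\<close>

lemma Ck_on_imp_C1_at:
  fixes F :: "'a::euclidean_space \<Rightarrow> 'b::real_normed_vector"
  assumes F: "\<forall>k. Ck_on k U F" and U: "open U" "x \<in> U"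
  shows "C1_at F x"
proof -
  have F1: "F differentiable_on U" "\<And>v. continuous_on U (\<lambda>x. frechet_derivative F (at x) v)"
    using F[rule_format, of "Suc 0"] by auto
  have D: "(F has_derivative frechet_derivative F (at v)) (at v)" if "v \<in> U" for v
    using F1(1) U that by (metis at_within_open differentiable_on_def frechet_derivative_works)
  have Bl: "blinfun_apply (Blinfun (frechet_derivative F (at v))) = frechet_derivative F (at v)" if "v \<in> U" for v
    using D[OF that] by (simp add: bounded_linear_Blinfun_apply has_derivative_bounded_linear)
  have "continuous_on U (\<lambda>v. Blinfun (frechet_derivative F (at v)))"
  proof (rule continuous_on_blinfun_componentwise)
    fix i :: 'a
    show "continuous_on U (\<lambda>v. blinfun_apply (Blinfun (frechet_derivative F (at v))) i)"
      using F1(2)[of i] Bl by (simp cong: continuous_on_cong)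
  qed
  then show ?thesis unfolding C1_at_def using D U Bl by (intro exI[of _ U]) auto
qed

text \<open>In finite dimension an injective derivative has a linear left inverse, which is what the
  inverse function theorem asks for. The later application thus only has to check that a kernel is
  zero.\<close>

lemma C1_local_homeomorphism:
  fixes f :: "'a::euclidean_space \<Rightarrow> 'a"
  assumes "C1_at f x" and D: "(f has_derivative D) (at x)" "\<And>w. D w = 0 \<Longrightarrow> w = 0"
  obtains U V g where "open U" "x \<in> U" "open V" "f x \<in> V" "homeomorphism U V f g"
proof -
  obtain U f' where U: "open U" "x \<in> U" "continuous_on U f'"
    "\<And>v. v \<in> U \<Longrightarrow> (f has_derivative blinfun_apply (f' v)) (at v)"
    using assms(1) unfolding C1_at_def by blast
  have D': "D = blinfun_apply (f' x)"
    using U D(1) has_derivative_unique by blast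
  have "linear D" using D(1) has_derivative_linear by blast
  moreover from this have "inj D" using D(2) linear_injective_0 by blast
  ultimately obtain g where g: "linear g" "g \<circ> D = id"
    using linear_injective_left_inverse by blast
  have "Blinfun g o\<^sub>L f' x = id_blinfun"
    by (rule blinfun_eqI)
      (use g D' in \<open>auto simp: bounded_linear_Blinfun_apply linear_linear id_def o_def fun_eq_iff\<close>)
  with inverse_function_theorem[OF U(1) U(4) U(3) U(2)] show thesis
    using that by metis
qed

section \<open>Equivariant local sections\<close>

text \<open>
  Here \<open>\<theta>\<close> is a germ of an action of \<open>K\<close> on the range of the projection \<open>P\<close>, fixing \<open>v0\<close>, and \<open>F\<close>
  is equivariant. Averaging a projection onto the kernel of the derivative of \<open>F\<close> gives a map \<open>Q\<close>
  with \<open>K\<close>-invariant zero set, and \<open>\<sigma> t\<close> is the only solution near \<open>v0\<close> of \<open>F v = t\<close> and \<open>Q v = 0\<close>;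
  it is fixed by \<open>K\<close> if \<open>t\<close> is.
\<close>

lemma equivariant_local_right_inverse:
  fixes F :: "'e::euclidean_space \<Rightarrow> 'c::euclidean_space" and \<theta> :: "'k \<Rightarrow> 'e \<Rightarrow> 'e" and P :: "'e \<Rightarrow> 'e"
    and K :: "('k, 'z) monoid_scheme" (structure)
  assumes K: "group K" "finite (carrier K)"
    and P: "linear P" "P v0 = v0"
    and F: "C1_at F v0" "(F has_derivative D) (at v0)" "range D = T"
    and \<theta>: "\<And>k. k \<in> carrier K \<Longrightarrow> C1_at (\<theta> k) v0" "\<And>k. k \<in> carrier K \<Longrightarrow> \<theta> k v0 = v0"
    and \<psi>: "\<And>k. k \<in> carrier K \<Longrightarrow> (\<psi> k has_derivative B k) (at (F v0))"
    and N: "open N" "v0 \<in> N"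
    and N_mult: "\<And>v k l. v \<in> N \<Longrightarrow> k \<in> carrier K \<Longrightarrow> l \<in> carrier K \<Longrightarrow> \<theta> k (\<theta> l v) = \<theta> (k \<otimes> l) v"
    and N_one: "\<And>v. v \<in> N \<Longrightarrow> \<theta> \<one> v = P v"
    and N_F: "\<And>v. v \<in> N \<Longrightarrow> F v - F v0 \<in> T" "\<And>v. v \<in> N \<Longrightarrow> F (P v) = F v"
    and N_equiv: "\<And>v k. v \<in> N \<Longrightarrow> k \<in> carrier K \<Longrightarrow> F (\<theta> k v) = \<psi> k (F v)"
  shows "\<exists>V \<sigma>. open V \<and> F v0 \<in> V \<and> continuous_on V \<sigma> \<and>
    (\<forall>t\<in>V. t - F v0 \<in> T \<longrightarrow> \<sigma> t \<in> N \<and> P (\<sigma> t) = \<sigma> t \<and> F (\<sigma> t) = t \<and>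
       ((\<forall>k\<in>carrier K. \<psi> k t = t) \<longrightarrow> (\<forall>k\<in>carrier K. \<theta> k (\<sigma> t) = \<sigma> t)))"
proof -
  interpret K: group K by fact
  interpret P: linear P by fact
  obtain A where A: "\<And>k. k \<in> carrier K \<Longrightarrow> (\<theta> k has_derivative A k) (at v0)"
    using C1_at_imp_has_derivative[OF \<theta>(1)] by metis
  have linA: "linear (A k)" if "k \<in> carrier K" for k using A[OF that] has_derivative_linear by blast
  have linD: "linear D" using F(2) has_derivative_linear by blast
  interpret D: linear D by fact
  \<comment> \<open>Differentiated at its fixed point, the action becomes a representation
    \<open>A\<close> of \<open>K\<close> on the range of \<open>P\<close>; the identity of
    \<open>K\<close> acts on the ambient space as \<open>P\<close>.\<close>
  have A_mult: "A k (A l w) = A (k \<otimes> l) w" if kl: "k \<in> carrier K" "l \<in> carrier K" for k l w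
  proof -
    have "((\<lambda>v. \<theta> k (\<theta> l v)) has_derivative (\<lambda>w. A k (A l w))) (at v0)"
      using diff_chain_at[OF A[OF kl(2)], of "\<theta> k" "A k"] A[OF kl(1)] \<theta>(2)[OF kl(2)] by (simp add: o_def)
    then have "(\<theta> (k \<otimes> l) has_derivative (\<lambda>w. A k (A l w))) (at v0)"
      by (rule has_derivative_transform_within_open[OF _ N]) (use N_mult kl in auto)
    from fun_cong[OF has_derivative_unique[OF this A]] show ?thesis using kl by simp
  qed
  have A_one: "A \<one> = P"
  proof -
    have "(P has_derivative A \<one>) (at v0)"
      by (rule has_derivative_transform_within_open[OF A N]) (use N_one in auto)
    moreover have "(P has_derivative P) (at v0)"
      using P(1) by (simp add: bounded_linear_imp_has_derivative linear_conv_bounded_linear)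
    ultimately show ?thesis using has_derivative_unique by blast
  qed
  have PA: "P (A k w) = A k w" if "k \<in> carrier K" for k w
    using A_mult[OF K.one_closed that] that by (simp add: A_one)
  have PP: "P (P w) = P w" for w using PA[of \<one> w] by (simp add: A_one)
  \<comment> \<open>The chain rule for \<open>F (\<theta> k v) = \<psi> k (F v)\<close> makes the
    kernel of \<open>D\<close> invariant under \<open>K\<close>.\<close>
  have DA: "D (A k w) = 0" if k: "k \<in> carrier K" and w: "D w = 0" for k w
  proof -
    have "((\<lambda>v. F (\<theta> k v)) has_derivative (\<lambda>w. D (A k w))) (at v0)"
      using diff_chain_at[OF A[OF k], of F D] F(2) \<theta>(2)[OF k] by (simp add: o_def)
    then have 1: "((\<lambda>v. \<psi> k (F v)) has_derivative (\<lambda>w. D (A k w))) (at v0)"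
      by (rule has_derivative_transform_within_open[OF _ N]) (use N_equiv k in auto)
    have 2: "((\<lambda>v. \<psi> k (F v)) has_derivative (\<lambda>w. B k (D w))) (at v0)"
      using diff_chain_at[OF F(2) \<psi>[OF k]] by (simp add: o_def)
    from fun_cong[OF has_derivative_unique[OF 1 2]] show ?thesis
      using w linear_0[OF has_derivative_linear[OF \<psi>[OF k]]] by simp
  qed
  have DP: "D (P w) = D w" for w
  proof -
    have "(P has_derivative P) (at v0)"
      using P(1) by (simp add: bounded_linear_imp_has_derivative linear_conv_bounded_linear)
    then have "((\<lambda>v. F (P v)) has_derivative (\<lambda>w. D (P w))) (at v0)"
      using diff_chain_at[of P P v0 F D] F(2) P(2) by (simp add: o_def)
    then have "(F has_derivative (\<lambda>w. D (P w))) (at v0)"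
      by (rule has_derivative_transform_within_open[OF _ N]) (use N_F in auto)
    from fun_cong[OF has_derivative_unique[OF this F(2)]] show ?thesis .
  qed
  have "subspace (range P)" using linear_subspace_image[OF P(1)] subspace_UNIV by blast
  then obtain R where R: "range R \<subseteq> range P" "linear R" "\<forall>v\<in>D ` range P. D (R v) = v"
    using linear_exists_right_inverse_on[OF linD] by blast
  interpret R: linear R by fact
  have PR: "P (R t) = R t" for t using R(1) PP by (metis imageE rangeI subset_iff)
  have DR: "D (R t) = t" if "t \<in> T" for t using R(3) that F(3) DP by (metis imageE image_eqI rangeI)
  have DT: "D w \<in> T" for w using F(3) by blast
  have K_ne: "card (carrier K) \<noteq> 0" using K K.one_closed by auto
  \<comment> \<open>On the range of \<open>P\<close> this is the projection onto the part of the
    kernel of \<open>D\<close> that lies there, along the image of \<open>T\<close> under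
    \<open>R\<close>. It need not commute with \<open>K\<close>; the average in \<open>Q\<close>
    repairs this.\<close>
  define \<pi> where "\<pi> w = P w - R (D w)" for w
  have lin\<pi>: "linear \<pi>" unfolding \<pi>_def
    using P(1) linear_compose[OF linD R(2)] linear_compose_sub by (auto simp: o_def)
  have D\<pi>: "D (\<pi> w) = 0" for w unfolding \<pi>_def by (simp add: D.diff DP DR DT)
  \<comment> \<open>An average of a nonlinear map, up to the factor 1/|K|. Replacing
    \<open>v\<close> by \<open>\<theta> k v\<close> replaces \<open>Q v\<close> by
    \<open>A k (Q v)\<close>, so the zero set of \<open>Q\<close> is invariant. On vectors of the
    kernel of \<open>D\<close> that are fixed by \<open>P\<close>, the derivative \<open>DQ\<close>
    is multiplication by |K|.\<close>
  define Q where "Q v = (\<Sum>k\<in>carrier K. A (inv k) (\<pi> (\<theta> k v - v0)))" for v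
  \<comment> \<open>For \<open>v\<close> in \<open>N\<close> the summands lie in three independent
    subspaces: the image of \<open>T\<close> under \<open>R\<close>, the part of the kernel of
    \<open>D\<close> in the range of \<open>P\<close>, and the kernel of \<open>P\<close>. The last
    summand makes \<open>\<Phi>\<close> a map of the ambient space to itself with injective
    derivative, although only the range of \<open>P\<close> carries geometry.\<close>
  define \<Phi> where "\<Phi> v = R (F v - F v0) + Q v + (v - P v)" for v
  define DQ where "DQ w = (\<Sum>k\<in>carrier K. A (inv k) (\<pi> (A k w)))" for w
  define D\<Phi> where "D\<Phi> w = R (D w) + DQ w + (w - P w)" for w
  have blA: "bounded_linear (A k)" if "k \<in> carrier K" for k using linA[OF that] by (simp add: linear_linear)
  have bl: "bounded_linear R" "bounded_linear P" "bounded_linear \<pi>" using R(2) P(1) lin\<pi> by (simp_all add: linear_linear)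
  have "C1_at \<Phi> v0" unfolding \<Phi>_def Q_def
    by (intro C1_at_add C1_at_diff C1_at_sum C1_at_id C1_at_const F(1) \<theta>(1)
        C1_at_linear_compose[OF _ bl(1)] C1_at_linear_compose[OF _ bl(2)] C1_at_linear_compose[OF _ bl(3)]
        C1_at_linear_compose[OF _ blA] K.inv_closed)
  moreover have "(\<Phi> has_derivative D\<Phi>) (at v0)" unfolding \<Phi>_def D\<Phi>_def Q_def DQ_def
    by (intro has_derivative_add has_derivative_diff has_derivative_sum has_derivative_ident
        bounded_linear.has_derivative[OF bl(1)] bounded_linear.has_derivative[OF bl(2)]
        bounded_linear.has_derivative[OF bl(3)] bounded_linear.has_derivative[OF blA])
      (use F(2) A in \<open>auto intro!: derivative_eq_intros\<close>)
  moreover have PQ: "P (Q v) = Q v" "D (Q v) = 0" "P (DQ v) = DQ v" "D (DQ v) = 0" for v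
    unfolding Q_def DQ_def P.sum D.sum by (simp_all add: PA DA D\<pi>)
  \<comment> \<open>\<open>P\<close> separates the last summand from the others; then
    \<open>D\<close> separates the first, since it annihilates \<open>Q\<close>.\<close>
  have PRQ: "v - P v = 0" "F v = F v0 + D (\<Phi> v)" "Q v = 0"
    if eq: "\<Phi> v = R t" and t: "t \<in> T" and v: "v \<in> N" for v t
  proof -
    have "P (\<Phi> v) = R (F v - F v0) + Q v" unfolding \<Phi>_def by (simp add: P.add P.diff PR PQ PP)
    then show 1: "v - P v = 0" using eq PR[of t] unfolding \<Phi>_def by simp
    then have "D (\<Phi> v) = D (R (F v - F v0)) + D (Q v)" unfolding \<Phi>_def by (simp add: D.add)
    then show 2: "F v = F v0 + D (\<Phi> v)" using DR N_F(1)[OF v] PQ by simp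
    then show "Q v = 0" using eq 1 unfolding \<Phi>_def by (simp add: DR[OF t])
  qed
  have "w = 0" if w: "D\<Phi> w = 0" for w
  proof -
    have "P (D\<Phi> w) = R (D w) + DQ w" unfolding D\<Phi>_def by (simp add: P.add P.diff PR PQ PP)
    then have 1: "P w = w" "R (D w) + DQ w = 0" using w P.zero unfolding D\<Phi>_def by auto
    then have "D (R (D w)) = 0" using D.add[of "R (D w)" "DQ w"] PQ D.zero by simp
    then have Dw: "D w = 0" using DR DT by simp
    then have "\<pi> (A k w) = A k w" if "k \<in> carrier K" for k
      using PA DA that R.zero by (simp add: \<pi>_def)
    then have "DQ w = (\<Sum>k\<in>carrier K. w)" unfolding DQ_def
      by (intro sum.cong) (simp_all add: A_mult A_one 1)
    then show "w = 0" using 1(2) Dw R.zero K_ne by (simp add: scaleR_conv_of_real sum_constant_scaleR)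
  qed
  ultimately obtain U W g where UW: "open U" "v0 \<in> U" "open W" "\<Phi> v0 \<in> W" "homeomorphism U W \<Phi> g"
    using C1_local_homeomorphism by blast
  have \<Phi>0: "\<Phi> v0 = 0"
  proof -
    have "A (inv k) (\<pi> 0) = 0" if "k \<in> carrier K" for k
      using linear_0[OF lin\<pi>] linear_0[OF linA] that by simp
    then show ?thesis unfolding \<Phi>_def Q_def using \<theta>(2) P(2) R.zero by simp
  qed
  \<comment> \<open>The translates \<open>\<theta> k v\<close> have to stay in \<open>U\<close>,
    where \<open>\<Phi>\<close> is injective, so that they can be compared with
    \<open>v\<close>.\<close>
  have "\<exists>J. open J \<and> v0 \<in> J \<and> (\<forall>v\<in>J. \<theta> k v \<in> U \<inter> N)" if k: "k \<in> carrier K" for k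
  proof -
    obtain J where J: "open J" "v0 \<in> J" "continuous_on J (\<theta> k)"
      using C1_at_imp_continuous[OF \<theta>(1)[OF k]] .
    have "open (\<theta> k -` (U \<inter> N) \<inter> J)"
      using continuous_on_open_vimage[OF J(1), of "\<theta> k"] J(3) open_Int[OF UW(1) N(1)] by blast
    then show ?thesis using J UW(2) N(2) \<theta>(2)[OF k] by (intro exI[of _ "\<theta> k -` (U \<inter> N) \<inter> J"]) auto
  qed
  then obtain J where J: "\<And>k. k \<in> carrier K \<Longrightarrow> open (J k)" "\<And>k. k \<in> carrier K \<Longrightarrow> v0 \<in> J k"
     "\<And>k v. k \<in> carrier K \<Longrightarrow> v \<in> J k \<Longrightarrow> \<theta> k v \<in> U \<inter> N" by metis
  define U0 where "U0 = U \<inter> N \<inter> (\<Inter>k\<in>carrier K. J k)"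
  have U0: "open U0" "v0 \<in> U0" "U0 \<subseteq> U"
    unfolding U0_def using UW N J K(2) by (auto intro!: open_Int open_INT)
  have "openin (top_of_set W) (\<Phi> ` U0)"
    using homeomorphism_imp_open_map[OF UW(5)] U0 by (simp add: open_subset)
  then have op: "open (\<Phi> ` U0)" using UW(3) by (metis openin_open_trans)
  have contR: "continuous_on S (\<lambda>t. R (t - F v0))" for S
    using linear_continuous_on_compose[OF _ R(2)] by (intro linear_continuous_on_compose[OF _ R(2)] continuous_intros)
  define V where "V = (\<lambda>t. R (t - F v0)) -` (\<Phi> ` U0)"
  define \<sigma> where "\<sigma> t = g (R (t - F v0))" for t
  have V: "open V" "F v0 \<in> V"
    unfolding V_def using op contR[of UNIV] U0(2) \<Phi>0 R.zero
    by (auto simp: open_vimage image_iff intro!: bexI[of _ v0])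
  have \<sigma>: "\<sigma> t \<in> U0" "\<Phi> (\<sigma> t) = R (t - F v0)" if "t \<in> V" for t
    using that homeomorphism_apply1[OF UW(5)] U0(3) unfolding V_def \<sigma>_def by auto
  have "continuous_on V \<sigma>" unfolding \<sigma>_def
    by (rule continuous_on_compose2[OF homeomorphism_cont2[OF UW(5)] contR])
       (use U0(3) homeomorphism_image1[OF UW(5)] in \<open>auto simp: V_def\<close>)
  moreover have F\<sigma>: "\<sigma> t \<in> N \<and> P (\<sigma> t) = \<sigma> t \<and> F (\<sigma> t) = t" if "t \<in> V" "t - F v0 \<in> T" for t
    using PRQ[of "\<sigma> t" "t - F v0"] \<sigma>[OF that(1)] that(2) DR[of "t - F v0"] by (auto simp: U0_def)
  moreover have "\<theta> k (\<sigma> t) = \<sigma> t"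
    if t: "t \<in> V" "t - F v0 \<in> T" and inv_t: "\<forall>k\<in>carrier K. \<psi> k t = t" and k: "k \<in> carrier K" for t k
  proof -
    define v where "v = \<sigma> t"
    have v: "v \<in> U" "v \<in> N" "\<theta> k v \<in> U" "\<theta> k v \<in> N" "\<Phi> v = R (t - F v0)" "F v = t" "Q v = 0"
      using \<sigma>[OF t(1)] F\<sigma>[OF t] J(3)[OF k] k PRQ(3)[of v "t - F v0"] t(2) unfolding U0_def v_def by auto
    have k_inv: "k \<otimes> (inv k \<otimes> a) = a" if "a \<in> carrier K" for a
      using k that by (simp flip: K.m_assoc)
    \<comment> \<open>Reindexing by \<open>j = l k\<close> gives
      \<open>Q (\<theta> k v) = A k (Q v) = 0\<close>. Then \<open>\<theta> k v\<close> solves the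
      same equations as \<open>v\<close>, and injectivity of \<open>\<Phi>\<close> makes the two
      equal.\<close>
    have "Q (\<theta> k v) = (\<Sum>l\<in>carrier K. A (inv l) (\<pi> (\<theta> (l \<otimes> k) v - v0)))"
      unfolding Q_def using v k by (simp add: N_mult)
    also have "\<dots> = (\<Sum>j\<in>carrier K. A (k \<otimes> inv j) (\<pi> (\<theta> j v - v0)))"
      by (rule sum.reindex_bij_witness[of _ "\<lambda>j. j \<otimes> inv k" "\<lambda>l. l \<otimes> k"])
        (use k K.inv_closed[OF k] in \<open>auto simp: K.inv_mult_group K.m_assoc k_inv\<close>)
    also have "\<dots> = A k (Q v)"
      unfolding Q_def linear_sum[OF linA[OF k]] by (intro sum.cong) (use k in \<open>auto simp: A_mult\<close>)
    finally have "Q (\<theta> k v) = 0" using v(7) linear_0[OF linA[OF k]] by simp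
    moreover have "P (\<theta> k v) = \<theta> k v"
      using N_one[OF v(4)] N_mult[OF v(2) K.one_closed k] k by simp
    moreover have "F (\<theta> k v) = t" using N_equiv[OF v(2) k] v(6) inv_t k by simp
    ultimately have "\<Phi> (\<theta> k v) = \<Phi> v" unfolding v(5) by (simp add: \<Phi>_def)
    then show ?thesis using homeomorphism_apply1[OF UW(5)] v unfolding v_def by metis
  qed
  ultimately show ?thesis using V by (intro exI[of _ V] exI[of _ \<sigma>]) blast
qed

section \<open>Charts, product manifolds and \<open>C^1\<close> maps\<close>

text \<open>The conditions that concern single charts, split off because they pass to products;
  group multiplication, actions and the submersion all live on product manifolds.\<close>

definition charted :: "('a::topological_space, 'e::euclidean_space) manifold \<Rightarrow> bool" where
  "charted M \<longleftrightarrow>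
     (\<Union>(U, \<kappa>)\<in>charts M. U) = points M \<and>
     (\<forall>(U, \<kappa>)\<in>charts M.
        openin (top_of_set (points M)) U \<and>
        openin (top_of_set (span (\<kappa> ` U))) (\<kappa> ` U) \<and>
        homeomorphism U (\<kappa> ` U) \<kappa> (inv_into U \<kappa>))"

lemma smooth_manifold_imp_charted: "smooth_manifold M \<Longrightarrow> charted M"
  unfolding smooth_manifold_def charted_def by blast

lemma chartedD:
  assumes "charted M" "(U, \<kappa>) \<in> charts M"
  shows "openin (top_of_set (points M)) U" "openin (top_of_set (span (\<kappa> ` U))) (\<kappa> ` U)"
    "homeomorphism U (\<kappa> ` U) \<kappa> (inv_into U \<kappa>)" "U \<subseteq> points M" "inj_on \<kappa> U"
proof -
  show 1: "openin (top_of_set (points M)) U" "openin (top_of_set (span (\<kappa> ` U))) (\<kappa> ` U)"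
    "homeomorphism U (\<kappa> ` U) \<kappa> (inv_into U \<kappa>)"
    using assms unfolding charted_def by blast+
  show "U \<subseteq> points M" using 1 openin_imp_subset by blast
  show "inj_on \<kappa> U" using homeomorphism_apply1[OF 1(3)] by (metis inj_onI)
qed

lemma charted_obtain:
  assumes "charted M" "p \<in> points M"
  obtains U \<kappa> where "(U, \<kappa>) \<in> charts M" "p \<in> U"
  using assms unfolding charted_def by blast

text \<open>For arbitrary sets the span of a product can be smaller than the product of the spans.
  Openness permits a step from \<open>a\<close> by a nonzero multiple of any \<open>w\<close> in the
  span, and the difference of two points of the product with equal second coordinates isolates
  \<open>(w, 0)\<close>.\<close>

lemma span_Times_openin:
  fixes A :: "'a::real_normed_vector set" and B :: "'b::real_normed_vector set"
  assumes A: "openin (top_of_set (span A)) A" "A \<noteq> {}" and B: "openin (top_of_set (span B)) B" "B \<noteq> {}"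
  shows "span (A \<times> B) = span A \<times> span B"
proof
  show "span (A \<times> B) \<subseteq> span A \<times> span B"
    by (rule span_minimal) (auto intro: span_base subspace_Times)
  have scale: "\<exists>c\<noteq>0. a + c *\<^sub>R w \<in> S" if S: "openin (top_of_set (span S)) S" "a \<in> S" "w \<in> span S"
    for S :: "'c::real_normed_vector set" and a w
  proof -
    obtain e where e: "e > 0" "ball a e \<inter> span S \<subseteq> S"
      using S(1,2) openin_contains_ball by metis
    define c where "c = e / (2 * (norm w + 1))"
    have c: "c > 0" using e(1) by (simp add: c_def add_nonneg_pos)
    have "norm w < 2 * (norm w + 1)" by (simp add: add_nonneg_pos add_strict_increasing)
    then have "c * norm w < e" using e(1) unfolding c_def
      by (simp add: pos_divide_less_eq add_nonneg_pos)
    then have "norm (c *\<^sub>R w) < e" using c by simp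
    then have "a + c *\<^sub>R w \<in> ball a e" by (simp add: dist_norm)
    moreover have "a + c *\<^sub>R w \<in> span S" using span_add[OF span_base[OF S(2)] span_scale[OF S(3)]] .
    ultimately have "a + c *\<^sub>R w \<in> S" using e(2) by blast
    then show ?thesis using c by (intro exI[of _ c]) simp
  qed
  obtain a b where ab: "a \<in> A" "b \<in> B" using A(2) B(2) by blast
  have "(w, 0) \<in> span (A \<times> B)" if w: "w \<in> span A" for w
  proof -
    obtain c where c: "c \<noteq> 0" "a + c *\<^sub>R w \<in> A" using scale[OF A(1) ab(1) w] by blast
    have "(a + c *\<^sub>R w, b) - (a, b) \<in> span (A \<times> B)"
      using ab c by (intro span_diff span_base) auto
    then have "inverse c *\<^sub>R ((a + c *\<^sub>R w, b) - (a, b)) \<in> span (A \<times> B)" by (rule span_scale)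
    then show ?thesis using c(1) by simp
  qed
  moreover have "(0, w) \<in> span (A \<times> B)" if w: "w \<in> span B" for w
  proof -
    obtain c where c: "c \<noteq> 0" "b + c *\<^sub>R w \<in> B" using scale[OF B(1) ab(2) w] by blast
    have "(a, b + c *\<^sub>R w) - (a, b) \<in> span (A \<times> B)"
      using ab c by (intro span_diff span_base) auto
    then have "inverse c *\<^sub>R ((a, b + c *\<^sub>R w) - (a, b)) \<in> span (A \<times> B)" by (rule span_scale)
    then show ?thesis using c(1) by simp
  qed
  ultimately have "(w, 0) + (0, w') \<in> span (A \<times> B)" if "w \<in> span A" "w' \<in> span B" for w w'
    using that span_add by blast
  then show "span A \<times> span B \<subseteq> span (A \<times> B)" by auto
qed

lemma charted_prod:
  assumes M: "charted M" and N: "charted N"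
  shows "charted (prod_manifold M N)"
proof -
  have "(\<Union>(U, \<kappa>)\<in>charts (prod_manifold M N). U) = points (prod_manifold M N)"
  proof
    show "(\<Union>(U, \<kappa>)\<in>charts (prod_manifold M N). U) \<subseteq> points (prod_manifold M N)"
      using chartedD(4)[OF M] chartedD(4)[OF N] by (fastforce simp: prod_manifold_def)
    show "points (prod_manifold M N) \<subseteq> (\<Union>(U, \<kappa>)\<in>charts (prod_manifold M N). U)"
    proof
      fix p assume "p \<in> points (prod_manifold M N)"
      then have "fst p \<in> points M" "snd p \<in> points N" by (auto simp: prod_manifold_def)
      then obtain U \<kappa> W \<mu> where "(U, \<kappa>) \<in> charts M" "fst p \<in> U" "(W, \<mu>) \<in> charts N" "snd p \<in> W"
        using charted_obtain M N by metis
      then have "(U \<times> W, map_prod \<kappa> \<mu>) \<in> charts (prod_manifold M N)" "p \<in> U \<times> W"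
        by (auto simp: prod_manifold_def mem_Times_iff)
      then show "p \<in> (\<Union>(U, \<kappa>)\<in>charts (prod_manifold M N). U)" by blast
    qed
  qed
  moreover have "openin (top_of_set (points M \<times> points N)) (U \<times> W) \<and>
      openin (top_of_set (span (map_prod \<kappa> \<mu> ` (U \<times> W)))) (map_prod \<kappa> \<mu> ` (U \<times> W)) \<and>
      homeomorphism (U \<times> W) (map_prod \<kappa> \<mu> ` (U \<times> W)) (map_prod \<kappa> \<mu>) (inv_into (U \<times> W) (map_prod \<kappa> \<mu>))"
    if U: "(U, \<kappa>) \<in> charts M" and W: "(W, \<mu>) \<in> charts N" for U \<kappa> W \<mu>
  proof (intro conjI)
    note cU = chartedD[OF M U] and cW = chartedD[OF N W]
    show "openin (top_of_set (points M \<times> points N)) (U \<times> W)"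
      using cU cW by (intro openin_Times)
    have im: "map_prod \<kappa> \<mu> ` (U \<times> W) = \<kappa> ` U \<times> \<mu> ` W" by auto
    show "openin (top_of_set (span (map_prod \<kappa> \<mu> ` (U \<times> W)))) (map_prod \<kappa> \<mu> ` (U \<times> W))"
    \<comment> \<open>If one chart is empty, the span of the empty product is zero while the product
      of the spans may be larger. The image is then empty, hence open in any case.\<close>
    proof (cases "U = {} \<or> W = {}")
      case False
      then have "span (\<kappa> ` U \<times> \<mu> ` W) = span (\<kappa> ` U) \<times> span (\<mu> ` W)"
        using cU cW by (intro span_Times_openin) auto
      then show ?thesis unfolding im using cU cW by (simp add: openin_Times)
    qed auto
    have inj: "inj_on (map_prod \<kappa> \<mu>) (U \<times> W)"
      using cU(5) cW(5) by (simp add: map_prod_inj_on)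
    have hom: "homeomorphism (U \<times> W) (\<kappa> ` U \<times> \<mu> ` W) (map_prod \<kappa> \<mu>) (map_prod (inv_into U \<kappa>) (inv_into W \<mu>))"
    proof (rule homeomorphismI)
      show "continuous_on (U \<times> W) (map_prod \<kappa> \<mu>)"
        "continuous_on (\<kappa> ` U \<times> \<mu> ` W) (map_prod (inv_into U \<kappa>) (inv_into W \<mu>))"
        using cU(3) cW(3) unfolding homeomorphism_def map_prod_def case_prod_unfold
        by (auto intro!: continuous_on_Pair continuous_on_compose2[OF _ continuous_on_fst]
            continuous_on_compose2[OF _ continuous_on_snd] continuous_on_id)
    qed (use cU(5) cW(5) in auto)
    have eq: "inv_into (U \<times> W) (map_prod \<kappa> \<mu>) q = map_prod (inv_into U \<kappa>) (inv_into W \<mu>) q"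
      if "q \<in> \<kappa> ` U \<times> \<mu> ` W" for q
      using that by (intro inv_into_f_eq[OF inj]) (auto simp: inv_into_into f_inv_into_f)
    show "homeomorphism (U \<times> W) (map_prod \<kappa> \<mu> ` (U \<times> W)) (map_prod \<kappa> \<mu>) (inv_into (U \<times> W) (map_prod \<kappa> \<mu>))"
      unfolding im by (rule homeomorphism_cong[OF hom]) (use eq in auto)
  qed
  ultimately show ?thesis unfolding charted_def by (auto simp: prod_manifold_def)
qed

text \<open>The local representative \<open>F\<close> extends \<open>\<mu> f \<kappa>\<^sup>-\<^sup>1\<close> to a neighbourhood in the ambient Euclidean space.\<close>

definition C1_map ::
    "('a::topological_space, 'e::euclidean_space) manifold \<Rightarrow>
     ('b::topological_space, 'f::euclidean_space) manifold \<Rightarrow> ('a \<Rightarrow> 'b) \<Rightarrow> bool" where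
  "C1_map M N f \<longleftrightarrow>
     f ` points M \<subseteq> points N \<and>
     (\<forall>p\<in>points M. \<forall>(U, \<kappa>)\<in>charts M. \<forall>(W, \<mu>)\<in>charts N. p \<in> U \<longrightarrow> f p \<in> W \<longrightarrow>
        (\<exists>F V. C1_at F (\<kappa> p) \<and> open V \<and> \<kappa> p \<in> V \<and> (\<forall>q\<in>U. \<kappa> q \<in> V \<longrightarrow> f q \<in> W \<and> F (\<kappa> q) = \<mu> (f q))))"

lemma C1_mapD:
  assumes "C1_map M N f" "p \<in> points M" "(U, \<kappa>) \<in> charts M" "(W, \<mu>) \<in> charts N" "p \<in> U" "f p \<in> W"
  shows "\<exists>F V. C1_at F (\<kappa> p) \<and> open V \<and> \<kappa> p \<in> V \<and> (\<forall>q\<in>U. \<kappa> q \<in> V \<longrightarrow> f q \<in> W \<and> F (\<kappa> q) = \<mu> (f q))"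
  using assms(1)[unfolded C1_map_def, THEN conjunct2, THEN bspec, OF assms(2), THEN bspec, OF assms(3),
      unfolded prod.case, THEN bspec, OF assms(4), unfolded prod.case, THEN mp, OF assms(5), THEN mp, OF assms(6)] .

lemma C1_map_obtain:
  assumes "C1_map M N f" "p \<in> points M" "(U, \<kappa>) \<in> charts M" "(W, \<mu>) \<in> charts N" "p \<in> U" "f p \<in> W"
  obtains F V where "C1_at F (\<kappa> p)" "open V" "\<kappa> p \<in> V"
    "\<And>q. q \<in> U \<Longrightarrow> \<kappa> q \<in> V \<Longrightarrow> f q \<in> W" "\<And>q. q \<in> U \<Longrightarrow> \<kappa> q \<in> V \<Longrightarrow> F (\<kappa> q) = \<mu> (f q)"
  using C1_mapD[OF assms] by auto

lemma C1_mapI: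
  assumes "f ` points M \<subseteq> points N"
    and "\<And>p U \<kappa> W \<mu>. \<lbrakk>p \<in> points M; (U, \<kappa>) \<in> charts M; (W, \<mu>) \<in> charts N; p \<in> U; f p \<in> W\<rbrakk> \<Longrightarrow>
      \<exists>F V. C1_at F (\<kappa> p) \<and> open V \<and> \<kappa> p \<in> V \<and> (\<forall>q\<in>U. \<kappa> q \<in> V \<longrightarrow> f q \<in> W \<and> F (\<kappa> q) = \<mu> (f q))"
  shows "C1_map M N f"
  unfolding C1_map_def by (intro conjI assms(1) ballI case_prodI2 impI assms(2)) auto

text \<open>Smoothness speaks only of the part \<open>S\<close> of the chart that \<open>f\<close>
  maps into \<open>W\<close>. Continuity of \<open>f\<close> makes the image of \<open>S\<close>
  relatively open, cut out by \<open>V1\<close>; within \<open>V1\<close> the smooth extension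
  remains tied to \<open>f\<close>.\<close>

lemma smooth_map_imp_C1_map:
  assumes M: "charted M" and N: "charted N" and f: "smooth_map M N f"
  shows "C1_map M N f"
proof (rule C1_mapI)
  show "f ` points M \<subseteq> points N" using f unfolding smooth_map_on_def by blast
  fix p U \<kappa> W \<mu>
  assume p: "p \<in> points M" and U: "(U, \<kappa>) \<in> charts M" and W: "(W, \<mu>) \<in> charts N" and pU: "p \<in> U" and fp: "f p \<in> W"
  note cU = chartedD[OF M U] and cW = chartedD[OF N W]
  define S where "S = U \<inter> points M \<inter> f -` W"
  have "openin (top_of_set (points M)) (points M \<inter> f -` W)"
    using f unfolding smooth_map_on_def by (intro continuous_openin_preimage[OF _ _ cW(1)]) auto
  then have "openin (top_of_set (points M)) S"
    unfolding S_def Int_assoc by (rule openin_Int[OF cU(1)])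
  then have "openin (top_of_set U) S"
    by (rule openin_subset_trans) (use cU(4) in \<open>auto simp: S_def\<close>)
  then have "openin (top_of_set (\<kappa> ` U)) (\<kappa> ` S)"
    using homeomorphism_imp_open_map[OF cU(3)] by blast
  then obtain V1 where V1: "open V1" "\<kappa> ` S = \<kappa> ` U \<inter> V1"
    by (auto simp: openin_open)
  have "smooth_on (\<kappa> ` S) (\<mu> \<circ> f \<circ> inv_into U \<kappa>)"
    using f U W unfolding smooth_map_on_def S_def by blast
  moreover have "\<kappa> p \<in> \<kappa> ` S" using p pU fp by (auto simp: S_def)
  ultimately obtain V2 F where V2: "open V2" "\<kappa> p \<in> V2" "\<forall>k. Ck_on k V2 F"
    "\<forall>y\<in>\<kappa> ` S \<inter> V2. F y = (\<mu> \<circ> f \<circ> inv_into U \<kappa>) y"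
    unfolding smooth_on_def by blast
  have "f q \<in> W \<and> F (\<kappa> q) = \<mu> (f q)" if q: "q \<in> U" "\<kappa> q \<in> V1 \<inter> V2" for q
  proof -
    have "\<kappa> q \<in> \<kappa> ` S" using q V1 by blast
    then have "q \<in> S" using inj_on_image_mem_iff[OF cU(5) q(1), of S] by (auto simp: S_def)
    then show ?thesis using V2(4) q cU(5) by (auto simp: S_def)
  qed
  moreover have "\<kappa> p \<in> V1 \<inter> V2" using V1 V2 \<open>\<kappa> p \<in> \<kappa> ` S\<close> by blast
  ultimately show "\<exists>F V. C1_at F (\<kappa> p) \<and> open V \<and> \<kappa> p \<in> V \<and> (\<forall>q\<in>U. \<kappa> q \<in> V \<longrightarrow> f q \<in> W \<and> F (\<kappa> q) = \<mu> (f q))"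
    using Ck_on_imp_C1_at[OF V2(3,1,2)] open_Int[OF V1(1) V2(1)] by blast
qed

lemma C1_map_compose:
  assumes f: "C1_map M N f" and g: "C1_map N L g" and N: "charted N"
  shows "C1_map M L (\<lambda>p. g (f p))"
proof (rule C1_mapI)
  show "(\<lambda>p. g (f p)) ` points M \<subseteq> points L" using f g unfolding C1_map_def by blast
  fix p U \<kappa> W \<mu>
  assume p: "p \<in> points M" "(U, \<kappa>) \<in> charts M" "(W, \<mu>) \<in> charts L" "p \<in> U" "g (f p) \<in> W"
  have fp: "f p \<in> points N" using f p(1) unfolding C1_map_def by blast
  obtain V \<nu> where V: "(V, \<nu>) \<in> charts N" "f p \<in> V" using charted_obtain[OF N fp] .
  obtain F A where F: "C1_at F (\<kappa> p)" "open A" "\<kappa> p \<in> A" "\<And>q. q \<in> U \<Longrightarrow> \<kappa> q \<in> A \<Longrightarrow> f q \<in> V"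
    "\<And>q. q \<in> U \<Longrightarrow> \<kappa> q \<in> A \<Longrightarrow> F (\<kappa> q) = \<nu> (f q)"
    using C1_map_obtain[OF f p(1,2) V(1) p(4) V(2)] by blast
  obtain G B where G: "C1_at G (\<nu> (f p))" "open B" "\<nu> (f p) \<in> B" "\<And>q. q \<in> V \<Longrightarrow> \<nu> q \<in> B \<Longrightarrow> g q \<in> W"
    "\<And>q. q \<in> V \<Longrightarrow> \<nu> q \<in> B \<Longrightarrow> G (\<nu> q) = \<mu> (g q)"
    using C1_map_obtain[OF g fp V(1) p(3) V(2) p(5)] by blast
  obtain E where E: "open E" "\<kappa> p \<in> E" "continuous_on E F" using C1_at_imp_continuous[OF F(1)] .
  have "open (F -` B \<inter> E)" using E G by (simp add: continuous_on_open_vimage)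
  moreover have "C1_at (\<lambda>v. G (F v)) (\<kappa> p)" using C1_at_compose[OF F(1)] G(1) F(5) p F(3) by simp
  moreover have "F (\<kappa> p) = \<nu> (f p)" using F(3,5) p by blast
  ultimately show "\<exists>F V. C1_at F (\<kappa> p) \<and> open V \<and> \<kappa> p \<in> V \<and>
      (\<forall>q\<in>U. \<kappa> q \<in> V \<longrightarrow> g (f q) \<in> W \<and> F (\<kappa> q) = \<mu> (g (f q)))"
    using F(2-5) G(3-5) E(2)
    by (intro exI[of _ "\<lambda>v. G (F v)"] exI[of _ "A \<inter> (F -` B \<inter> E)"]) (auto intro: open_Int)
qed

lemma C1_map_curry_left:
  assumes f: "C1_map (prod_manifold A M) N (\<lambda>(a, p). f a p)" and A: "charted A" "a \<in> points A"
  shows "C1_map M N (f a)"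
proof (rule C1_mapI)
  show "f a ` points M \<subseteq> points N" using f A(2) unfolding C1_map_def by (auto simp: prod_manifold_def)
  fix p U \<kappa> W \<mu>
  assume p: "p \<in> points M" "(U, \<kappa>) \<in> charts M" "(W, \<mu>) \<in> charts N" "p \<in> U" "f a p \<in> W"
  obtain V \<nu> where V: "(V, \<nu>) \<in> charts A" "a \<in> V" using charted_obtain[OF A] .
  have c: "(V \<times> U, map_prod \<nu> \<kappa>) \<in> charts (prod_manifold A M)" "(a, p) \<in> V \<times> U" "(a, p) \<in> points (prod_manifold A M)"
    using V p A by (auto simp: prod_manifold_def)
  obtain F B where F: "C1_at F (\<nu> a, \<kappa> p)" "open B" "(\<nu> a, \<kappa> p) \<in> B"
    "\<And>q. q \<in> V \<times> U \<Longrightarrow> map_prod \<nu> \<kappa> q \<in> B \<Longrightarrow> (case q of (a, p) \<Rightarrow> f a p) \<in> W"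
    "\<And>q. q \<in> V \<times> U \<Longrightarrow> map_prod \<nu> \<kappa> q \<in> B \<Longrightarrow> F (map_prod \<nu> \<kappa> q) = \<mu> (case q of (a, p) \<Rightarrow> f a p)"
    using C1_map_obtain[OF f c(3,1) p(3) c(2)] p(5) unfolding prod.case map_prod_simp by blast
  have "C1_at (\<lambda>v. F (\<nu> a, v)) (\<kappa> p)"
    using C1_at_compose[OF C1_at_Pair[OF C1_at_const C1_at_id] F(1)] .
  moreover have "open (Pair (\<nu> a) -` B)" using F(2) by (intro open_vimage) (auto intro!: continuous_intros)
  ultimately show "\<exists>F V. C1_at F (\<kappa> p) \<and> open V \<and> \<kappa> p \<in> V \<and>
      (\<forall>q\<in>U. \<kappa> q \<in> V \<longrightarrow> f a q \<in> W \<and> F (\<kappa> q) = \<mu> (f a q))"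
    using F(3) F(4,5)[of "(a, _)"] V(2)
    by (intro exI[of _ "\<lambda>v. F (\<nu> a, v)"] exI[of _ "Pair (\<nu> a) -` B"]) auto
qed

lemma C1_map_curry_right:
  assumes f: "C1_map (prod_manifold M A) N (\<lambda>(p, a). f p a)" and A: "charted A" "a \<in> points A"
  shows "C1_map M N (\<lambda>p. f p a)"
proof (rule C1_mapI)
  show "(\<lambda>p. f p a) ` points M \<subseteq> points N" using f A(2) unfolding C1_map_def by (auto simp: prod_manifold_def)
  fix p U \<kappa> W \<mu>
  assume p: "p \<in> points M" "(U, \<kappa>) \<in> charts M" "(W, \<mu>) \<in> charts N" "p \<in> U" "f p a \<in> W"
  obtain V \<nu> where V: "(V, \<nu>) \<in> charts A" "a \<in> V" using charted_obtain[OF A] .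
  have c: "(U \<times> V, map_prod \<kappa> \<nu>) \<in> charts (prod_manifold M A)" "(p, a) \<in> U \<times> V" "(p, a) \<in> points (prod_manifold M A)"
    using V p A by (auto simp: prod_manifold_def)
  obtain F B where F: "C1_at F (\<kappa> p, \<nu> a)" "open B" "(\<kappa> p, \<nu> a) \<in> B"
    "\<And>q. q \<in> U \<times> V \<Longrightarrow> map_prod \<kappa> \<nu> q \<in> B \<Longrightarrow> (case q of (p, a) \<Rightarrow> f p a) \<in> W"
    "\<And>q. q \<in> U \<times> V \<Longrightarrow> map_prod \<kappa> \<nu> q \<in> B \<Longrightarrow> F (map_prod \<kappa> \<nu> q) = \<mu> (case q of (p, a) \<Rightarrow> f p a)"
    using C1_map_obtain[OF f c(3,1) p(3) c(2)] p(5) unfolding prod.case map_prod_simp by blast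
  have "C1_at (\<lambda>v. F (v, \<nu> a)) (\<kappa> p)"
    using C1_at_compose[OF C1_at_Pair[OF C1_at_id C1_at_const] F(1)] .
  moreover have "open ((\<lambda>v. (v, \<nu> a)) -` B)" using F(2) by (intro open_vimage) (auto intro!: continuous_intros)
  ultimately show "\<exists>F V. C1_at F (\<kappa> p) \<and> open V \<and> \<kappa> p \<in> V \<and>
      (\<forall>q\<in>U. \<kappa> q \<in> V \<longrightarrow> f q a \<in> W \<and> F (\<kappa> q) = \<mu> (f q a))"
    using F(3) F(4,5)[of "(_, a)"] V(2)
    by (intro exI[of _ "\<lambda>v. F (v, \<nu> a)"] exI[of _ "(\<lambda>v. (v, \<nu> a)) -` B"]) auto
qed

lemma C1_map_prod:
  assumes f: "C1_map M M' f" and g: "C1_map N N' g"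
  shows "C1_map (prod_manifold M N) (prod_manifold M' N') (map_prod f g)"
proof (rule C1_mapI)
  show "map_prod f g ` points (prod_manifold M N) \<subseteq> points (prod_manifold M' N')"
    using f g unfolding C1_map_def by (auto simp: prod_manifold_def)
  fix p U \<kappa> W \<mu>
  assume p: "p \<in> points (prod_manifold M N)" "(U, \<kappa>) \<in> charts (prod_manifold M N)"
    "(W, \<mu>) \<in> charts (prod_manifold M' N')" "p \<in> U" "map_prod f g p \<in> W"
  obtain x y where xy: "p = (x, y)" "x \<in> points M" "y \<in> points N" using p(1) by (auto simp: prod_manifold_def)
  obtain U1 \<kappa>1 U2 \<kappa>2 where U: "U = U1 \<times> U2" "\<kappa> = map_prod \<kappa>1 \<kappa>2" "(U1, \<kappa>1) \<in> charts M" "(U2, \<kappa>2) \<in> charts N"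
    using p(2) by (auto simp: prod_manifold_def)
  obtain W1 \<mu>1 W2 \<mu>2 where W: "W = W1 \<times> W2" "\<mu> = map_prod \<mu>1 \<mu>2" "(W1, \<mu>1) \<in> charts M'" "(W2, \<mu>2) \<in> charts N'"
    using p(3) by (auto simp: prod_manifold_def)
  have mem: "x \<in> U1" "y \<in> U2" "f x \<in> W1" "g y \<in> W2" using p(4,5) xy U W by auto
  obtain F A where F: "C1_at F (\<kappa>1 x)" "open A" "\<kappa>1 x \<in> A" "\<And>q. q \<in> U1 \<Longrightarrow> \<kappa>1 q \<in> A \<Longrightarrow> f q \<in> W1"
    "\<And>q. q \<in> U1 \<Longrightarrow> \<kappa>1 q \<in> A \<Longrightarrow> F (\<kappa>1 q) = \<mu>1 (f q)"
    using C1_map_obtain[OF f xy(2) U(3) W(3) mem(1,3)] by blast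
  obtain G B where G: "C1_at G (\<kappa>2 y)" "open B" "\<kappa>2 y \<in> B" "\<And>q. q \<in> U2 \<Longrightarrow> \<kappa>2 q \<in> B \<Longrightarrow> g q \<in> W2"
    "\<And>q. q \<in> U2 \<Longrightarrow> \<kappa>2 q \<in> B \<Longrightarrow> G (\<kappa>2 q) = \<mu>2 (g q)"
    using C1_map_obtain[OF g xy(3) U(4) W(4) mem(2,4)] by blast
  have "C1_at (\<lambda>v. (F (fst v), G (snd v))) (\<kappa> p)"
    using C1_at_Pair[OF C1_at_compose[OF C1_at_bounded_linear[OF bounded_linear_fst], of F "\<kappa> p"]
        C1_at_compose[OF C1_at_bounded_linear[OF bounded_linear_snd], of G "\<kappa> p"]] F(1) G(1) xy(1) U(2) by simp
  then show "\<exists>F V. C1_at F (\<kappa> p) \<and> open V \<and> \<kappa> p \<in> V \<and>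
      (\<forall>q\<in>U. \<kappa> q \<in> V \<longrightarrow> map_prod f g q \<in> W \<and> F (\<kappa> q) = \<mu> (map_prod f g q))"
    using F(2-5) G(2-5) xy U(1,2) W(1,2)
    by (intro exI[of _ "\<lambda>v. (F (fst v), G (snd v))"] exI[of _ "A \<times> B"]) (auto intro: open_Times)
qed


section \<open>Equivariant local sections of submersions\<close>

lemma C1_at_nhd:
  assumes "C1_at f x" "open B" "f x \<in> B"
  obtains E where "open E" "x \<in> E" "\<And>v. v \<in> E \<Longrightarrow> f v \<in> B"
proof -
  obtain U where U: "open U" "x \<in> U" "continuous_on U f" using C1_at_imp_continuous[OF assms(1)] .
  then have "open (f -` B \<inter> U)" using assms(2) by (simp add: continuous_on_open_vimage)
  then show thesis using that[of "f -` B \<inter> U"] U assms(3) by auto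
qed

text \<open>In charts at \<open>p0\<close> and \<open>m p0\<close> this is
  \<open>equivariant_local_right_inverse\<close>. As the image of a chart is open only in its span,
  the local representatives are precomposed with a projection \<open>P\<close> onto the span; off
  the span their extensions carry no information.\<close>

lemma equivariant_local_section:
  fixes M :: "('m::topological_space, 'e::euclidean_space) manifold"
    and N :: "('n::topological_space, 'f::euclidean_space) manifold"
    and K :: "('k, 'z) monoid_scheme" (structure)
  assumes M: "charted M" and N: "charted N" and m: "submersion M N m"
    and K: "group K" "finite (carrier K)"
    and a: "\<And>k. k \<in> carrier K \<Longrightarrow> C1_map M M (a k)"
    and b: "\<And>k. k \<in> carrier K \<Longrightarrow> C1_map N N (b k)"
    and a_mult: "\<And>k l p. \<lbrakk>k \<in> carrier K; l \<in> carrier K; p \<in> points M\<rbrakk> \<Longrightarrow> a (k \<otimes> l) p = a k (a l p)"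
    and a_one: "\<And>p. p \<in> points M \<Longrightarrow> a \<one> p = p"
    and equiv: "\<And>k p. \<lbrakk>k \<in> carrier K; p \<in> points M\<rbrakk> \<Longrightarrow> m (a k p) = b k (m p)"
    and p0: "p0 \<in> points M" "\<And>k. k \<in> carrier K \<Longrightarrow> a k p0 = p0"
  shows "\<exists>V s. openin (top_of_set (points N)) V \<and> m p0 \<in> V \<and> continuous_on V s \<and>
    (\<forall>q\<in>V. s q \<in> points M \<and> m (s q) = q \<and>
       ((\<forall>k\<in>carrier K. b k q = q) \<longrightarrow> (\<forall>k\<in>carrier K. a k (s q) = s q)))"
proof -
  interpret K: group K by fact
  have sm: "smooth_map M N m" using m unfolding submersion_def by blast
  have mp0: "m p0 \<in> points N" using sm p0(1) unfolding smooth_map_on_def by blast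
  obtain U \<kappa> where U: "(U, \<kappa>) \<in> charts M" "p0 \<in> U" using charted_obtain[OF M p0(1)] .
  obtain W \<mu> where W: "(W, \<mu>) \<in> charts N" "m p0 \<in> W" using charted_obtain[OF N mp0] .
  note cU = chartedD[OF M U(1)] and cW = chartedD[OF N W(1)]
  define v0 where "v0 = \<kappa> p0"
  define S where "S = span (\<kappa> ` U)"
  define T where "T = span (\<mu> ` W)"
  have \<kappa>S: "\<kappa> q \<in> S" if "q \<in> U" for q using that by (auto simp: S_def intro: span_base)
  have \<mu>T: "\<mu> q \<in> T" if "q \<in> W" for q using that by (auto simp: T_def intro: span_base)
  \<comment> \<open>A right inverse of \<open>id\<close> on \<open>S\<close> with values in
    \<open>S\<close> is a linear retraction onto \<open>S\<close>.\<close>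
  obtain P where P: "range P \<subseteq> S" "linear P" "\<And>v. v \<in> S \<Longrightarrow> P v = v"
    using linear_exists_right_inverse_on[of id S] by (auto simp: S_def linear_id)
  have blP: "bounded_linear P" using P(2) by (simp add: linear_linear)
  have Pv0: "P v0 = v0" using P(3) \<kappa>S U(2) by (simp add: v0_def)
  have P\<kappa>: "P (\<kappa> q) = \<kappa> q" if "q \<in> U" for q using P(3) \<kappa>S that by blast
  obtain J where J: "open J" "\<kappa> ` U = S \<inter> J" using cU(2) by (auto simp: openin_open S_def)
  have "\<exists>\<theta> V. C1_at \<theta> v0 \<and> open V \<and> v0 \<in> V \<and> (\<forall>q\<in>U. \<kappa> q \<in> V \<longrightarrow> a k q \<in> U \<and> \<theta> (\<kappa> q) = \<kappa> (a k q))"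
    if "k \<in> carrier K" for k
  proof -
    have "a k p0 \<in> U" using p0(2)[OF that] U(2) by simp
    from C1_mapD[OF a[OF that] p0(1) U(1) U(1) U(2) this] show ?thesis unfolding v0_def .
  qed
  then obtain \<theta> V\<theta> where \<theta>: "\<And>k. k \<in> carrier K \<Longrightarrow> C1_at (\<theta> k) v0"
    "\<And>k. k \<in> carrier K \<Longrightarrow> open (V\<theta> k)" "\<And>k. k \<in> carrier K \<Longrightarrow> v0 \<in> V\<theta> k"
    "\<And>k q. \<lbrakk>k \<in> carrier K; q \<in> U; \<kappa> q \<in> V\<theta> k\<rbrakk> \<Longrightarrow> a k q \<in> U \<and> \<theta> k (\<kappa> q) = \<kappa> (a k q)"
    by metis
  have bm: "b k (m p0) = m p0" if "k \<in> carrier K" for k using equiv[OF that p0(1)] p0(2)[OF that] by simp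
  have "\<exists>\<psi> V. C1_at \<psi> (\<mu> (m p0)) \<and> open V \<and> \<mu> (m p0) \<in> V \<and> (\<forall>q\<in>W. \<mu> q \<in> V \<longrightarrow> b k q \<in> W \<and> \<psi> (\<mu> q) = \<mu> (b k q))"
    if "k \<in> carrier K" for k
  proof -
    have "b k (m p0) \<in> W" using bm[OF that] W(2) by simp
    from C1_mapD[OF b[OF that] mp0 W(1) W(1) W(2) this] show ?thesis unfolding bm[OF that] .
  qed
  then obtain \<psi> V\<psi> where \<psi>: "\<And>k. k \<in> carrier K \<Longrightarrow> C1_at (\<psi> k) (\<mu> (m p0))"
    "\<And>k. k \<in> carrier K \<Longrightarrow> open (V\<psi> k)" "\<And>k. k \<in> carrier K \<Longrightarrow> \<mu> (m p0) \<in> V\<psi> k"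
    "\<And>k q. \<lbrakk>k \<in> carrier K; q \<in> W; \<mu> q \<in> V\<psi> k\<rbrakk> \<Longrightarrow> b k q \<in> W \<and> \<psi> k (\<mu> q) = \<mu> (b k q)"
    by metis
  obtain B where B: "\<And>k. k \<in> carrier K \<Longrightarrow> (\<psi> k has_derivative B k) (at (\<mu> (m p0)))"
    using C1_at_imp_has_derivative[OF \<psi>(1)] by metis
  obtain F VF where F: "C1_at F v0" "open VF" "v0 \<in> VF" "\<And>q. q \<in> U \<Longrightarrow> \<kappa> q \<in> VF \<Longrightarrow> m q \<in> W"
    "\<And>q. q \<in> U \<Longrightarrow> \<kappa> q \<in> VF \<Longrightarrow> F (\<kappa> q) = \<mu> (m q)"
    using C1_map_obtain[OF smooth_map_imp_C1_map[OF M N sm] p0(1) U(1) W(1) U(2) W(2)] unfolding v0_def by blast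
  obtain D0 where D0: "((\<mu> \<circ> m \<circ> inv_into U \<kappa>) has_derivative D0) (at v0 within \<kappa> ` (U \<inter> m -` W))" "D0 ` S = T"
    using m U W p0(1) unfolding submersion_def v0_def S_def T_def by blast

  \<comment> \<open>The representatives of \<open>m\<close> and of all \<open>a k\<close> are valid
    on the part of \<open>A\<close> in \<open>S\<close>, which by \<open>J\<close> lies in the image
    of the chart.\<close>
  define A where "A = J \<inter> VF \<inter> (\<Inter>k\<in>carrier K. V\<theta> k)"
  have A: "open A" "v0 \<in> A"
    using J F(2,3) \<theta>(2,3) K(2) U(2) unfolding A_def v0_def by (auto intro!: open_Int open_INT)
  define \<theta>' where "\<theta>' k v = \<theta> k (P v)" for k v
  define F' where "F' v = F (P v)" for v
  have C\<theta>': "C1_at (\<theta>' k) v0" if "k \<in> carrier K" for k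
    unfolding \<theta>'_def using C1_at_compose[OF C1_at_bounded_linear[OF blP], of "\<theta> k" v0] \<theta>(1)[OF that] Pv0 by simp
  have CF': "C1_at F' v0"
    unfolding F'_def using C1_at_compose[OF C1_at_bounded_linear[OF blP], of F v0] F(1) Pv0 by simp
  have \<theta>0: "\<theta>' k v0 = v0" if "k \<in> carrier K" for k
    using \<theta>(3,4)[OF that] p0(2)[OF that] U(2) Pv0 unfolding \<theta>'_def v0_def by auto
  have F0: "F' v0 = \<mu> (m p0)" using F(3,5) U(2) Pv0 unfolding F'_def v0_def by auto
  have "\<exists>E. open E \<and> v0 \<in> E \<and> (\<forall>v\<in>E. \<theta>' k v \<in> A)" if "k \<in> carrier K" for k
    using C1_at_nhd[OF C\<theta>'[OF that] A(1)] \<theta>0[OF that] A(2) by metis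
  then obtain E where E: "\<And>k. k \<in> carrier K \<Longrightarrow> open (E k)" "\<And>k. k \<in> carrier K \<Longrightarrow> v0 \<in> E k"
    "\<And>k v. k \<in> carrier K \<Longrightarrow> v \<in> E k \<Longrightarrow> \<theta>' k v \<in> A" by metis
  have "open (\<Inter>k\<in>carrier K. V\<psi> k)" "F' v0 \<in> (\<Inter>k\<in>carrier K. V\<psi> k)"
    using \<psi>(2,3) K(2) F0 by auto
  then obtain EF where EF: "open EF" "v0 \<in> EF" "\<And>v. v \<in> EF \<Longrightarrow> F' v \<in> (\<Inter>k\<in>carrier K. V\<psi> k)"
    using C1_at_nhd[OF CF'] by metis
  \<comment> \<open>The multiplication law applies \<open>\<theta>'\<close> twice, so the translates
    of a point of \<open>L\<close> must land in \<open>A\<close> again; this is what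
    \<open>E\<close> ensures. \<open>EF\<close> keeps the values of \<open>F'\<close> in the domains
    of all \<open>\<psi> k\<close>.\<close>
  define L where "L = P -` A \<inter> EF \<inter> (\<Inter>k\<in>carrier K. E k)"
  have L: "open L" "v0 \<in> L"
  proof -
    have "open (P -` A)" using A(1) by (intro open_vimage linear_continuous_on[OF blP])
    then show "open L" "v0 \<in> L"
      using EF E K(2) A Pv0 unfolding L_def by (auto intro!: open_Int open_INT)
  qed
  have LU: "\<exists>q\<in>U. P v = \<kappa> q \<and> \<kappa> q \<in> A \<and> m q \<in> W \<and> F' v = \<mu> (m q) \<and>
      (\<forall>k\<in>carrier K. a k q \<in> U \<and> \<theta>' k v = \<kappa> (a k q) \<and> \<kappa> (a k q) \<in> A)" if v: "v \<in> L" for v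
  proof -
    have PA: "P v \<in> A" using v by (auto simp: L_def)
    then have "P v \<in> \<kappa> ` U" using P(1) J(2) by (auto simp: A_def)
    then obtain q where q: "q \<in> U" "P v = \<kappa> q" by blast
    then have "m q \<in> W" "F' v = \<mu> (m q)" using F(4,5) PA by (auto simp: A_def F'_def)
    moreover have "a k q \<in> U \<and> \<theta>' k v = \<kappa> (a k q) \<and> \<kappa> (a k q) \<in> A" if "k \<in> carrier K" for k
      using \<theta>(4)[OF that q(1)] E(3)[OF that, of v] v q PA that by (auto simp: A_def L_def \<theta>'_def)
    ultimately show ?thesis using q PA by auto
  qed
  have a\<theta>: "\<theta>' k (\<kappa> q) = \<kappa> (a k q)" if "k \<in> carrier K" "q \<in> U" "\<kappa> q \<in> A" for k q
    using \<theta>(4)[OF that(1,2)] that P\<kappa> by (auto simp: A_def \<theta>'_def)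
  have "range P = S" using P(1,3) by (metis antisym rangeI subsetI)
  then have T: "range (\<lambda>w. D0 (P w)) = T" using D0(2) by (metis image_image)
  \<comment> \<open>The submersion has a derivative only within the image of the chart.
    \<open>P\<close> maps the open set \<open>L\<close> into that image, so after composition with
    \<open>P\<close> the derivative exists in the ambient space.\<close>
  have DF': "(F' has_derivative (\<lambda>w. D0 (P w))) (at v0)"
  proof -
    have "P ` L \<subseteq> \<kappa> ` (U \<inter> m -` W)" using LU by fastforce
    then have 1: "((\<mu> \<circ> m \<circ> inv_into U \<kappa>) has_derivative D0) (at (P v0) within P ` L)"
      using has_derivative_subset[OF D0(1)] Pv0 by simp
    have "((\<lambda>v. (\<mu> \<circ> m \<circ> inv_into U \<kappa>) (P v)) has_derivative (\<lambda>w. D0 (P w))) (at v0 within L)"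
      by (rule has_derivative_in_compose[OF bounded_linear_imp_has_derivative[OF blP] 1])
    then have "((\<lambda>v. (\<mu> \<circ> m \<circ> inv_into U \<kappa>) (P v)) has_derivative (\<lambda>w. D0 (P w))) (at v0)"
      by (simp only: at_within_open[OF L(2,1)])
    then show ?thesis
    proof (rule has_derivative_transform_within_open[OF _ L])
      fix v assume "v \<in> L"
      then show "(\<mu> \<circ> m \<circ> inv_into U \<kappa>) (P v) = F' v" using LU[of v] cU(5) by auto
    qed
  qed
  have "\<exists>V \<sigma>. open V \<and> F' v0 \<in> V \<and> continuous_on V \<sigma> \<and>
    (\<forall>t\<in>V. t - F' v0 \<in> T \<longrightarrow> \<sigma> t \<in> L \<and> P (\<sigma> t) = \<sigma> t \<and> F' (\<sigma> t) = t \<and>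
       ((\<forall>k\<in>carrier K. \<psi> k t = t) \<longrightarrow> (\<forall>k\<in>carrier K. \<theta>' k (\<sigma> t) = \<sigma> t)))"
  proof (rule equivariant_local_right_inverse[where \<psi> = \<psi> and B = B, OF K P(2) Pv0 CF' DF' T C\<theta>' \<theta>0 _ L])
    show "(\<psi> k has_derivative B k) (at (F' v0))" if "k \<in> carrier K" for k using B[OF that] F0 by simp
    show "\<theta>' k (\<theta>' l v) = \<theta>' (k \<otimes> l) v" if vkl: "v \<in> L" "k \<in> carrier K" "l \<in> carrier K" for v k l
    proof -
      obtain q where q: "q \<in> U" "\<theta>' l v = \<kappa> (a l q)" "\<theta>' (k \<otimes> l) v = \<kappa> (a (k \<otimes> l) q)" "a l q \<in> U" "\<kappa> (a l q) \<in> A"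
        using LU[OF vkl(1)] vkl(2,3) K.m_closed by blast
      then show ?thesis using a\<theta>[OF vkl(2) q(4,5)] a_mult[OF vkl(2,3), of q] cU(4) by auto
    qed
    show "\<theta>' \<one> v = P v" "F' v - F' v0 \<in> T" if v: "v \<in> L" for v
    proof -
      obtain q where q: "q \<in> U" "P v = \<kappa> q" "\<theta>' \<one> v = \<kappa> (a \<one> q)" "F' v = \<mu> (m q)" "m q \<in> W"
        using LU[OF v] by blast
      then show "\<theta>' \<one> v = P v" using a_one cU(4) by auto
      show "F' v - F' v0 \<in> T" using span_diff[OF \<mu>T[OF q(5), unfolded T_def] \<mu>T[OF W(2), unfolded T_def]] q(4) F0 by (simp add: T_def)
    qed
    show "F' (P v) = F' v" for v unfolding F'_def using P(1,3) by (metis rangeI subset_iff)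
    show "F' (\<theta>' k v) = \<psi> k (F' v)" if v: "v \<in> L" "k \<in> carrier K" for v k
    proof -
      obtain q where q: "q \<in> U" "\<theta>' k v = \<kappa> (a k q)" "a k q \<in> U" "\<kappa> (a k q) \<in> A" "F' v = \<mu> (m q)" "m q \<in> W"
        using LU[OF v(1)] v(2) by blast
      have "F' (\<theta>' k v) = \<mu> (b k (m q))"
        using F(5)[OF q(3)] q(2,4) P\<kappa>[OF q(3)] equiv[OF v(2), of q] q(1) cU(4) by (auto simp: F'_def A_def)
      moreover have "F' v \<in> V\<psi> k" using EF(3)[of v] v by (auto simp: L_def)
      ultimately show ?thesis using \<psi>(4)[OF v(2) q(6)] q(5) by simp
    qed
  qed
  then obtain V \<sigma> where V: "open V" "F' v0 \<in> V" "continuous_on V \<sigma>"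
    "\<And>t. t \<in> V \<Longrightarrow> t - F' v0 \<in> T \<Longrightarrow> \<sigma> t \<in> L \<and> P (\<sigma> t) = \<sigma> t \<and> F' (\<sigma> t) = t"
    "\<And>t k. t \<in> V \<Longrightarrow> t - F' v0 \<in> T \<Longrightarrow> \<forall>k\<in>carrier K. \<psi> k t = t \<Longrightarrow> k \<in> carrier K \<Longrightarrow> \<theta>' k (\<sigma> t) = \<sigma> t"
    by metis
  define V' where "V' = W \<inter> \<mu> -` V"
  define s where "s q = inv_into U \<kappa> (\<sigma> (\<mu> q))" for q
  have cont\<mu>: "continuous_on W \<mu>" using homeomorphism_cont1[OF cW(3)] .
  have "openin (top_of_set W) V'" unfolding V'_def using continuous_openin_preimage_gen[OF cont\<mu> V(1)] .
  then have "openin (top_of_set (points N)) V'" using cW(1) openin_trans by blast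
  moreover have "m p0 \<in> V'" using W(2) V(2) F0 by (simp add: V'_def)
  moreover have \<sigma>: "\<sigma> (\<mu> q) \<in> L \<and> P (\<sigma> (\<mu> q)) = \<sigma> (\<mu> q) \<and> F' (\<sigma> (\<mu> q)) = \<mu> q \<and> \<mu> q \<in> V \<and> \<mu> q - F' v0 \<in> T" if "q \<in> V'" for q
  proof -
    have "\<mu> q - F' v0 \<in> T" using span_diff[OF \<mu>T[of q, unfolded T_def] \<mu>T[OF W(2), unfolded T_def]] that F0 by (simp add: V'_def T_def)
    then show ?thesis using V(4)[of "\<mu> q"] that by (auto simp: V'_def)
  qed
  have \<sigma>U: "s q \<in> U \<and> \<kappa> (s q) = \<sigma> (\<mu> q) \<and> \<kappa> (s q) \<in> A \<and> m (s q) \<in> W \<and> \<mu> (m (s q)) = \<mu> q" if q: "q \<in> V'" for q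
  proof -
    obtain p where p: "p \<in> U" "P (\<sigma> (\<mu> q)) = \<kappa> p" "\<kappa> p \<in> A" "m p \<in> W" "F' (\<sigma> (\<mu> q)) = \<mu> (m p)"
      using LU[of "\<sigma> (\<mu> q)"] \<sigma>[OF q] by blast
    then have "s q = p" using \<sigma>[OF q] cU(5) by (auto simp: s_def)
    then show ?thesis using p \<sigma>[OF q] by simp
  qed
  have "continuous_on V' s" unfolding s_def
  proof (rule continuous_on_compose2[OF homeomorphism_cont2[OF cU(3)]])
    show "continuous_on V' (\<lambda>q. \<sigma> (\<mu> q))"
      by (rule continuous_on_compose2[OF V(3) continuous_on_subset[OF cont\<mu>]]) (auto simp: V'_def)
    show "(\<lambda>q. \<sigma> (\<mu> q)) ` V' \<subseteq> \<kappa> ` U" using \<sigma>U by (metis image_eqI image_subsetI)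
  qed
  moreover have "s q \<in> points M \<and> m (s q) = q" if q: "q \<in> V'" for q
    using \<sigma>U[OF q] inj_onD[OF cW(5), of "m (s q)" q] q cU(4) by (auto simp: V'_def)
  moreover have "a k (s q) = s q" if q: "q \<in> V'" "\<forall>k\<in>carrier K. b k q = q" and k: "k \<in> carrier K" for q k
  proof -
    \<comment> \<open>Invariance of \<open>q\<close>, read in the chart. Since
      \<open>\<mu> q = F' (\<sigma> (\<mu> q))\<close> and \<open>\<sigma> (\<mu> q)\<close> lies in
      \<open>L\<close>, the point \<open>\<mu> q\<close> is in the domain of
      \<open>\<psi> k\<close>.\<close>
    have "\<psi> k (\<mu> q) = \<mu> q" if "k \<in> carrier K" for k
      using \<psi>(4)[OF that, of q] EF(3)[of "\<sigma> (\<mu> q)"] \<sigma>[OF q(1)] q that by (auto simp: L_def V'_def)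
    then have "\<theta>' k (\<sigma> (\<mu> q)) = \<sigma> (\<mu> q)" using V(5)[of "\<mu> q" k] \<sigma>[OF q(1)] k by blast
    moreover have e: "s q \<in> U" "\<kappa> (s q) \<in> A" "\<kappa> (s q) = \<sigma> (\<mu> q)" using \<sigma>U[OF q(1)] by auto
    ultimately have "\<kappa> (a k (s q)) = \<kappa> (s q)" using a\<theta>[OF k e(1,2)] by simp
    moreover have "a k (s q) \<in> U" using \<theta>(4)[OF k, of "s q"] \<sigma>U[OF q(1)] k by (auto simp: A_def)
    ultimately show ?thesis using inj_onD[OF cU(5)] \<sigma>U[OF q(1)] by blast
  qed
  ultimately show ?thesis by (intro exI[of _ V'] exI[of _ s]) blast
qed

section \<open>Actions with finite isotropy\<close>

text \<open>Parameter paths with common ends in a convex set are homotopic, and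
  \<open>\<Psi>\<close> carries the homotopy over. Reparametrizations and the passage from edges to
  diagonal of a square are obtained from this without explicit homotopies.\<close>

lemma homotopic_paths_in_convex:
  fixes S :: "'a::real_normed_vector set" and \<Psi> :: "'a \<Rightarrow> 'b::topological_space"
  assumes "convex S" "continuous_on S \<Psi>" "\<Psi> ` S \<subseteq> T"
    and "path \<alpha>" "path_image \<alpha> \<subseteq> S" "path \<beta>" "path_image \<beta> \<subseteq> S"
    and "pathstart \<alpha> = pathstart \<beta>" "pathfinish \<alpha> = pathfinish \<beta>"
    and p: "\<And>t. t \<in> {0..1} \<Longrightarrow> p t = \<Psi> (\<alpha> t)" and q: "\<And>t. t \<in> {0..1} \<Longrightarrow> q t = \<Psi> (\<beta> t)"
  shows "homotopic_paths T p q"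
proof -
  have "homotopic_paths S \<alpha> \<beta>"
    using convex_imp_simply_connected[OF assms(1)] assms(4-9) simply_connected_eq_homotopic_paths by metis
  then have h: "homotopic_paths T (\<Psi> \<circ> \<alpha>) (\<Psi> \<circ> \<beta>)"
    using assms(2,3) by (intro homotopic_paths_continuous_image) auto
  have "homotopic_paths T (\<Psi> \<circ> \<alpha>) p" "homotopic_paths T (\<Psi> \<circ> \<beta>) q"
    using homotopic_paths_imp_path[OF h] homotopic_paths_imp_subset[OF h] p q
    by (auto intro!: homotopic_paths_eq)
  with h show ?thesis by (meson homotopic_paths_sym homotopic_paths_trans)
qed

text \<open>Joining with a constant path only lets the parameter pause; it still runs from 0 to
  1.\<close>

lemma homotopic_paths_const_join:
  assumes "path p" "path_image p \<subseteq> T"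
  shows "homotopic_paths T ((\<lambda>_. pathstart p) +++ p) p" "homotopic_paths T (p +++ (\<lambda>_. pathfinish p)) p"
proof -
  have p: "continuous_on {0..1} p" "p ` {0..1} \<subseteq> T"
    using assms by (auto simp: path_def path_image_def)
  have I: "path_image (linepath 0 0 +++ linepath 0 1) \<subseteq> {0..1::real}"
    "path_image (linepath 0 1 +++ linepath 1 1) \<subseteq> {0..1::real}" "path_image (linepath 0 1) \<subseteq> {0..1::real}"
    by (auto simp: path_image_join closed_segment_eq_real_ivl)
  show "homotopic_paths T ((\<lambda>_. pathstart p) +++ p) p"
  proof (rule homotopic_paths_in_convex[OF _ p _ I(1) _ I(3)])
    fix t :: real assume "t \<in> {0..1}"
    show "((\<lambda>_. pathstart p) +++ p) t = p ((linepath 0 0 +++ linepath 0 1) t)" "p t = p (linepath 0 1 t)"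
      by (auto simp: joinpaths_def linepath_def pathstart_def pathfinish_def)
  qed (auto intro!: path_join_imp)
  show "homotopic_paths T (p +++ (\<lambda>_. pathfinish p)) p"
  proof (rule homotopic_paths_in_convex[OF _ p _ I(2) _ I(3)])
    fix t :: real assume "t \<in> {0..1}"
    show "(p +++ (\<lambda>_. pathfinish p)) t = p ((linepath 0 1 +++ linepath 1 1) t)" "p t = p (linepath 0 1 t)"
      by (auto simp: joinpaths_def linepath_def pathstart_def pathfinish_def)
  qed (auto intro!: path_join_imp)
qed

lemma path_class_eq: "homotopic_paths S p q \<Longrightarrow> path_class S p = path_class S q"
  unfolding path_class_def by (auto intro: homotopic_paths_trans homotopic_paths_sym)

text \<open>A finite subset of a T1 space is discrete, and an interval is connected. The case of
  interest is a path of conjugates \<open>inv (a t) \<otimes> k \<otimes> a t\<close> in a finite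
  subgroup.\<close>

lemma continuous_into_finite_constant:
  fixes f :: "real \<Rightarrow> 'a::topological_space"
  assumes f: "continuous_on {0..1} f" "f ` {0..1} \<subseteq> L" and L: "finite L" "L \<subseteq> S" "t1_space (top_of_set S)"
    and t: "t \<in> {0..1}"
  shows "f t = f 0"
proof -
  have f': "continuous_map (top_of_set {0..1}) (top_of_set S) f"
    using f L(2) by (auto simp: continuous_map_in_subtopology)
  have cl: "closedin (top_of_set {0..1}) {t \<in> {0..1}. f t \<in> A}" if "A \<subseteq> L" for A
  proof -
    have "closedin (top_of_set S) A" using L that by (simp add: t1_space_closedin_finite finite_subset subset_trans)
    then show ?thesis using closedin_continuous_map_preimage[OF f'] by simp
  qed
  define A where "A = {t \<in> {0..1}. f t \<in> L - {f 0}}"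
  define B where "B = {t \<in> {0..1}. f t \<in> {f 0}}"
  have B: "0 \<in> B" by (simp add: B_def)
  have "f 0 \<in> L" using f(2) by auto
  then have "closedin (top_of_set {0..1}) A" "closedin (top_of_set {0..1}) B"
    unfolding A_def B_def by (intro cl; simp)+
  moreover have "{0..1} \<subseteq> A \<union> B" "A \<inter> B = {}" using f(2) by (auto simp: A_def B_def)
  moreover have "connected {0..1::real}" by simp
  ultimately have "A = {}" using B unfolding connected_closedin by blast
  then have "{t \<in> {0..1}. f t \<in> L - {f 0}} = {}" unfolding A_def .
  then show ?thesis using f(2) t by blast
qed

section \<open>Actions, fixed sets, centralizers and cosets\<close>

text \<open>What the discrete category sees of a smooth action with finite isotropy; charts return
  only in the construction of local sections.\<close>

locale finite_isotropy_action = group G for G :: "('g::topological_space, 'z) monoid_scheme" (structure) +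
  fixes X :: "'x::topological_space set" and act :: "'g \<Rightarrow> 'x \<Rightarrow> 'x"
  assumes act_closed [simp]: "g \<in> carrier G \<Longrightarrow> x \<in> X \<Longrightarrow> act g x \<in> X"
    and act_mult: "g \<in> carrier G \<Longrightarrow> h \<in> carrier G \<Longrightarrow> x \<in> X \<Longrightarrow> act (g \<otimes> h) x = act g (act h x)"
    and act_one [simp]: "x \<in> X \<Longrightarrow> act \<one> x = x"
    and cont_act: "continuous_on (carrier G \<times> X) (\<lambda>(g, x). act g x)"
    and cont_mult: "continuous_on (carrier G \<times> carrier G) (\<lambda>(g, h). g \<otimes> h)"
    and cont_inv: "continuous_on (carrier G) (\<lambda>g. inv g)"
    and t1_carrier: "t1_space (top_of_set (carrier G))"
    and finite_isotropy: "x \<in> X \<Longrightarrow> finite {g \<in> carrier G. act g x = x}"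
begin

abbreviation "Fix \<equiv> fixed_points X act"

definition centr :: "'g set \<Rightarrow> 'g set" where
  "centr K = {c \<in> carrier G. \<forall>k\<in>K. c \<otimes> k = k \<otimes> c}"

definition centr_path :: "'g set \<Rightarrow> (real \<Rightarrow> 'g) \<Rightarrow> bool" where
  "centr_path K c \<longleftrightarrow> path c \<and> path_image c \<subseteq> centr K \<and> pathstart c = \<one>"

lemma FixD: "x \<in> Fix K \<Longrightarrow> x \<in> X" "x \<in> Fix K \<Longrightarrow> k \<in> K \<Longrightarrow> act k x = x"
  by (auto simp: fixed_points_def)

lemma centrD: "c \<in> centr K \<Longrightarrow> c \<in> carrier G" "c \<in> centr K \<Longrightarrow> k \<in> K \<Longrightarrow> c \<otimes> k = k \<otimes> c"
  by (auto simp: centr_def)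

lemma continuous_act:
  assumes "continuous_on S a" "a ` S \<subseteq> carrier G" "continuous_on S p" "p ` S \<subseteq> X"
  shows "continuous_on S (\<lambda>t. act (a t) (p t))"
  using continuous_on_compose2[OF cont_act continuous_on_Pair[OF assms(1,3)]] assms(2,4) by fastforce

lemma continuous_mult:
  assumes "continuous_on S a" "a ` S \<subseteq> carrier G" "continuous_on S b" "b ` S \<subseteq> carrier G"
  shows "continuous_on S (\<lambda>t. a t \<otimes> b t)"
  using continuous_on_compose2[OF cont_mult continuous_on_Pair[OF assms(1,3)]] assms(2,4) by fastforce

lemma continuous_inv:
  assumes "continuous_on S a" "a ` S \<subseteq> carrier G"
  shows "continuous_on S (\<lambda>t. inv (a t))"
  using continuous_on_compose2[OF cont_inv assms] .

lemma m_inv_cancel [simp]: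
  assumes "g \<in> carrier G" "h \<in> carrier G"
  shows "inv g \<otimes> (g \<otimes> h) = h" "g \<otimes> (inv g \<otimes> h) = h"
  using assms by (simp_all flip: m_assoc)

lemma act_inv [simp]: "g \<in> carrier G \<Longrightarrow> x \<in> X \<Longrightarrow> act (inv g) (act g x) = x"
  using act_mult[of "inv g" g x] by simp

lemma act_inv' [simp]: "g \<in> carrier G \<Longrightarrow> x \<in> X \<Longrightarrow> act g (act (inv g) x) = x"
  using act_mult[of g "inv g" x] by simp

lemma act_Fix:
  assumes "g \<in> carrier G" "K \<subseteq> carrier G" "\<And>k. k \<in> K \<Longrightarrow> inv g \<otimes> k \<otimes> g \<in> L" "x \<in> Fix L"
  shows "act g x \<in> Fix K"
proof -
  have x: "x \<in> X" using FixD assms(4) by blast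
  have "act k (act g x) = act g x" if k: "k \<in> K" for k
  proof -
    have kc: "k \<in> carrier G" using k assms(2) by blast
    have "act k (act g x) = act (g \<otimes> (inv g \<otimes> k \<otimes> g)) x"
      using kc assms(1) x by (simp add: act_mult m_assoc)
    also have "\<dots> = act g (act (inv g \<otimes> k \<otimes> g) x)" using kc assms(1) x by (intro act_mult) auto
    finally show ?thesis using FixD(2)[OF assms(4) assms(3)[OF k]] by simp
  qed
  then show ?thesis using x assms(1) by (auto simp: fixed_points_def)
qed

lemma centr_conj:
  assumes c: "c \<in> centr K" and k: "k \<in> K" "K \<subseteq> carrier G"
  shows "inv c \<otimes> k \<otimes> c = k"
proof -
  have kc: "k \<in> carrier G" using k by blast
  have "inv c \<otimes> k \<otimes> c = inv c \<otimes> (k \<otimes> c)" using centrD(1)[OF c] kc by (simp add: m_assoc)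
  also have "\<dots> = inv c \<otimes> (c \<otimes> k)" using centrD(2)[OF c k(1)] by simp
  also have "\<dots> = k" using centrD(1)[OF c] kc by simp
  finally show ?thesis .
qed

lemma act_centr: "c \<in> centr K \<Longrightarrow> K \<subseteq> carrier G \<Longrightarrow> x \<in> Fix K \<Longrightarrow> act c x \<in> Fix K"
  by (rule act_Fix) (auto simp: centr_conj centrD)

lemma centr_subgroup:
  assumes "K \<subseteq> carrier G"
  shows "subgroup (centr K) G"
proof (rule subgroupI)
  show "centr K \<subseteq> carrier G" "centr K \<noteq> {}" using assms by (auto simp: centr_def intro!: exI[of _ \<one>])
  fix a assume a: "a \<in> centr K"
  note ac = centrD[OF a]
  have "inv a \<otimes> k = k \<otimes> inv a" if k: "k \<in> K" for k
  proof -
    have kc: "k \<in> carrier G" using k assms by blast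
    have "inv a \<otimes> k = inv a \<otimes> (k \<otimes> a) \<otimes> inv a" using kc ac(1) by (simp add: m_assoc)
    also have "\<dots> = inv a \<otimes> (a \<otimes> k) \<otimes> inv a" using ac(2)[OF k] by simp
    also have "\<dots> = k \<otimes> inv a" using kc ac(1) by simp
    finally show ?thesis .
  qed
  then show "inv a \<in> centr K" using ac(1) by (simp add: centr_def)
  fix b assume b: "b \<in> centr K"
  note bc = centrD[OF b]
  have "a \<otimes> b \<otimes> k = k \<otimes> (a \<otimes> b)" if k: "k \<in> K" for k
  proof -
    have kc: "k \<in> carrier G" using k assms by blast
    have "a \<otimes> b \<otimes> k = a \<otimes> k \<otimes> b" using kc ac(1) bc(1) bc(2)[OF k] by (simp add: m_assoc)
    also have "\<dots> = k \<otimes> (a \<otimes> b)" using kc ac(1) bc(1) ac(2)[OF k] by (simp add: m_assoc)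
    finally show ?thesis .
  qed
  then show "a \<otimes> b \<in> centr K" using ac(1) bc(1) by (simp add: centr_def)
qed

lemma subgroup_finite:
  assumes "subgroup L G" "y \<in> Fix L"
  shows "finite L"
proof (rule finite_subset)
  show "L \<subseteq> {g \<in> carrier G. act g y = y}" using FixD(2)[OF assms(2)] subgroup.subset[OF assms(1)] by blast
  show "finite {g \<in> carrier G. act g y = y}" by (rule finite_isotropy[OF FixD(1)[OF assms(2)]])
qed

lemma lcoset_eq_iff:
  assumes "subgroup L G" "g \<in> carrier G" "h \<in> carrier G"
  shows "g <# L = h <# L \<longleftrightarrow> inv g \<otimes> h \<in> L"
proof
  assume "g <# L = h <# L"
  then have "h \<in> g <# L" using lcos_self[OF assms(3,1)] by simp
  then show "inv g \<otimes> h \<in> L" using subgroup.lcos_module_imp[OF assms(1) is_group assms(2)] by blast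
next
  assume l: "inv g \<otimes> h \<in> L"
  have "h <# L = g <# ((inv g \<otimes> h) <# L)"
    using assms subgroup.subset[OF assms(1)] by (simp add: lcos_m_assoc)
  also have "(inv g \<otimes> h) <# L = L" using l assms(1) by (simp add: coset_join3 subgroup.mem_carrier)
  finally show "g <# L = h <# L" by simp
qed

lemma coset_act_lcoset:
  assumes "subgroup L G" "g \<in> carrier G" "y \<in> Fix L"
  shows "coset_act act (g <# L) y = act g y"
proof -
  have "act (g \<otimes> l) y = act g y" if "l \<in> L" for l
    using FixD[OF assms(3)] act_mult[OF assms(2), of l y] subgroup.mem_carrier[OF assms(1) that] that by simp
  then have "(\<lambda>g. act g y) ` (g <# L) \<subseteq> {act g y}" by (auto simp: l_coset_def)
  moreover have "act g y \<in> (\<lambda>g. act g y) ` (g <# L)" using lcos_self[OF assms(2,1)] by blast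
  ultimately have "(\<lambda>g. act g y) ` (g <# L) = {act g y}" by blast
  then show ?thesis unfolding coset_act_def by simp
qed

lemma orbit_arrows_iff:
  assumes K: "subgroup K G" and L: "subgroup L G" and g: "g \<in> carrier G"
  shows "g <# L \<in> orbit_arrows G K L \<longleftrightarrow> (\<forall>k\<in>K. inv g \<otimes> k \<otimes> g \<in> L)"
proof -
  have "k <# (g <# L) = g <# L \<longleftrightarrow> inv g \<otimes> inv k \<otimes> g \<in> L" if "k \<in> K" for k
  proof -
    have k: "k \<in> carrier G" using subgroup.mem_carrier[OF K that] .
    have "k <# (g <# L) = (k \<otimes> g) <# L" using k g subgroup.subset[OF L] by (simp add: lcos_m_assoc)
    then show ?thesis using lcoset_eq_iff[OF L, of "k \<otimes> g" g] k g by (simp add: inv_mult_group)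
  qed
  moreover have "g <# L \<in> lcosets L" using g by (auto simp: LCOSETS_def)
  moreover have "(\<forall>k\<in>K. inv g \<otimes> inv k \<otimes> g \<in> L) \<longleftrightarrow> (\<forall>k\<in>K. inv g \<otimes> k \<otimes> g \<in> L)"
    using subgroup.m_inv_closed[OF K] subgroup.mem_carrier[OF K] by (metis inv_inv)
  ultimately show ?thesis unfolding orbit_arrows_def by simp
qed

lemma orbit_arrowsE:
  assumes "C \<in> orbit_arrows G K L"
  obtains g where "g \<in> carrier G" "C = g <# L"
  using assms unfolding orbit_arrows_def LCOSETS_def by blast

text \<open>\<open>h\<close> conjugates \<open>L\<close> into \<open>M\<close>, so that
  \<open>L\<close> can be moved past \<open>h\<close> and absorbed. This identifies the product of
  sets with composition in the orbit category.\<close>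

lemma lcoset_mult:
  assumes L: "subgroup L G" and M: "subgroup M G" and gh: "g \<in> carrier G" "h \<in> carrier G"
    and LM: "\<And>l. l \<in> L \<Longrightarrow> inv h \<otimes> l \<otimes> h \<in> M"
  shows "(g <# L) <#> (h <# M) = (g \<otimes> h) <# M"
proof -
  have "g \<otimes> l \<otimes> (h \<otimes> m) \<in> (g \<otimes> h) <# M" if lm: "l \<in> L" "m \<in> M" for l m
  proof -
    have "g \<otimes> l \<otimes> (h \<otimes> m) = g \<otimes> h \<otimes> ((inv h \<otimes> l \<otimes> h) \<otimes> m)"
      using subgroup.mem_carrier[OF L lm(1)] subgroup.mem_carrier[OF M lm(2)] gh by (simp add: m_assoc)
    moreover have "(inv h \<otimes> l \<otimes> h) \<otimes> m \<in> M" using LM lm subgroup.m_closed[OF M] by blast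
    ultimately show ?thesis unfolding l_coset_def by blast
  qed
  moreover have "g \<otimes> h \<otimes> m \<in> (g <# L) <#> (h <# M)" if "m \<in> M" for m
  proof -
    have "g \<otimes> h \<otimes> m = (g \<otimes> \<one>) \<otimes> (h \<otimes> m)" using gh subgroup.mem_carrier[OF M that] by (simp add: m_assoc)
    then show ?thesis unfolding l_coset_def set_mult_def using subgroup.one_closed[OF L] that by blast
  qed
  ultimately show ?thesis unfolding l_coset_def set_mult_def by blast
qed

text \<open>Both paths are images under \<open>(s, t) \<mapsto> act (c s) (p t)\<close> of paths
  from one corner of the square to the opposite one: along two edges, and along the diagonal. This
  turns the concatenation in the definition of a 2-cell into a pointwise action.\<close>

lemma homotopic_centr_path:
  assumes K: "K \<subseteq> carrier G" and c: "centr_path K c" and p: "path p" "path_image p \<subseteq> Fix K"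
  shows "homotopic_paths (Fix K) (p +++ (\<lambda>t. act (c t) (pathfinish p))) (\<lambda>t. act (c t) (p t))"
proof (rule homotopic_paths_in_convex[of "{0..1} \<times> {0..1}" "\<lambda>(s, t). act (c s) (p t)" _
      "linepath (0, 0) (0, 1) +++ linepath (0, 1) (1, 1)" "linepath (0, 0) (1, 1)"])
  have c': "continuous_on {0..1} c" "c ` {0..1} \<subseteq> carrier G" "c ` {0..1} \<subseteq> centr K" "c 0 = \<one>"
    using c unfolding centr_path_def path_def path_image_def pathstart_def by (auto simp: centr_def)
  have p': "continuous_on {0..1} p" "p ` {0..1} \<subseteq> X" "p ` {0..1} \<subseteq> Fix K"
    using p unfolding path_def path_image_def by (auto simp: fixed_points_def)
  have "continuous_on ({0..1} \<times> {0..1}) (\<lambda>v. act (c (fst v)) (p (snd v)))"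
    by (intro continuous_act continuous_on_compose2[OF c'(1) continuous_on_fst]
        continuous_on_compose2[OF p'(1) continuous_on_snd] continuous_on_id) (use c' p' in auto)
  then show "continuous_on ({0..1} \<times> {0..1}) (\<lambda>(s, t). act (c s) (p t))" by (simp add: case_prod_unfold)
  show "(\<lambda>(s, t). act (c s) (p t)) ` ({0..1} \<times> {0..1}) \<subseteq> Fix K"
    using act_centr[OF _ K] c'(3) p'(3) by (auto simp: image_subset_iff)
  have I: "convex ({0..1::real} \<times> {0..1::real})" by (intro convex_Times) auto
  then show "convex ({0..1::real} \<times> {0..1::real})" .
  show "path_image (linepath (0, 0) (0, 1) +++ linepath (0, 1) (1, 1)) \<subseteq> {0..1::real} \<times> {0..1::real}"
    "path_image (linepath (0, 0) (1, 1)) \<subseteq> {0..1::real} \<times> {0..1::real}"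
    by (intro subset_path_image_join; unfold path_image_linepath; intro closed_segment_subset[OF _ _ I]; simp)
      (unfold path_image_linepath; intro closed_segment_subset[OF _ _ I]; simp)
  fix t :: real assume t: "t \<in> {0..1}"
  show "(p +++ (\<lambda>t. act (c t) (pathfinish p))) t =
      (case (linepath (0, 0) (0, 1) +++ linepath (0, 1) (1, 1)) t of (s, t) \<Rightarrow> act (c s) (p t))"
  proof (cases "t \<le> 1/2")
    case True
    then have "p (2 * t) \<in> X" using p'(2) t by auto
    then show ?thesis using True c'(4) by (simp add: joinpaths_def linepath_def)
  qed (simp add: joinpaths_def linepath_def pathfinish_def)
  show "act (c t) (p t) = (case linepath (0, 0) (1, 1) t of (s, t) \<Rightarrow> act (c s) (p t))"
    by (simp add: linepath_def)
qed (auto intro!: path_join_imp)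

section \<open>Paths of cosets and their lifts\<close>

text \<open>The finite set \<open>L - {\<one>}\<close> is closed, so
  \<open>inv a \<otimes> b\<close> avoids it for \<open>a\<close> and \<open>b\<close> near
  \<open>\<one>\<close>. Translates of \<open>U\<close> then meet each coset of \<open>L\<close> at
  most once.\<close>

lemma discrete_subgroup_nhd:
  assumes L: "subgroup L G" "finite L"
  obtains U where "open U" "\<one> \<in> U"
    "\<And>a b. \<lbrakk>a \<in> U; b \<in> U; a \<in> carrier G; b \<in> carrier G; inv a \<otimes> b \<in> L\<rbrakk> \<Longrightarrow> a = b"
proof -
  let ?S = "carrier G \<times> carrier G"
  have cont: "continuous_on ?S (\<lambda>v. inv (fst v) \<otimes> snd v)"
    by (intro continuous_mult continuous_inv continuous_intros) auto
  have "closedin (top_of_set (carrier G)) (L - {\<one>})"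
    using L t1_carrier subgroup.subset[OF L(1)] by (auto simp: t1_space_closedin_finite)
  then have "closedin (top_of_set ?S) (?S \<inter> (\<lambda>v. inv (fst v) \<otimes> snd v) -` (L - {\<one>}))"
    by (intro continuous_closedin_preimage_gen[OF cont]) auto
  then have "openin (top_of_set ?S) (?S - (?S \<inter> (\<lambda>v. inv (fst v) \<otimes> snd v) -` (L - {\<one>})))"
    by (simp add: closedin_def)
  then obtain W where W: "open W" "?S - (?S \<inter> (\<lambda>v. inv (fst v) \<otimes> snd v) -` (L - {\<one>})) = ?S \<inter> W"
    by (auto simp: openin_open)
  have "(\<one>, \<one>) \<in> ?S - (?S \<inter> (\<lambda>v. inv (fst v) \<otimes> snd v) -` (L - {\<one>}))" by simp
  then have "(\<one>, \<one>) \<in> W" using W(2) by blast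
  then obtain A B where AB: "open A" "open B" "\<one> \<in> A" "\<one> \<in> B" "A \<times> B \<subseteq> W"
    using open_prod_elim[OF W(1)] by (metis mem_Sigma_iff)
  show thesis
  proof (rule that)
    show "open (A \<inter> B)" "\<one> \<in> A \<inter> B" using AB by auto
    fix a b assume ab: "a \<in> A \<inter> B" "b \<in> A \<inter> B" "a \<in> carrier G" "b \<in> carrier G" "inv a \<otimes> b \<in> L"
    then have "(a, b) \<in> ?S \<inter> W" using AB(5) by auto
    then have "inv a \<otimes> b = \<one>" using ab(5) W(2)[symmetric] by auto
    then show "a = b" using ab(3,4) by (metis inv_closed inv_inv inv_equality inv_solve_left r_one)
  qed
qed

text \<open>The preimage of the image is the union of right translates of \<open>B\<close> by
  elements of \<open>L\<close>, and translations are continuous; so the quotient map is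
  open.\<close>

lemma openin_coset_image:
  assumes L: "subgroup L G" and B: "openin (top_of_set (carrier G)) B"
  shows "openin (coset_topology G L) ((\<lambda>g. g <# L) ` B)"
proof -
  have BG: "B \<subseteq> carrier G" using openin_imp_subset[OF B] .
  have "{g \<in> carrier G. g <# L \<in> (\<lambda>g. g <# L) ` B} = (\<Union>l\<in>L. {g \<in> carrier G. g \<otimes> l \<in> B})"
  proof safe
    fix g b assume g: "g \<in> carrier G" and b: "b \<in> B" "g <# L = b <# L"
    then have "b \<in> g <# L" using lcos_self[OF _ L, of b] BG by auto
    then obtain l where "l \<in> L" "b = g \<otimes> l" unfolding l_coset_def by blast
    then show "g \<in> (\<Union>l\<in>L. {g \<in> carrier G. g \<otimes> l \<in> B})" using b(1) g by auto
  next
    fix g l assume gl: "g \<in> carrier G" "l \<in> L" "g \<otimes> l \<in> B"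
    then have "g <# L = (g \<otimes> l) <# L"
      using lcoset_eq_iff[OF L, of g "g \<otimes> l"] subgroup.mem_carrier[OF L] by simp
    then show "g <# L \<in> (\<lambda>g. g <# L) ` B" using gl by blast
  qed
  moreover have "openin (top_of_set (carrier G)) {g \<in> carrier G. g \<otimes> l \<in> B}" if "l \<in> L" for l
  proof -
    have "continuous_on (carrier G) (\<lambda>g. g \<otimes> l)" "(\<lambda>g. g \<otimes> l) ` carrier G \<subseteq> carrier G"
      using subgroup.mem_carrier[OF L that] by (auto intro!: continuous_mult continuous_intros)
    then have "openin (top_of_set (carrier G)) (carrier G \<inter> (\<lambda>g. g \<otimes> l) -` B)"
      by (intro continuous_openin_preimage[OF _ _ B]) auto
    moreover have "carrier G \<inter> (\<lambda>g. g \<otimes> l) -` B = {g \<in> carrier G. g \<otimes> l \<in> B}" by auto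
    ultimately show ?thesis by simp
  qed
  ultimately show ?thesis
    unfolding openin_coset_topology LCOSETS_def using BG by (auto intro!: openin_Union)
qed

lemma topspace_coset_topology: "topspace (coset_topology G L) = lcosets L"
proof -
  have "{g \<in> carrier G. g <# L \<in> lcosets L} = carrier G" by (auto simp: LCOSETS_def)
  then have "openin (coset_topology G L) (lcosets L)" unfolding openin_coset_topology by simp
  moreover have "topspace (coset_topology G L) \<subseteq> lcosets L"
    using openin_topspace[of "coset_topology G L"] unfolding openin_coset_topology by blast
  ultimately show ?thesis using openin_subset by blast
qed

text \<open>The quotient map is a principal bundle for \<open>L\<close> acting from the right: two
  points of a fibre differ by the element \<open>inv z \<otimes> z'\<close> of \<open>L\<close>. The
  path is pulled back to the square along the second coordinate. There is a single type of fibre,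
  hence the index in \<open>unit\<close>.\<close>

lemma coset_path_lift:
  assumes L: "subgroup L G" "finite L" and \<sigma>: "pathin (coset_topology G L) \<sigma>"
  obtains a where "path a" "path_image a \<subseteq> carrier G" "\<And>t. t \<in> {0..1} \<Longrightarrow> a t <# L = \<sigma> t"
proof -
  define F where "F i v = {g \<in> carrier G. g <# L = \<sigma> (snd v)}" for i :: unit and v :: "real \<times> real"
  have \<sigma>op: "openin (top_of_set {0..1}) {t \<in> {0..1}. \<sigma> t \<in> \<U>}" if "openin (coset_topology G L) \<U>" for \<U>
    using openin_continuous_map_preimage[OF \<sigma>[unfolded pathin_def] that] by simp
  have "\<exists>i s. continuous_on ({0..1} \<times> {0..1}) s \<and> (\<forall>v\<in>{0..1} \<times> {0..1}. s v \<in> F i v)"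
  proof (rule section_on_square[where T = "\<lambda>z z' w. w \<otimes> inv z \<otimes> z'"])
    fix v :: "real \<times> real" assume v: "v \<in> {0..1} \<times> {0..1}"
    define t0 where "t0 = snd v"
    have t0: "t0 \<in> {0..1}" using v by (auto simp: t0_def)
    have "\<sigma> t0 \<in> lcosets L"
      using \<sigma> t0 unfolding pathin_def continuous_map_def topspace_coset_topology by auto
    then obtain g0 where g0: "g0 \<in> carrier G" "\<sigma> t0 = g0 <# L" by (auto simp: LCOSETS_def)
    obtain U where U: "open U" "\<one> \<in> U"
      "\<And>a b. \<lbrakk>a \<in> U; b \<in> U; a \<in> carrier G; b \<in> carrier G; inv a \<otimes> b \<in> L\<rbrakk> \<Longrightarrow> a = b"
      using discrete_subgroup_nhd[OF L] by blast
    \<comment> \<open>The translate of \<open>U\<close> by \<open>g0\<close>. The quotient map is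
      injective on it, and \<open>s\<close> composes its inverse with
      \<open>\<sigma>\<close>.\<close>
    define V where "V = carrier G \<inter> (\<lambda>g. inv g0 \<otimes> g) -` U"
    have "continuous_on (carrier G) (\<lambda>g. inv g0 \<otimes> g)"
      using g0 by (intro continuous_mult continuous_intros) auto
    then have V: "openin (top_of_set (carrier G)) V"
      unfolding V_def using U(1) by (rule continuous_openin_preimage_gen)
    have g0V: "g0 \<in> V" using g0 U(2) by (simp add: V_def)
    have V_inj: "a = b" if ab: "a \<in> V" "b \<in> V" "a <# L = b <# L" for a b
    proof -
      have c: "a \<in> carrier G" "b \<in> carrier G" using ab by (auto simp: V_def)
      have "inv (inv g0 \<otimes> a) \<otimes> (inv g0 \<otimes> b) = inv a \<otimes> b" using g0 c by (simp add: inv_mult_group m_assoc)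
      then have "inv g0 \<otimes> a = inv g0 \<otimes> b"
        using U(3)[of "inv g0 \<otimes> a" "inv g0 \<otimes> b"] ab c g0 lcoset_eq_iff[OF L(1) c] by (simp add: V_def)
      then show ?thesis using g0 c by simp
    qed
    define s where "s t = inv_into V (\<lambda>g. g <# L) (\<sigma> t)" for t
    define N0 where "N0 = {t \<in> {0..1}. \<sigma> t \<in> (\<lambda>g. g <# L) ` V}"
    have s: "s t \<in> V" "s t <# L = \<sigma> t" if "t \<in> N0" for t
      using that inv_into_into[of "\<sigma> t" "\<lambda>g. g <# L" V] f_inv_into_f[of "\<sigma> t" "\<lambda>g. g <# L" V]
      by (auto simp: s_def N0_def)
    have "openin (top_of_set {0..1}) N0"
      unfolding N0_def by (rule \<sigma>op[OF openin_coset_image[OF L(1) V]])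
    then obtain N1 where N1: "open N1" "N0 = {0..1} \<inter> N1" by (auto simp: openin_open)
    have "continuous_on N0 s"
      unfolding continuous_on_open_invariant
    proof (intro allI impI)
      fix B :: "'g set" assume B: "open B"
      \<comment> \<open>On \<open>N0\<close>, \<open>s t\<close> lies in \<open>B\<close> exactly
        when \<open>\<sigma> t\<close> is the coset of a point of \<open>V \<inter> B\<close>;
        openness of the quotient map makes this an open condition on \<open>t\<close>.\<close>
      have "openin (top_of_set (carrier G)) (V \<inter> B)" using V B by (simp add: openin_Int_open)
      then have "openin (top_of_set {0..1}) {t \<in> {0..1}. \<sigma> t \<in> (\<lambda>g. g <# L) ` (V \<inter> B)}"
        by (rule \<sigma>op[OF openin_coset_image[OF L(1)]])
      then obtain A where A: "open A" "{t \<in> {0..1}. \<sigma> t \<in> (\<lambda>g. g <# L) ` (V \<inter> B)} = {0..1} \<inter> A"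
        by (auto simp: openin_open)
      have "A \<inter> N0 = s -` B \<inter> N0"
      proof (intro Set.set_eqI iffI)
        fix t assume t: "t \<in> A \<inter> N0"
        then have "t \<in> {0..1} \<inter> A" by (auto simp: N0_def)
        then obtain g where "g \<in> V" "g \<in> B" "\<sigma> t = g <# L" unfolding A(2)[symmetric] by blast
        then show "t \<in> s -` B \<inter> N0" using t V_inj[of "s t" g] s[of t] by auto
      next
        fix t assume t: "t \<in> s -` B \<inter> N0"
        then have "t \<in> {t \<in> {0..1}. \<sigma> t \<in> (\<lambda>g. g <# L) ` (V \<inter> B)}"
          using s[of t] by (auto simp: N0_def image_iff intro!: bexI[of _ "s t"])
        then show "t \<in> A \<inter> N0" using t unfolding A(2) by blast
      qed
      then show "\<exists>A. open A \<and> A \<inter> N0 = s -` B \<inter> N0" using A(1) by blast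
    qed
    then have "continuous_on (snd -` N1 \<inter> {0..1} \<times> {0..1}) (\<lambda>w. s (snd w))"
      by (rule continuous_on_compose2[OF _ continuous_on_snd[OF continuous_on_id]]) (auto simp: N1)
    moreover have "open (snd -` N1 :: (real \<times> real) set)" by (intro open_vimage_snd N1)
    moreover have "t0 \<in> N0" using g0V g0 t0 by (auto simp: N0_def)
    moreover have "s (snd w) \<in> F () w" if "w \<in> snd -` N1 \<inter> {0..1} \<times> {0..1}" for w
    proof -
      have "snd w \<in> N0" using that N1 by auto
      then show ?thesis using s[of "snd w"] by (auto simp: F_def V_def)
    qed
    ultimately show "\<exists>N i s. open N \<and> v \<in> N \<and> continuous_on (N \<inter> {0..1} \<times> {0..1}) s \<and>
        (\<forall>w\<in>N \<inter> {0..1} \<times> {0..1}. s w \<in> F i w)"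
      using N1(2) unfolding t0_def by blast
  next
    fix i j :: unit and u v :: "real \<times> real" and z z' w
    assume z: "z \<in> F i u" "z' \<in> F j u" and w: "w \<in> F i v"
    have zz: "inv z \<otimes> z' \<in> L" using z lcoset_eq_iff[OF L(1), of z z'] by (simp add: F_def)
    have "inv w \<otimes> (w \<otimes> inv z \<otimes> z') = inv z \<otimes> z'" using z w by (simp add: F_def m_assoc)
    then have "w <# L = (w \<otimes> inv z \<otimes> z') <# L"
      using lcoset_eq_iff[OF L(1), of w "w \<otimes> inv z \<otimes> z'"] zz z w by (simp add: F_def)
    then show "w \<otimes> inv z \<otimes> z' \<in> F j v" using z w by (simp add: F_def)
  next
    fix i j :: unit and u :: "real \<times> real" and z z'
    assume z: "z \<in> F i u" "z' \<in> F j u"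
    then show "z \<otimes> inv z \<otimes> z' = z'" by (simp add: F_def)
  next
    have "continuous_on (carrier G \<times> carrier G \<times> carrier G) (\<lambda>v. snd (snd v) \<otimes> inv (fst v) \<otimes> fst (snd v))"
      by (intro continuous_mult continuous_inv continuous_intros) auto
    then show "continuous_on {(z, z', w). \<exists>i j u v. u \<in> {0..1} \<times> {0..1} \<and> v \<in> {0..1} \<times> {0..1} \<and>
        z \<in> F i u \<and> z' \<in> F j u \<and> w \<in> F i v} (\<lambda>(z, z', w). w \<otimes> inv z \<otimes> z')"
      unfolding case_prod_unfold by (rule continuous_on_subset) (auto simp: F_def)
  qed
  then obtain s where s: "continuous_on ({0..1} \<times> {0..1}) s" "\<And>v. v \<in> {0..1} \<times> {0..1} \<Longrightarrow> s v \<in> F () v"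
    by (metis (full_types) old.unit.exhaust)
  show thesis
  proof (rule that)
    show "path (\<lambda>t. s (0, t))" unfolding path_def
      by (rule continuous_on_compose2[OF s(1)]) (auto intro!: continuous_intros)
    show "path_image (\<lambda>t. s (0, t)) \<subseteq> carrier G" "\<And>t. t \<in> {0..1} \<Longrightarrow> s (0, t) <# L = \<sigma> t"
      using s(2) by (auto simp: path_image_def F_def)
  qed
qed

text \<open>Let \<open>a\<close> be a lift of \<open>\<sigma>\<close>. For \<open>k\<close> in
  \<open>K\<close> the conjugate \<open>inv (a t) \<otimes> k \<otimes> a t\<close> moves in the
  finite group \<open>L\<close>, hence is constant. This says that
  \<open>a t \<otimes> inv (a 0)\<close> commutes with \<open>k\<close>.\<close>

lemma centr_path_of_coset_path:
  assumes K: "subgroup K G" and L: "subgroup L G" "finite L" and g: "g \<in> carrier G" "\<sigma> 0 = g <# L"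
    and \<sigma>: "pathin (subtopology (coset_topology G L) (orbit_arrows G K L)) \<sigma>"
  obtains c where "centr_path K c" "\<And>t. t \<in> {0..1} \<Longrightarrow> \<sigma> t = (c t \<otimes> g) <# L"
proof -
  have \<sigma>': "pathin (coset_topology G L) \<sigma>" "\<And>t. t \<in> {0..1} \<Longrightarrow> \<sigma> t \<in> orbit_arrows G K L"
    using \<sigma> unfolding pathin_subtopology by auto
  obtain a where a: "path a" "path_image a \<subseteq> carrier G" "\<And>t. t \<in> {0..1} \<Longrightarrow> a t <# L = \<sigma> t"
    using coset_path_lift[OF L \<sigma>'(1)] by blast
  have a': "continuous_on {0..1} a" "a ` {0..1} \<subseteq> carrier G" "\<And>t. t \<in> {0..1} \<Longrightarrow> a t \<in> carrier G"
    using a unfolding path_def path_image_def by auto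
  have a0: "a 0 \<in> carrier G" using a'(3) by simp
  define c where "c t = a t \<otimes> inv (a 0)" for t
  have "continuous_on {0..1} c"
    unfolding c_def using a'(1,2) a0 by (intro continuous_mult continuous_intros) auto
  moreover have "c t \<in> centr K" if t: "t \<in> {0..1}" for t
  proof -
    have "c t \<otimes> k = k \<otimes> c t" if k: "k \<in> K" for k
    proof -
      have kc: "k \<in> carrier G" using subgroup.mem_carrier[OF K k] .
      define f where "f t = inv (a t) \<otimes> k \<otimes> a t" for t
      have "continuous_on {0..1} f" unfolding f_def
        using a'(1,2) kc by (intro continuous_mult continuous_inv continuous_intros) auto
      moreover have "f ` {0..1} \<subseteq> L"
        using orbit_arrows_iff[OF K L(1) a'(3)] \<sigma>'(2) a(3) k unfolding f_def by auto
      ultimately have "f t = f 0"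
        using continuous_into_finite_constant[OF _ _ L(2) subgroup.subset[OF L(1)] t1_carrier t] by blast
      then have "a t \<otimes> f t \<otimes> inv (a 0) = a t \<otimes> f 0 \<otimes> inv (a 0)" by simp
      then show ?thesis unfolding f_def c_def using kc a0 a'(3)[OF t] by (simp add: m_assoc)
    qed
    then show ?thesis using a'(3)[OF t] a0 by (simp add: centr_def c_def)
  qed
  ultimately have c: "centr_path K c"
    using a0 unfolding centr_path_def path_def path_image_def pathstart_def by (auto simp: c_def)
  have "\<sigma> t = (c t \<otimes> g) <# L" if t: "t \<in> {0..1}" for t
  proof -
    \<comment> \<open>The lift starts somewhere in the coset of \<open>g\<close>, not necessarily at
      \<open>g\<close>; the discrepancy is the same element of \<open>L\<close> for all
      \<open>t\<close>.\<close>
    have "inv (c t \<otimes> g) \<otimes> a t = inv g \<otimes> a 0"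
      using a'(3)[OF t] a0 g(1) by (simp add: c_def inv_mult_group m_assoc)
    moreover have "inv g \<otimes> a 0 \<in> L" using a(3)[of 0] g lcoset_eq_iff[OF L(1) g(1) a0] by simp
    ultimately have "(c t \<otimes> g) <# L = a t <# L"
      using lcoset_eq_iff[OF L(1), of "c t \<otimes> g" "a t"] a'(3)[OF t] a0 g(1) by (simp add: c_def)
    then show ?thesis using a(3)[OF t] by simp
  qed
  with c show thesis using that by blast
qed

lemma coset_path_of_centr_path:
  assumes K: "subgroup K G" and L: "subgroup L G" and g: "g \<in> carrier G" "\<And>k. k \<in> K \<Longrightarrow> inv g \<otimes> k \<otimes> g \<in> L"
    and c: "centr_path K c"
  shows "pathin (subtopology (coset_topology G L) (orbit_arrows G K L)) (\<lambda>t. (c t \<otimes> g) <# L)"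
  unfolding pathin_subtopology
proof (intro conjI ballI)
  have c': "continuous_on {0..1} c" "\<And>t. t \<in> {0..1} \<Longrightarrow> c t \<in> centr K"
    using c unfolding centr_path_def path_def path_image_def by auto
  note c'' = centrD(1)[OF c'(2)]
  have cont: "continuous_on {0..1} (\<lambda>t. c t \<otimes> g)"
    using c' g(1) by (intro continuous_mult continuous_intros) (auto simp: c'')
  have lc: "(c t \<otimes> g) <# L \<in> lcosets L" if "t \<in> {0..1}" for t
    unfolding LCOSETS_def using c''[OF that] g(1) by blast
  show "pathin (coset_topology G L) (\<lambda>t. (c t \<otimes> g) <# L)"
    unfolding pathin_def continuous_map_def topspace_coset_topology
  proof (intro conjI allI impI)
    show "(\<lambda>t. (c t \<otimes> g) <# L) \<in> topspace (top_of_set {0..1}) \<rightarrow> lcosets L"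
      using lc by auto
    fix \<U> assume "openin (coset_topology G L) \<U>"
    then have "openin (top_of_set (carrier G)) {g \<in> carrier G. g <# L \<in> \<U>}"
      unfolding openin_coset_topology by blast
    then have "openin (top_of_set {0..1}) ({0..1} \<inter> (\<lambda>t. c t \<otimes> g) -` {g \<in> carrier G. g <# L \<in> \<U>})"
      using c'' g(1) by (intro continuous_openin_preimage[OF cont]) (auto simp: c'')
    moreover have "{0..1} \<inter> (\<lambda>t. c t \<otimes> g) -` {g \<in> carrier G. g <# L \<in> \<U>} = {t \<in> topspace (top_of_set {0..1}). (c t \<otimes> g) <# L \<in> \<U>}"
      using c'' g(1) by (auto simp: c'')
    ultimately show "openin (top_of_set {0..1}) {t \<in> topspace (top_of_set {0..1}). (c t \<otimes> g) <# L \<in> \<U>}"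
      by simp
  qed
  fix t :: real assume t: "t \<in> {0..1}"
  have ct: "c t \<in> carrier G" using centrD(1) c'(2)[OF t] .
  have "inv (c t \<otimes> g) \<otimes> k \<otimes> (c t \<otimes> g) \<in> L" if k: "k \<in> K" for k
  proof -
    have kc: "k \<in> carrier G" using subgroup.mem_carrier[OF K k] .
    have "inv (c t \<otimes> g) \<otimes> k \<otimes> (c t \<otimes> g) = inv g \<otimes> (inv (c t) \<otimes> k \<otimes> c t) \<otimes> g"
      using kc ct g(1) by (simp add: inv_mult_group m_assoc)
    then show ?thesis using centr_conj[OF c'(2)[OF t] k subgroup.subset[OF K]] g(2)[OF k] by simp
  qed
  then show "(c t \<otimes> g) <# L \<in> orbit_arrows G K L"
    using orbit_arrows_iff[OF K L, of "c t \<otimes> g"] ct g(1) by simp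
qed

section \<open>The discrete fundamental group category\<close>

text \<open>
  Cosets are represented by elements of \<open>G\<close>: \<open>arrow a b g p\<close> says that \<open>(gL, [p])\<close> is an arrow from
  \<open>a = (K, x)\<close> to \<open>b = (L, y)\<close>.
\<close>

definition arrow :: "'g set \<times> 'x \<Rightarrow> 'g set \<times> 'x \<Rightarrow> 'g \<Rightarrow> (real \<Rightarrow> 'x) \<Rightarrow> bool" where
  "arrow a b g p \<longleftrightarrow> g \<in> carrier G \<and> (\<forall>k\<in>fst a. inv g \<otimes> k \<otimes> g \<in> fst b) \<and>
     path p \<and> path_image p \<subseteq> Fix (fst a) \<and> pathstart p = snd a \<and> pathfinish p = act g (snd b)"

definition arr :: "'g set \<times> 'x \<Rightarrow> 'g set \<times> 'x \<Rightarrow> 'g \<Rightarrow> (real \<Rightarrow> 'x) \<Rightarrow> 'g set \<times> (real \<Rightarrow> 'x) set" where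
  "arr a b g p = (g <# fst b, path_class (Fix (fst a)) p)"

text \<open>A 2-cell in terms of its lift to the centralizer: pointwise action of \<open>c\<close>
  in place of concatenation with a path of endpoints.\<close>

definition arrow_rel ::
    "'g set \<times> 'x \<Rightarrow> 'g set \<times> 'x \<Rightarrow> 'g \<Rightarrow> (real \<Rightarrow> 'x) \<Rightarrow> 'g \<Rightarrow> (real \<Rightarrow> 'x) \<Rightarrow> bool" where
  "arrow_rel a b g p g' p' \<longleftrightarrow> (\<exists>c. centr_path (fst a) c \<and> (pathfinish c \<otimes> g) <# fst b = g' <# fst b \<and>
     homotopic_paths (Fix (fst a)) (\<lambda>t. act (c t) (p t)) p')"

lemma centr_pathD:
  assumes "centr_path K c" "t \<in> {0..1}"
  shows "c t \<in> centr K" "c t \<in> carrier G"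
  using assms imageI[of t "{0..1}" c] centrD(1)[of "c t" K] unfolding centr_path_def path_image_def by blast+

lemma Fix_pathD:
  assumes "path_image p \<subseteq> Fix K" "t \<in> {0..1}"
  shows "p t \<in> Fix K" "p t \<in> X"
  using assms imageI[of t "{0..1}" p] FixD(1)[of "p t" K] unfolding path_image_def by blast+

lemma Pi_objD:
  assumes "a \<in> Pi_obj G X act"
  shows "subgroup (fst a) G" "snd a \<in> Fix (fst a)" "finite (fst a)" "fst a \<subseteq> carrier G" "snd a \<in> X"
  using assms subgroup_finite[of "fst a" "snd a"] subgroup.subset[of "fst a" G] FixD(1)[of "snd a" "fst a"]
  by (auto simp: Pi_obj_def)

text \<open>A subgroup that fixes a point is finite and therefore closed, so images and preimages of
  subgroups yield objects without a separate proof of closedness.\<close>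

lemma Pi_objI:
  assumes "subgroup K G" "x \<in> Fix K"
  shows "(K, x) \<in> Pi_obj G X act"
  using assms subgroup_finite[OF assms] subgroup.subset[OF assms(1)] t1_carrier
  by (auto simp: Pi_obj_def t1_space_closedin_finite)

lemma path_act_centr:
  assumes K: "K \<subseteq> carrier G" and c: "path c" "path_image c \<subseteq> centr K" and p: "path p" "path_image p \<subseteq> Fix K"
  shows "path (\<lambda>t. act (c t) (p t))" "path_image (\<lambda>t. act (c t) (p t)) \<subseteq> Fix K"
proof -
  show "path (\<lambda>t. act (c t) (p t))"
    using c p unfolding path_def path_image_def
    by (intro continuous_act) (auto simp: image_subset_iff dest: centrD FixD)
  show "path_image (\<lambda>t. act (c t) (p t)) \<subseteq> Fix K"
    using c p act_centr[OF _ K] by (auto simp: path_image_def image_subset_iff)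
qed

lemma homotopic_act_centr:
  assumes K: "K \<subseteq> carrier G" and c: "path c" "path_image c \<subseteq> centr K" and h: "homotopic_paths (Fix K) p q"
  shows "homotopic_paths (Fix K) (\<lambda>t. act (c t) (p t)) (\<lambda>t. act (c t) (q t))"
proof -
  obtain h where h: "continuous_on ({0..1} \<times> {0..1}) h" "h \<in> ({0..1} \<times> {0..1}) \<rightarrow> Fix K"
    "\<forall>x \<in> {0..1}. h (0, x) = p x" "\<forall>x \<in> {0..1}. h (1, x) = q x"
    "\<forall>t \<in> {0..1::real}. pathstart (h \<circ> Pair t) = pathstart p \<and> pathfinish (h \<circ> Pair t) = pathfinish p"
    using h unfolding homotopic_paths by blast
  have c': "continuous_on {0..1} c" "\<And>t. t \<in> {0..1} \<Longrightarrow> c t \<in> centr K" "\<And>t. t \<in> {0..1} \<Longrightarrow> c t \<in> carrier G"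
    using c centrD(1)[of _ K] by (auto simp: path_def path_image_def image_subset_iff)
  show ?thesis unfolding homotopic_paths
  proof (intro exI conjI)
    show "continuous_on ({0..1} \<times> {0..1}) (\<lambda>v. act (c (snd v)) (h v))"
      by (intro continuous_act continuous_on_compose2[OF c'(1) continuous_on_snd[OF continuous_on_id]] h)
        (use h(2) c'(3) in \<open>auto simp: Pi_iff intro: FixD(1)\<close>)
    show "(\<lambda>v. act (c (snd v)) (h v)) \<in> ({0..1} \<times> {0..1}) \<rightarrow> Fix K"
      using act_centr[OF c'(2) K] h(2) by (auto simp: Pi_iff)
  qed (use h(3-5) in \<open>auto simp: pathstart_def pathfinish_def\<close>)
qed

lemma Pi_arr_iff:
  assumes a: "a \<in> Pi_obj G X act" and b: "b \<in> Pi_obj G X act"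
  shows "u \<in> Pi_arr G X act a b \<longleftrightarrow> (\<exists>g p. arrow a b g p \<and> u = arr a b g p)"
proof -
  obtain K x L y where ab: "a = (K, x)" "b = (L, y)" by fastforce
  note A = Pi_objD[OF a] and B = Pi_objD[OF b]
  show ?thesis
  proof
    assume "u \<in> Pi_arr G X act a b"
    then obtain C p where u: "u = (C, path_class (Fix K) p)" "C \<in> orbit_arrows G K L" "path p"
      "path_image p \<subseteq> Fix K" "pathstart p = x" "pathfinish p = coset_act act C y"
      by (auto simp: Pi_arr_def ab)
    obtain g where g: "g \<in> carrier G" "C = g <# L" using orbit_arrowsE[OF u(2)] .
    have "arrow a b g p"
      unfolding arrow_def ab using u g orbit_arrows_iff[of K L g] coset_act_lcoset[of L g y] A B by (simp add: ab)
    then show "\<exists>g p. arrow a b g p \<and> u = arr a b g p" using u(1) g(2) by (auto simp: arr_def ab)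
  next
    assume "\<exists>g p. arrow a b g p \<and> u = arr a b g p"
    then obtain g p where g: "arrow a b g p" "u = arr a b g p" by blast
    then have "g <# L \<in> orbit_arrows G K L" "coset_act act (g <# L) y = act g y"
      using orbit_arrows_iff[of K L g] coset_act_lcoset[of L g y] A B by (auto simp: arrow_def ab)
    then show "u \<in> Pi_arr G X act a b" using g unfolding Pi_arr_def arrow_def arr_def ab by auto
  qed
qed

text \<open>Paths of cosets and centralizer paths correspond by lifting. As \<open>snd b\<close> is
  fixed by \<open>fst b\<close>, the 2-cell moves the endpoint of \<open>p\<close> by
  \<open>c\<close>, and \<open>homotopic_centr_path\<close> exchanges concatenation for pointwise
  action.\<close>

lemma Pi_rel_iff:
  assumes a: "a \<in> Pi_obj G X act" and b: "b \<in> Pi_obj G X act"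
    and g: "arrow a b g p" and g': "arrow a b g' p'"
  shows "(arr a b g p, arr a b g' p') \<in> Pi_rel G X act a b \<longleftrightarrow> arrow_rel a b g p g' p'"
proof -
  obtain K x L y where ab: "a = (K, x)" "b = (L, y)" by fastforce
  note A = Pi_objD[OF a, unfolded ab fst_conv snd_conv] and B = Pi_objD[OF b, unfolded ab fst_conv snd_conv]
  have gG: "g \<in> carrier G" "g' \<in> carrier G" and gK: "\<And>k. k \<in> K \<Longrightarrow> inv g \<otimes> k \<otimes> g \<in> L"
    and p: "path p" "path_image p \<subseteq> Fix K" "pathfinish p = act g y"
    using g g' unfolding arrow_def ab by auto
  have arr_mem: "arr a b g p \<in> Pi_arr G X act a b" "arr a b g' p' \<in> Pi_arr G X act a b"
    using Pi_arr_iff[OF a b] g g' by auto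
  have homotopic: "homotopic_paths (Fix K) (p1 +++ (\<lambda>t. coset_act act (\<sigma> t) y)) (\<lambda>t. act (c t) (p t))"
    if c: "centr_path K c" and \<sigma>: "\<And>t. t \<in> {0..1} \<Longrightarrow> \<sigma> t = (c t \<otimes> g) <# L" and p1: "homotopic_paths (Fix K) p p1"
    for c \<sigma> p1
  proof -
    have c': "path c" "path_image c \<subseteq> centr K" "pathstart c = \<one>" using c by (auto simp: centr_path_def)
    have q: "path (\<lambda>_::real. pathfinish p)" "path_image (\<lambda>_::real. pathfinish p) \<subseteq> Fix K"
      using p(2) pathfinish_in_path_image[of p] by (auto simp: path_def path_image_def)
    have eq: "act (c t) (pathfinish p) = coset_act act (\<sigma> t) y" if t: "t \<in> {0..1}" for t
    proof -
      have "c t \<in> carrier G" using centr_pathD[OF c t] by simp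
      then show ?thesis using coset_act_lcoset[OF B(1) _ B(2)] gG p(3) \<sigma>[OF t] B(5) by (simp add: act_mult)
    qed
    have "homotopic_paths (Fix K) (\<lambda>t. act (c t) (pathfinish p)) (\<lambda>t. coset_act act (\<sigma> t) y)"
      by (rule homotopic_paths_eq[OF path_act_centr[OF A(4) c'(1,2) q]]) (rule eq)
    moreover have "pathfinish p = pathstart (\<lambda>t. act (c t) (pathfinish p))"
      using c'(3) gG(1) B(5) p(3) by (simp add: pathstart_def)
    ultimately have "homotopic_paths (Fix K) (p +++ (\<lambda>t. act (c t) (pathfinish p))) (p1 +++ (\<lambda>t. coset_act act (\<sigma> t) y))"
      using p1 by (intro homotopic_paths_join)
    with homotopic_centr_path[OF A(4) c p(1,2)] show ?thesis
      by (meson homotopic_paths_sym homotopic_paths_trans)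
  qed
  show ?thesis
  proof
    assume "(arr a b g p, arr a b g' p') \<in> Pi_rel G X act a b"
    then obtain \<sigma> p1 p1' where \<sigma>: "pathin (subtopology (coset_topology G L) (orbit_arrows G K L)) \<sigma>"
      "\<sigma> 0 = g <# L" "\<sigma> 1 = g' <# L" "homotopic_paths (Fix K) p p1" "homotopic_paths (Fix K) p' p1'"
      "homotopic_paths (Fix K) (p1 +++ (\<lambda>t. coset_act act (\<sigma> t) y)) p1'"
      unfolding Pi_rel_def arr_def ab path_class_def by auto
    obtain c where c: "centr_path K c" "\<And>t. t \<in> {0..1} \<Longrightarrow> \<sigma> t = (c t \<otimes> g) <# L"
      using centr_path_of_coset_path[OF A(1) B(1,3) gG(1) \<sigma>(2,1)] by blast
    have "homotopic_paths (Fix K) (\<lambda>t. act (c t) (p t)) p'"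
      using homotopic[OF c \<sigma>(4)] \<sigma>(5,6) by (meson homotopic_paths_sym homotopic_paths_trans)
    moreover have "(pathfinish c \<otimes> g) <# L = g' <# L" using c(2)[of 1] \<sigma>(3) by (simp add: pathfinish_def)
    ultimately show "arrow_rel a b g p g' p'" using c(1) unfolding arrow_rel_def ab by auto
  next
    assume "arrow_rel a b g p g' p'"
    then obtain c where c: "centr_path K c" "(pathfinish c \<otimes> g) <# L = g' <# L"
      "homotopic_paths (Fix K) (\<lambda>t. act (c t) (p t)) p'"
      unfolding arrow_rel_def ab by auto
    define \<sigma> where "\<sigma> t = (c t \<otimes> g) <# L" for t
    have "pathin (subtopology (coset_topology G L) (orbit_arrows G K L)) \<sigma>"
      unfolding \<sigma>_def using coset_path_of_centr_path[OF A(1) B(1) gG(1) gK c(1)] .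
    moreover have "\<sigma> 0 = g <# L" "\<sigma> 1 = g' <# L"
      using c(1,2) gG by (auto simp: \<sigma>_def centr_path_def pathstart_def pathfinish_def)
    moreover have "homotopic_paths (Fix K) (p +++ (\<lambda>t. coset_act act (\<sigma> t) y)) p'"
      using homotopic[OF c(1), of \<sigma> p] c(3) p(1,2) by (auto simp: \<sigma>_def intro: homotopic_paths_trans)
    moreover have "p \<in> path_class (Fix K) p" "p' \<in> path_class (Fix K) p'"
      using g g' by (auto simp: path_class_def arrow_def ab)
    ultimately show "(arr a b g p, arr a b g' p') \<in> Pi_rel G X act a b"
      using arr_mem unfolding Pi_rel_def arr_def ab by auto
  qed
qed

lemma centr_path_const: "K \<subseteq> carrier G \<Longrightarrow> centr_path K (\<lambda>_. \<one>)"
  by (auto simp: centr_path_def path_def path_image_def pathstart_def centr_def)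

lemma arrow_rel_of_homotopic:
  assumes a: "a \<in> Pi_obj G X act" and g: "arrow a b g p" and eq: "g <# fst b = g' <# fst b"
    and h: "homotopic_paths (Fix (fst a)) p p'"
  shows "arrow_rel a b g p g' p'"
proof -
  have p: "path p" "path_image p \<subseteq> Fix (fst a)" "g \<in> carrier G" using g by (auto simp: arrow_def)
  have "act \<one> (p t) = p t" if "t \<in> {0..1}" for t
    using Fix_pathD[OF p(2) that] by simp
  then have "homotopic_paths (Fix (fst a)) p (\<lambda>t. act \<one> (p t))"
    using p by (intro homotopic_paths_eq) auto
  with h have "homotopic_paths (Fix (fst a)) (\<lambda>t. act \<one> (p t)) p'"
    by (meson homotopic_paths_sym homotopic_paths_trans)
  then show ?thesis unfolding arrow_rel_def
    using centr_path_const[OF Pi_objD(4)[OF a]] eq p(3)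
    by (intro exI[of _ "\<lambda>_. \<one>"]) (simp add: pathfinish_def)
qed

text \<open>The centralizer is a group, so products and inverses of such paths are again of this
  kind; they witness transitivity and symmetry of \<open>arrow_rel\<close>.\<close>

lemma centr_path_mult:
  assumes K: "K \<subseteq> carrier G" and c: "centr_path K c" and d: "centr_path K d"
  shows "centr_path K (\<lambda>t. c t \<otimes> d t)"
  using c d subgroup.m_closed[OF centr_subgroup[OF K]] centrD(1)[of _ K]
  unfolding centr_path_def path_def path_image_def pathstart_def
  by (auto intro!: continuous_mult simp: image_subset_iff)

lemma centr_path_inv:
  assumes K: "K \<subseteq> carrier G" and c: "centr_path K c"
  shows "centr_path K (\<lambda>t. inv (c t))"
  using c subgroup.m_inv_closed[OF centr_subgroup[OF K]] centrD(1)[of _ K]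
  unfolding centr_path_def path_def path_image_def pathstart_def
  by (auto intro!: continuous_inv simp: image_subset_iff)

lemma arrow_rel_sym:
  assumes a: "a \<in> Pi_obj G X act" and b: "b \<in> Pi_obj G X act" and g: "arrow a b g p" and g': "arrow a b g' p'"
    and r: "arrow_rel a b g p g' p'"
  shows "arrow_rel a b g' p' g p"
proof -
  note K = Pi_objD(4)[OF a]
  obtain c where c: "centr_path (fst a) c" "(pathfinish c \<otimes> g) <# fst b = g' <# fst b"
    "homotopic_paths (Fix (fst a)) (\<lambda>t. act (c t) (p t)) p'" using r unfolding arrow_rel_def by blast
  have c': "\<And>t. t \<in> {0..1} \<Longrightarrow> c t \<in> carrier G" using centr_pathD(2)[OF c(1)] .
  then have c1: "pathfinish c \<in> carrier G" by (simp add: pathfinish_def)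
  have gG: "g \<in> carrier G" "g' \<in> carrier G" and p: "path p" "path_image p \<subseteq> Fix (fst a)"
    using g g' by (auto simp: arrow_def)
  note ci = centr_path_inv[OF K c(1)]
  have "homotopic_paths (Fix (fst a)) (\<lambda>t. act (inv (c t)) (act (c t) (p t))) (\<lambda>t. act (inv (c t)) (p' t))"
    using ci by (intro homotopic_act_centr[OF K _ _ c(3)]) (auto simp: centr_path_def)
  moreover have "homotopic_paths (Fix (fst a)) p (\<lambda>t. act (inv (c t)) (act (c t) (p t)))"
    using c' Fix_pathD[OF p(2)] by (intro homotopic_paths_eq[OF p]) simp
  ultimately have "homotopic_paths (Fix (fst a)) (\<lambda>t. act (inv (c t)) (p' t)) p"
    by (meson homotopic_paths_sym homotopic_paths_trans)
  moreover have "(pathfinish (\<lambda>t. inv (c t)) \<otimes> g') <# fst b = g <# fst b"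
  proof -
    have "(inv (pathfinish c) \<otimes> g') <# fst b = inv (pathfinish c) <# (g' <# fst b)"
      using c1 gG Pi_objD(4)[OF b] by (simp add: lcos_m_assoc)
    also have "\<dots> = inv (pathfinish c) <# ((pathfinish c \<otimes> g) <# fst b)" using c(2) by simp
    also have "\<dots> = g <# fst b" using c1 gG Pi_objD(4)[OF b] by (simp add: lcos_m_assoc)
    finally show ?thesis by (simp add: pathfinish_def)
  qed
  ultimately show ?thesis using ci unfolding arrow_rel_def by blast
qed

lemma arrow_rel_trans:
  assumes a: "a \<in> Pi_obj G X act" and b: "b \<in> Pi_obj G X act"
    and g: "arrow a b g p" "arrow a b g' p'" "arrow a b g'' p''"
    and r: "arrow_rel a b g p g' p'" "arrow_rel a b g' p' g'' p''"
  shows "arrow_rel a b g p g'' p''"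
proof -
  note K = Pi_objD(4)[OF a]
  obtain c where c: "centr_path (fst a) c" "(pathfinish c \<otimes> g) <# fst b = g' <# fst b"
    "homotopic_paths (Fix (fst a)) (\<lambda>t. act (c t) (p t)) p'" using r(1) unfolding arrow_rel_def by blast
  obtain d where d: "centr_path (fst a) d" "(pathfinish d \<otimes> g') <# fst b = g'' <# fst b"
    "homotopic_paths (Fix (fst a)) (\<lambda>t. act (d t) (p' t)) p''" using r(2) unfolding arrow_rel_def by blast
  have c': "\<And>t. t \<in> {0..1} \<Longrightarrow> c t \<in> carrier G" using centr_pathD(2)[OF c(1)] .
  have d': "\<And>t. t \<in> {0..1} \<Longrightarrow> d t \<in> carrier G" using centr_pathD(2)[OF d(1)] .
  have cd1: "pathfinish c \<in> carrier G" "pathfinish d \<in> carrier G" using c' d' by (simp_all add: pathfinish_def)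
  have gG: "g \<in> carrier G" "g' \<in> carrier G" and p: "path p" "path_image p \<subseteq> Fix (fst a)"
    using g by (auto simp: arrow_def)
  note dc = centr_path_mult[OF K d(1) c(1)]
  have "homotopic_paths (Fix (fst a)) (\<lambda>t. act (d t) (act (c t) (p t))) (\<lambda>t. act (d t) (p' t))"
    using d(1) by (intro homotopic_act_centr[OF K _ _ c(3)]) (auto simp: centr_path_def)
  moreover have "homotopic_paths (Fix (fst a)) (\<lambda>t. act (d t \<otimes> c t) (p t)) (\<lambda>t. act (d t) (act (c t) (p t)))"
  proof (intro homotopic_paths_eq)
    show "path (\<lambda>t. act (d t \<otimes> c t) (p t))" "path_image (\<lambda>t. act (d t \<otimes> c t) (p t)) \<subseteq> Fix (fst a)"
      using path_act_centr[OF K _ _ p, of "\<lambda>t. d t \<otimes> c t"] dc by (auto simp: centr_path_def)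
    show "act (d t \<otimes> c t) (p t) = act (d t) (act (c t) (p t))" if "t \<in> {0..1}" for t
      using c'[OF that] d'[OF that] Fix_pathD[OF p(2) that] by (intro act_mult)
  qed
  ultimately have "homotopic_paths (Fix (fst a)) (\<lambda>t. act (d t \<otimes> c t) (p t)) p''"
    using d(3) by (meson homotopic_paths_trans)
  moreover have "(pathfinish (\<lambda>t. d t \<otimes> c t) \<otimes> g) <# fst b = g'' <# fst b"
  proof -
    have "(pathfinish d \<otimes> pathfinish c \<otimes> g) <# fst b = pathfinish d <# ((pathfinish c \<otimes> g) <# fst b)"
      using cd1 gG Pi_objD(4)[OF b] by (simp add: lcos_m_assoc m_assoc)
    also have "\<dots> = g'' <# fst b" using c(2) d(2) cd1 gG Pi_objD(4)[OF b] by (simp add: lcos_m_assoc)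
    finally show ?thesis by (simp add: pathfinish_def)
  qed
  ultimately show ?thesis using dc unfolding arrow_rel_def by blast
qed

lemma equiv_Pi_rel:
  assumes a: "a \<in> Pi_obj G X act" and b: "b \<in> Pi_obj G X act"
  shows "equiv (Pi_arr G X act a b) (Pi_rel G X act a b)"
proof (rule equivI)
  show sub: "Pi_rel G X act a b \<subseteq> Pi_arr G X act a b \<times> Pi_arr G X act a b"
    unfolding Pi_rel_def by (auto split: prod.splits)
  show "refl_on (Pi_arr G X act a b) (Pi_rel G X act a b)"
  proof (rule refl_onI)
    fix u assume "u \<in> Pi_arr G X act a b"
    then obtain g p where g: "arrow a b g p" "u = arr a b g p" using Pi_arr_iff[OF a b] by blast
    then have "arrow_rel a b g p g p" using arrow_rel_of_homotopic[OF a g(1) refl] by (simp add: arrow_def)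
    then show "(u, u) \<in> Pi_rel G X act a b" using Pi_rel_iff[OF a b g(1) g(1)] g(2) by simp
  qed
  show "sym (Pi_rel G X act a b)"
  proof (rule symI)
    fix u v assume uv: "(u, v) \<in> Pi_rel G X act a b"
    then obtain g p g' p' where g: "arrow a b g p" "u = arr a b g p" "arrow a b g' p'" "v = arr a b g' p'"
      using sub Pi_arr_iff[OF a b] by blast
    then show "(v, u) \<in> Pi_rel G X act a b"
      using uv arrow_rel_sym[OF a b g(1,3)] Pi_rel_iff[OF a b g(1,3)] Pi_rel_iff[OF a b g(3,1)] by simp
  qed
  show "trans (Pi_rel G X act a b)"
  proof (rule transI)
    fix u v w assume uv: "(u, v) \<in> Pi_rel G X act a b" and vw: "(v, w) \<in> Pi_rel G X act a b"
    then obtain g p g' p' where g: "arrow a b g p" "u = arr a b g p" "arrow a b g' p'" "v = arr a b g' p'"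
      using sub Pi_arr_iff[OF a b] by blast
    obtain g'' p'' where g'': "arrow a b g'' p''" "w = arr a b g'' p''"
      using vw sub Pi_arr_iff[OF a b] by blast
    show "(u, w) \<in> Pi_rel G X act a b"
      using uv vw arrow_rel_trans[OF a b g(1,3) g''(1)] Pi_rel_iff[OF a b g(1,3)]
        Pi_rel_iff[OF a b g(3) g''(1)] Pi_rel_iff[OF a b g(1) g''(1)] g g'' by simp
  qed
qed

definition cls :: "'g set \<times> 'x \<Rightarrow> 'g set \<times> 'x \<Rightarrow> 'g \<Rightarrow> (real \<Rightarrow> 'x) \<Rightarrow> ('g set \<times> (real \<Rightarrow> 'x) set) set" where
  "cls a b g p = Pi_rel G X act a b `` {arr a b g p}"

lemma cls_eq_iff:
  assumes a: "a \<in> Pi_obj G X act" and b: "b \<in> Pi_obj G X act"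
    and g: "arrow a b g p" and g': "arrow a b g' p'"
  shows "cls a b g p = cls a b g' p' \<longleftrightarrow> arrow_rel a b g p g' p'"
proof -
  have "arr a b g p \<in> Pi_arr G X act a b" "arr a b g' p' \<in> Pi_arr G X act a b"
    using Pi_arr_iff[OF a b] g g' by auto
  then show ?thesis unfolding cls_def
    using eq_equiv_class_iff[OF equiv_Pi_rel[OF a b]] Pi_rel_iff[OF a b g g'] by simp
qed

lemma mem_cls_iff:
  assumes a: "a \<in> Pi_obj G X act" and b: "b \<in> Pi_obj G X act" and g: "arrow a b g p"
  shows "u \<in> cls a b g p \<longleftrightarrow> (\<exists>g' p'. arrow a b g' p' \<and> u = arr a b g' p' \<and> arrow_rel a b g p g' p')"
proof
  assume u: "u \<in> cls a b g p"
  then have "u \<in> Pi_arr G X act a b" unfolding cls_def Pi_rel_def by (auto split: prod.splits)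
  then obtain g' p' where "arrow a b g' p'" "u = arr a b g' p'" using Pi_arr_iff[OF a b] by blast
  then show "\<exists>g' p'. arrow a b g' p' \<and> u = arr a b g' p' \<and> arrow_rel a b g p g' p'"
    using u Pi_rel_iff[OF a b g] unfolding cls_def by blast
next
  assume "\<exists>g' p'. arrow a b g' p' \<and> u = arr a b g' p' \<and> arrow_rel a b g p g' p'"
  then show "u \<in> cls a b g p" using Pi_rel_iff[OF a b g] unfolding cls_def by blast
qed

lemma arr_mem_cls:
  assumes a: "a \<in> Pi_obj G X act" and b: "b \<in> Pi_obj G X act" and g: "arrow a b g p"
  shows "arr a b g p \<in> cls a b g p"
proof -
  have "arr a b g p \<in> Pi_arr G X act a b" using Pi_arr_iff[OF a b] g by auto
  then show ?thesis unfolding cls_def by (rule equiv_class_self[OF equiv_Pi_rel[OF a b]])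
qed

lemma Hom_iff:
  assumes a: "a \<in> Pi_obj G X act" and b: "b \<in> Pi_obj G X act"
  shows "A \<in> Hom (Pi_d G X act) a b \<longleftrightarrow> (\<exists>g p. arrow a b g p \<and> A = cls a b g p)"
proof -
  have "A \<in> Hom (Pi_d G X act) a b \<longleftrightarrow> (\<exists>u\<in>Pi_arr G X act a b. A = Pi_rel G X act a b `` {u})"
    unfolding Pi_d_def quotient_def by simp
  also have "\<dots> \<longleftrightarrow> (\<exists>u. (\<exists>g p. arrow a b g p \<and> u = arr a b g p) \<and> A = Pi_rel G X act a b `` {u})"
    unfolding Bex_def Pi_arr_iff[OF a b] ..
  also have "\<dots> \<longleftrightarrow> (\<exists>g p. arrow a b g p \<and> A = cls a b g p)" unfolding cls_def by metis
  finally show ?thesis .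
qed

section \<open>Composition and the category laws\<close>

definition path_comp :: "'g \<Rightarrow> (real \<Rightarrow> 'x) \<Rightarrow> (real \<Rightarrow> 'x) \<Rightarrow> real \<Rightarrow> 'x" where
  "path_comp g p q = p +++ (\<lambda>t. act g (q t))"

lemma path_act:
  assumes K: "K \<subseteq> carrier G" and g: "g \<in> carrier G" "\<And>k. k \<in> K \<Longrightarrow> inv g \<otimes> k \<otimes> g \<in> L"
    and q: "path q" "path_image q \<subseteq> Fix L"
  shows "path (\<lambda>t. act g (q t))" "path_image (\<lambda>t. act g (q t)) \<subseteq> Fix K"
proof -
  show "path (\<lambda>t. act g (q t))" unfolding path_def
    using q g(1) Fix_pathD(2)[OF q(2)] by (intro continuous_act continuous_intros) (auto simp: path_def)
  show "path_image (\<lambda>t. act g (q t)) \<subseteq> Fix K"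
    using act_Fix[OF g(1) K g(2)] Fix_pathD(1)[OF q(2)] unfolding path_image_def by blast
qed

lemma homotopic_act:
  assumes K: "K \<subseteq> carrier G" and g: "g \<in> carrier G" "\<And>k. k \<in> K \<Longrightarrow> inv g \<otimes> k \<otimes> g \<in> L"
    and h: "homotopic_paths (Fix L) q q'"
  shows "homotopic_paths (Fix K) (\<lambda>t. act g (q t)) (\<lambda>t. act g (q' t))"
proof -
  have "continuous_on (Fix L) (act g)"
    using g(1) by (intro continuous_act continuous_intros) (auto simp: fixed_points_def)
  moreover have "act g \<in> Fix L \<rightarrow> Fix K" using act_Fix[OF g(1) K g(2)] by blast
  ultimately show ?thesis using homotopic_paths_continuous_image[OF h] by (simp add: o_def)
qed

lemma arrow_comp:
  assumes a: "a \<in> Pi_obj G X act" and b: "b \<in> Pi_obj G X act" and c: "c \<in> Pi_obj G X act"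
    and g: "arrow a b g p" and h: "arrow b c h q"
  shows "arrow a c (g \<otimes> h) (path_comp g p q)"
proof -
  note A = Pi_objD[OF a] and B = Pi_objD[OF b] and C = Pi_objD[OF c]
  have gh: "g \<in> carrier G" "h \<in> carrier G" and gK: "\<And>k. k \<in> fst a \<Longrightarrow> inv g \<otimes> k \<otimes> g \<in> fst b"
    and hK: "\<And>k. k \<in> fst b \<Longrightarrow> inv h \<otimes> k \<otimes> h \<in> fst c"
    and p: "path p" "path_image p \<subseteq> Fix (fst a)" "pathstart p = snd a" "pathfinish p = act g (snd b)"
    and q: "path q" "path_image q \<subseteq> Fix (fst b)" "pathstart q = snd b" "pathfinish q = act h (snd c)"
    using g h unfolding arrow_def by auto
  note gq = path_act[OF A(4) gh(1) gK q(1,2)]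
  have e: "pathfinish p = pathstart (\<lambda>t. act g (q t))" using p(4) q(3) by (simp add: pathstart_def)
  have "inv (g \<otimes> h) \<otimes> k \<otimes> (g \<otimes> h) \<in> fst c" if k: "k \<in> fst a" for k
  proof -
    have "k \<in> carrier G" using k A(4) by blast
    then have "inv (g \<otimes> h) \<otimes> k \<otimes> (g \<otimes> h) = inv h \<otimes> (inv g \<otimes> k \<otimes> g) \<otimes> h"
      using gh by (simp add: inv_mult_group m_assoc)
    then show ?thesis using hK[OF gK[OF k]] by simp
  qed
  moreover have "pathfinish (\<lambda>t. act g (q t)) = act (g \<otimes> h) (snd c)"
    using q(4) gh C(5) by (simp add: pathfinish_def act_mult)
  ultimately show ?thesis
    unfolding arrow_def path_comp_def using gh p gq e by (auto simp: path_join_imp path_image_join)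
qed

lemma act_join: "(\<lambda>t. act ((c +++ d) t) ((p +++ q) t)) = (\<lambda>t. act (c t) (p t)) +++ (\<lambda>t. act (d t) (q t))"
  by (auto simp: joinpaths_def)

lemma centr_path_join:
  assumes "centr_path K c" "path d" "path_image d \<subseteq> centr K" "pathfinish c = pathstart d"
  shows "centr_path K (c +++ d)"
  using assms unfolding centr_path_def by (auto simp: path_join_imp path_image_join)

text \<open>The witness is \<open>d\<close> along the first path and then rests at its endpoint
  \<open>d1\<close>. There \<open>d1 \<otimes> g\<close> and \<open>g'\<close> represent the same
  coset of \<open>fst b\<close>, which fixes \<open>q\<close> pointwise, so they move the points of
  \<open>q\<close> alike.\<close>

lemma arrow_rel_comp_left:
  assumes a: "a \<in> Pi_obj G X act" and b: "b \<in> Pi_obj G X act" and c: "c \<in> Pi_obj G X act"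
    and g: "arrow a b g p" and g': "arrow a b g' p'" and h: "arrow b c h q"
    and r: "arrow_rel a b g p g' p'"
  shows "arrow_rel a c (g \<otimes> h) (path_comp g p q) (g' \<otimes> h) (path_comp g' p' q)"
proof -
  note A = Pi_objD[OF a] and B = Pi_objD[OF b] and C = Pi_objD[OF c]
  obtain d where d: "centr_path (fst a) d" "(pathfinish d \<otimes> g) <# fst b = g' <# fst b"
    "homotopic_paths (Fix (fst a)) (\<lambda>t. act (d t) (p t)) p'" using r unfolding arrow_rel_def by blast
  define d1 where "d1 = pathfinish d"
  have d1: "d1 \<in> carrier G" "d1 \<in> centr (fst a)" using centr_pathD[OF d(1), of 1] by (simp_all add: d1_def pathfinish_def)
  have gG: "g \<in> carrier G" "g' \<in> carrier G" "h \<in> carrier G" and hK: "\<And>k. k \<in> fst b \<Longrightarrow> inv h \<otimes> k \<otimes> h \<in> fst c"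
    and gK: "\<And>k. k \<in> fst a \<Longrightarrow> inv g \<otimes> k \<otimes> g \<in> fst b" "\<And>k. k \<in> fst a \<Longrightarrow> inv g' \<otimes> k \<otimes> g' \<in> fst b"
    and p: "path p" "path_image p \<subseteq> Fix (fst a)" "pathfinish p = act g (snd b)"
    and q: "path q" "path_image q \<subseteq> Fix (fst b)" "pathstart q = snd b"
    using g g' h unfolding arrow_def by auto
  have g'q: "act d1 (act g (q t)) = act g' (q t)" if t: "t \<in> {0..1}" for t
  proof -
    note qt = Fix_pathD[OF q(2) t]
    have "act d1 (act g (q t)) = coset_act act ((d1 \<otimes> g) <# fst b) (q t)"
      using coset_act_lcoset[OF B(1) _ qt(1)] qt gG d1 by (simp add: act_mult)
    also have "\<dots> = act g' (q t)" using coset_act_lcoset[OF B(1) gG(2) qt(1)] d(2) by (simp add: d1_def)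
    finally show ?thesis .
  qed
  define e where "e = d +++ (\<lambda>_. d1)"
  have e: "centr_path (fst a) e" unfolding e_def
    by (rule centr_path_join[OF d(1)]) (use d1 in \<open>auto simp: path_def path_image_def pathstart_def d1_def\<close>)
  have "(\<lambda>t. act (e t) (path_comp g p q t)) = (\<lambda>t. act (d t) (p t)) +++ (\<lambda>t. act d1 (act g (q t)))"
    unfolding e_def path_comp_def act_join ..
  moreover have "homotopic_paths (Fix (fst a)) ((\<lambda>t. act (d t) (p t)) +++ (\<lambda>t. act d1 (act g (q t)))) (path_comp g' p' q)"
    unfolding path_comp_def
  proof (intro homotopic_paths_join d(3))
    have "path (\<lambda>t. act g' (q t))" "path_image (\<lambda>t. act g' (q t)) \<subseteq> Fix (fst a)"
      using path_act[OF A(4) gG(2) gK(2) q(1,2)] by auto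
    then have "homotopic_paths (Fix (fst a)) (\<lambda>t. act g' (q t)) (\<lambda>t. act d1 (act g (q t)))"
      by (rule homotopic_paths_eq) (simp add: g'q)
    then show "homotopic_paths (Fix (fst a)) (\<lambda>t. act d1 (act g (q t))) (\<lambda>t. act g' (q t))"
      by (rule homotopic_paths_sym)
    show "pathfinish (\<lambda>t. act (d t) (p t)) = pathstart (\<lambda>t. act d1 (act g (q t)))"
      using p(3) q(3) by (simp add: pathfinish_def pathstart_def d1_def)
  qed
  moreover have "(pathfinish e \<otimes> (g \<otimes> h)) <# fst c = (g' \<otimes> h) <# fst c"
  proof -
    have "(d1 \<otimes> g \<otimes> h) <# fst c = ((d1 \<otimes> g) <# fst b) <#> (h <# fst c)"
      using lcoset_mult[OF B(1) C(1) _ gG(3) hK, of "d1 \<otimes> g"] d1 gG by simp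
    also have "\<dots> = (g' \<otimes> h) <# fst c"
      using lcoset_mult[OF B(1) C(1) gG(2,3) hK] d(2) by (simp add: d1_def)
    finally show ?thesis using d1 gG by (simp add: e_def pathfinish_def joinpaths_def m_assoc)
  qed
  ultimately show ?thesis unfolding arrow_rel_def using e by (intro exI[of _ e]) auto
qed

text \<open>The witness rests at \<open>\<one>\<close> along the first path and is then
  \<open>g \<otimes> d t \<otimes> inv g\<close>. As \<open>inv g \<otimes> k \<otimes> g\<close>
  lies in \<open>fst b\<close> for \<open>k\<close> in \<open>fst a\<close>, conjugation by
  \<open>g\<close> carries the centralizer of \<open>fst b\<close> into that of
  \<open>fst a\<close>.\<close>

lemma arrow_rel_comp_right:
  assumes a: "a \<in> Pi_obj G X act" and b: "b \<in> Pi_obj G X act" and c: "c \<in> Pi_obj G X act"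
    and g: "arrow a b g p" and h: "arrow b c h q" and h': "arrow b c h' q'"
    and r: "arrow_rel b c h q h' q'"
  shows "arrow_rel a c (g \<otimes> h) (path_comp g p q) (g \<otimes> h') (path_comp g p q')"
proof -
  note A = Pi_objD[OF a] and B = Pi_objD[OF b] and C = Pi_objD[OF c]
  obtain d where d: "centr_path (fst b) d" "(pathfinish d \<otimes> h) <# fst c = h' <# fst c"
    "homotopic_paths (Fix (fst b)) (\<lambda>t. act (d t) (q t)) q'" using r unfolding arrow_rel_def by blast
  note dt = centr_pathD[OF d(1)]
  have d1: "pathfinish d \<in> carrier G" using dt(2)[of 1] by (simp add: pathfinish_def)
  have gG: "g \<in> carrier G" "h \<in> carrier G" "h' \<in> carrier G"
    and gK: "\<And>k. k \<in> fst a \<Longrightarrow> inv g \<otimes> k \<otimes> g \<in> fst b"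
    and p: "path p" "path_image p \<subseteq> Fix (fst a)" "pathfinish p = act g (snd b)"
    and q: "path q" "path_image q \<subseteq> Fix (fst b)" "pathstart q = snd b"
    using g h h' unfolding arrow_def by auto
  define e2 where "e2 t = g \<otimes> d t \<otimes> inv g" for t
  have e2c: "e2 t \<in> centr (fst a)" if t: "t \<in> {0..1}" for t
  proof -
    have "e2 t \<otimes> k = k \<otimes> e2 t" if k: "k \<in> fst a" for k
    proof -
      have kc: "k \<in> carrier G" using k A(4) by blast
      have "e2 t \<otimes> k = g \<otimes> (d t \<otimes> (inv g \<otimes> k \<otimes> g)) \<otimes> inv g"
        using kc gG dt(2)[OF t] by (simp add: e2_def m_assoc)
      also have "d t \<otimes> (inv g \<otimes> k \<otimes> g) = (inv g \<otimes> k \<otimes> g) \<otimes> d t" using centrD(2)[OF dt(1)[OF t] gK[OF k]] .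
      also have "g \<otimes> ((inv g \<otimes> k \<otimes> g) \<otimes> d t) \<otimes> inv g = k \<otimes> e2 t"
        using kc gG dt(2)[OF t] by (simp add: e2_def m_assoc)
      finally show ?thesis .
    qed
    then show ?thesis using gG dt(2)[OF t] by (simp add: centr_def e2_def)
  qed
  have e2: "path e2" "path_image e2 \<subseteq> centr (fst a)" "pathstart e2 = \<one>"
  proof -
    show "path e2" unfolding path_def e2_def
      using d(1) dt(2) gG(1) by (intro continuous_mult continuous_intros) (auto simp: centr_path_def path_def)
    show "path_image e2 \<subseteq> centr (fst a)" using e2c by (auto simp: path_image_def)
    show "pathstart e2 = \<one>" using d(1) gG(1) by (simp add: pathstart_def e2_def centr_path_def)
  qed
  define e where "e = (\<lambda>_. \<one>) +++ e2"
  have e: "centr_path (fst a) e" unfolding e_def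
    by (rule centr_path_join[OF centr_path_const[OF A(4)] e2(1,2)]) (simp add: e2(3) pathfinish_def)
  have "(\<lambda>t. act (e t) (path_comp g p q t)) = (\<lambda>t. act \<one> (p t)) +++ (\<lambda>t. act (e2 t) (act g (q t)))"
    unfolding e_def path_comp_def act_join ..
  moreover have "homotopic_paths (Fix (fst a)) ((\<lambda>t. act \<one> (p t)) +++ (\<lambda>t. act (e2 t) (act g (q t)))) (path_comp g p q')"
    unfolding path_comp_def
  proof (intro homotopic_paths_join)
    have "homotopic_paths (Fix (fst a)) p (\<lambda>t. act \<one> (p t))"
      using Fix_pathD(2)[OF p(2)] by (intro homotopic_paths_eq[OF p(1,2)]) simp
    then show "homotopic_paths (Fix (fst a)) (\<lambda>t. act \<one> (p t)) p" by (rule homotopic_paths_sym)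
    have "homotopic_paths (Fix (fst a)) (\<lambda>t. act g (act (d t) (q t))) (\<lambda>t. act g (q' t))"
      by (rule homotopic_act[OF A(4) gG(1) gK d(3)])
    moreover have "homotopic_paths (Fix (fst a)) (\<lambda>t. act (e2 t) (act g (q t))) (\<lambda>t. act g (act (d t) (q t)))"
    proof (rule homotopic_paths_eq)
      show "path (\<lambda>t. act (e2 t) (act g (q t)))" "path_image (\<lambda>t. act (e2 t) (act g (q t))) \<subseteq> Fix (fst a)"
        using path_act_centr[OF A(4) e2(1,2) path_act[OF A(4) gG(1) gK q(1,2)]] by auto
      fix t :: real assume t: "t \<in> {0..1}"
      note qt = Fix_pathD(2)[OF q(2) t]
      have "act (e2 t) (act g (q t)) = act (g \<otimes> d t) (act (inv g) (act g (q t)))"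
        unfolding e2_def using gG dt(2)[OF t] qt by (intro act_mult) auto
      then show "act (e2 t) (act g (q t)) = act g (act (d t) (q t))"
        using gG dt(2)[OF t] qt by (simp add: act_mult)
    qed
    ultimately show "homotopic_paths (Fix (fst a)) (\<lambda>t. act (e2 t) (act g (q t))) (\<lambda>t. act g (q' t))"
      by (rule homotopic_paths_trans[rotated])
    show "pathfinish (\<lambda>t. act \<one> (p t)) = pathstart (\<lambda>t. act (e2 t) (act g (q t)))"
      using p(3) q(3) e2(3) by (simp add: pathfinish_def pathstart_def)
  qed
  moreover have "(pathfinish e \<otimes> (g \<otimes> h)) <# fst c = (g \<otimes> h') <# fst c"
  proof -
    have "pathfinish e \<otimes> (g \<otimes> h) = g \<otimes> (pathfinish d \<otimes> h)"
      using d1 gG by (simp add: e_def e2_def joinpaths_def pathfinish_def m_assoc)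
    then have "(pathfinish e \<otimes> (g \<otimes> h)) <# fst c = g <# ((pathfinish d \<otimes> h) <# fst c)"
      using d1 gG C(4) by (simp add: lcos_m_assoc)
    also have "\<dots> = (g \<otimes> h') <# fst c" using d(2) gG C(4) by (simp add: lcos_m_assoc)
    finally show ?thesis .
  qed
  ultimately show ?thesis unfolding arrow_rel_def using e by (intro exI[of _ e]) auto
qed

lemma arrow_rel_comp:
  assumes a: "a \<in> Pi_obj G X act" and b: "b \<in> Pi_obj G X act" and c: "c \<in> Pi_obj G X act"
    and g: "arrow a b g p" "arrow a b g' p'" "arrow_rel a b g p g' p'"
    and h: "arrow b c h q" "arrow b c h' q'" "arrow_rel b c h q h' q'"
  shows "arrow_rel a c (g \<otimes> h) (path_comp g p q) (g' \<otimes> h') (path_comp g' p' q')"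
  by (rule arrow_rel_trans[OF a c arrow_comp[OF a b c g(1) h(1)] arrow_comp[OF a b c g(2) h(1)]
        arrow_comp[OF a b c g(2) h(2)] arrow_rel_comp_left[OF a b c g(1,2) h(1) g(3)]
        arrow_rel_comp_right[OF a b c g(2) h]])

lemma Pi_comp_arr:
  assumes a: "a \<in> Pi_obj G X act" and b: "b \<in> Pi_obj G X act" and c: "c \<in> Pi_obj G X act"
    and g: "arrow a b g p" and h: "arrow b c h q"
  shows "Pi_comp G X act a (arr a b g p) (arr b c h q) = arr a c (g \<otimes> h) (path_comp g p q)"
proof -
  note A = Pi_objD[OF a] and B = Pi_objD[OF b] and C = Pi_objD[OF c]
  have gG: "g \<in> carrier G" "h \<in> carrier G" and hK: "\<And>k. k \<in> fst b \<Longrightarrow> inv h \<otimes> k \<otimes> h \<in> fst c"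
    and gK: "\<And>k. k \<in> fst a \<Longrightarrow> inv g \<otimes> k \<otimes> g \<in> fst b"
    and p: "path p" "path_image p \<subseteq> Fix (fst a)" "pathfinish p = act g (snd b)"
    and q: "path q" "path_image q \<subseteq> Fix (fst b)" "pathstart q = snd b"
    using g h unfolding arrow_def by auto
  have "path_class (Fix (fst a)) (p1 +++ (\<lambda>t. coset_act act (g <# fst b) (q1 t))) = path_class (Fix (fst a)) (path_comp g p q)"
    if p1: "p1 \<in> path_class (Fix (fst a)) p" and q1: "q1 \<in> path_class (Fix (fst b)) q" for p1 q1
  proof (rule path_class_eq)
    have hp: "homotopic_paths (Fix (fst a)) p p1" and hq: "homotopic_paths (Fix (fst b)) q q1"
      using p1 q1 by (auto simp: path_class_def)
    have q1': "path q1" "path_image q1 \<subseteq> Fix (fst b)"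
      using homotopic_paths_imp_path[OF hq] homotopic_paths_imp_subset[OF hq] by auto
    have "homotopic_paths (Fix (fst a)) (\<lambda>t. act g (q1 t)) (\<lambda>t. coset_act act (g <# fst b) (q1 t))"
      using path_act[OF A(4) gG(1) gK q1'] Fix_pathD[OF q1'(2)] coset_act_lcoset[OF B(1) gG(1)]
      by (intro homotopic_paths_eq) auto
    moreover have "homotopic_paths (Fix (fst a)) (\<lambda>t. act g (q t)) (\<lambda>t. act g (q1 t))"
      by (rule homotopic_act[OF A(4) gG(1) gK hq])
    ultimately have "homotopic_paths (Fix (fst a)) (\<lambda>t. act g (q t)) (\<lambda>t. coset_act act (g <# fst b) (q1 t))"
      by (rule homotopic_paths_trans[rotated])
    then have "homotopic_paths (Fix (fst a)) (path_comp g p q) (p1 +++ (\<lambda>t. coset_act act (g <# fst b) (q1 t)))"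
      unfolding path_comp_def using p(3) q(3)
      by (intro homotopic_paths_join hp) (auto simp: pathstart_def)
    then show "homotopic_paths (Fix (fst a)) (p1 +++ (\<lambda>t. coset_act act (g <# fst b) (q1 t))) (path_comp g p q)"
      by (rule homotopic_paths_sym)
  qed
  moreover have "p \<in> path_class (Fix (fst a)) p" "q \<in> path_class (Fix (fst b)) q"
    using p q by (auto simp: path_class_def)
  ultimately have "(\<Union>p1\<in>path_class (Fix (fst a)) p. \<Union>q1\<in>path_class (Fix (fst b)) q.
      path_class (Fix (fst a)) (p1 +++ (\<lambda>t. coset_act act (g <# fst b) (q1 t)))) = path_class (Fix (fst a)) (path_comp g p q)"
    by blast
  then show ?thesis
    using lcoset_mult[OF B(1) C(1) gG hK] by (simp add: Pi_comp_def arr_def split_beta)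
qed

text \<open>Composition is defined as a union over representatives. By \<open>arrow_rel_comp\<close>
  all sets in the union coincide, and the classes are nonempty, so the union is that one
  set.\<close>

lemma Comp_cls:
  assumes a: "a \<in> Pi_obj G X act" and b: "b \<in> Pi_obj G X act" and c: "c \<in> Pi_obj G X act"
    and g: "arrow a b g p" and h: "arrow b c h q"
  shows "Comp (Pi_d G X act) a b c (cls a b g p) (cls b c h q) = cls a c (g \<otimes> h) (path_comp g p q)"
proof -
  have "Pi_rel G X act a c `` {Pi_comp G X act a u v} = cls a c (g \<otimes> h) (path_comp g p q)"
    if uv: "u \<in> cls a b g p" "v \<in> cls b c h q" for u v
  proof -
    obtain g' p' where g': "arrow a b g' p'" "u = arr a b g' p'" "arrow_rel a b g p g' p'"
      using uv(1) mem_cls_iff[OF a b g] by blast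
    obtain h' q' where h': "arrow b c h' q'" "v = arr b c h' q'" "arrow_rel b c h q h' q'"
      using uv(2) mem_cls_iff[OF b c h] by blast
    have "cls a c (g \<otimes> h) (path_comp g p q) = cls a c (g' \<otimes> h') (path_comp g' p' q')"
      using arrow_rel_comp[OF a b c g g'(1,3) h h'(1,3)]
        cls_eq_iff[OF a c arrow_comp[OF a b c g h] arrow_comp[OF a b c g'(1) h'(1)]] by simp
    then show ?thesis unfolding g'(2) h'(2) Pi_comp_arr[OF a b c g'(1) h'(1)] cls_def by simp
  qed
  moreover note arr_mem_cls[OF a b g] arr_mem_cls[OF b c h]
  ultimately have "(\<Union>u\<in>cls a b g p. \<Union>v\<in>cls b c h q. Pi_rel G X act a c `` {Pi_comp G X act a u v}) =
      cls a c (g \<otimes> h) (path_comp g p q)" by blast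
  then show ?thesis by (simp add: Pi_d_def)
qed

lemma arrow_one: "a \<in> Pi_obj G X act \<Longrightarrow> arrow a a \<one> (\<lambda>_. snd a)"
  using Pi_objD[of a] by (auto simp: arrow_def path_def path_image_def pathstart_def pathfinish_def)

lemma Ident_cls:
  assumes "a \<in> Pi_obj G X act"
  shows "Ident (Pi_d G X act) a = cls a a \<one> (\<lambda>_. snd a)"
  using coset_mult_one[of "fst a"] lcos_mult_one[OF Pi_objD(4)[OF assms]]
  by (simp add: Pi_d_def cls_def arr_def)

text \<open>Units and associativity hold already for homotopy classes of paths, so the constant
  2-cell of \<open>arrow_rel_of_homotopic\<close> suffices.\<close>

theorem is_category_Pi_d: "is_category (Pi_d G X act)"
proof -
  have obj: "Obj (Pi_d G X act) = Pi_obj G X act" by (simp add: Pi_d_def)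
  show ?thesis unfolding is_category_def obj
  proof (intro conjI ballI)
    fix a assume a: "a \<in> Pi_obj G X act"
    show "Ident (Pi_d G X act) a \<in> Hom (Pi_d G X act) a a"
      using Hom_iff[OF a a] Ident_cls[OF a] arrow_one[OF a] by blast
    fix b assume b: "b \<in> Pi_obj G X act"
    {
      fix u assume "u \<in> Hom (Pi_d G X act) a b"
      then obtain g p where g: "arrow a b g p" "u = cls a b g p" using Hom_iff[OF a b] by blast
      have gG: "g \<in> carrier G" and p: "path p" "path_image p \<subseteq> Fix (fst a)" "pathstart p = snd a" "pathfinish p = act g (snd b)"
        using g(1) by (auto simp: arrow_def)
      have one_p: "homotopic_paths (Fix (fst a)) p (\<lambda>t. act \<one> (p t))"
        using Fix_pathD(2)[OF p(2)] by (intro homotopic_paths_eq[OF p(1,2)]) simp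
      note l = arrow_comp[OF a a b arrow_one[OF a] g(1)] and r = arrow_comp[OF a b b g(1) arrow_one[OF b]]
      have "homotopic_paths (Fix (fst a)) (path_comp \<one> (\<lambda>_. snd a) p) p"
      proof -
        have "homotopic_paths (Fix (fst a)) (path_comp \<one> (\<lambda>_. snd a) p) ((\<lambda>_. pathstart p) +++ p)"
          unfolding path_comp_def p(3)
          using Pi_objD[OF a] p(3) by (intro homotopic_paths_join homotopic_paths_sym[OF one_p])
            (auto simp: path_def path_image_def pathstart_def pathfinish_def)
        then show ?thesis using homotopic_paths_const_join(1)[OF p(1,2)] by (rule homotopic_paths_trans)
      qed
      then have "arrow_rel a b (\<one> \<otimes> g) (path_comp \<one> (\<lambda>_. snd a) p) g p"
        using gG by (intro arrow_rel_of_homotopic[OF a l]) simp_all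
      then show "Comp (Pi_d G X act) a a b (Ident (Pi_d G X act) a) u = u"
        using Comp_cls[OF a a b arrow_one[OF a] g(1)] cls_eq_iff[OF a b l g(1)] g(2) Ident_cls[OF a] by simp
      have "homotopic_paths (Fix (fst a)) (path_comp g p (\<lambda>_. snd b)) p"
        unfolding path_comp_def p(4)[symmetric] by (rule homotopic_paths_const_join(2)[OF p(1,2)])
      then have "arrow_rel a b (g \<otimes> \<one>) (path_comp g p (\<lambda>_. snd b)) g p"
        using gG by (intro arrow_rel_of_homotopic[OF a r]) simp_all
      then show "Comp (Pi_d G X act) a b b u (Ident (Pi_d G X act) b) = u"
        using Comp_cls[OF a b b g(1) arrow_one[OF b]] cls_eq_iff[OF a b r g(1)] g(2) Ident_cls[OF b] by simp
    }
    fix c assume c: "c \<in> Pi_obj G X act"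
    fix u assume "u \<in> Hom (Pi_d G X act) a b"
    then obtain g p where g: "arrow a b g p" "u = cls a b g p" using Hom_iff[OF a b] by blast
    fix v assume "v \<in> Hom (Pi_d G X act) b c"
    then obtain h q where h: "arrow b c h q" "v = cls b c h q" using Hom_iff[OF b c] by blast
    note gh = arrow_comp[OF a b c g(1) h(1)]
    show "Comp (Pi_d G X act) a b c u v \<in> Hom (Pi_d G X act) a c"
      unfolding Hom_iff[OF a c] using Comp_cls[OF a b c g(1) h(1)] gh g(2) h(2) by blast
    fix d assume d: "d \<in> Pi_obj G X act"
    fix w assume "w \<in> Hom (Pi_d G X act) c d"
    then obtain k r where k: "arrow c d k r" "w = cls c d k r" using Hom_iff[OF c d] by blast
    note hk = arrow_comp[OF b c d h(1) k(1)]
    note l = arrow_comp[OF a c d gh k(1)] and r = arrow_comp[OF a b d g(1) hk]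
    have G: "g \<in> carrier G" "h \<in> carrier G" "k \<in> carrier G" using g h k by (auto simp: arrow_def)
    have gK: "\<And>k. k \<in> fst a \<Longrightarrow> inv g \<otimes> k \<otimes> g \<in> fst b" and hK: "\<And>k. k \<in> fst b \<Longrightarrow> inv h \<otimes> k \<otimes> h \<in> fst c"
      and P: "path p" "path_image p \<subseteq> Fix (fst a)" "pathfinish p = act g (snd b)"
      and Q: "path q" "path_image q \<subseteq> Fix (fst b)" "pathstart q = snd b" "pathfinish q = act h (snd c)"
      and R: "path r" "path_image r \<subseteq> Fix (fst c)" "pathstart r = snd c"
      using g(1) h(1) k(1) by (auto simp: arrow_def)
    note A = Pi_objD(4)[OF a] and B = Pi_objD(4)[OF b]
    note gQ = path_act[OF A G(1) gK Q(1,2)] and hR = path_act[OF B G(2) hK R(1,2)]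
    note ghR = path_act[OF A G(1) gK hR]
    have h1: "homotopic_paths (Fix (fst a)) ((p +++ (\<lambda>t. act g (q t))) +++ (\<lambda>t. act g (act h (r t))))
        (p +++ ((\<lambda>t. act g (q t)) +++ (\<lambda>t. act g (act h (r t)))))"
      using P Q R by (intro homotopic_paths_sym[OF homotopic_paths_assoc] P(1,2) gQ ghR)
        (auto simp: pathstart_def pathfinish_def)
    have e1: "(p +++ ((\<lambda>t. act g (q t)) +++ (\<lambda>t. act g (act h (r t))))) = path_comp g p (path_comp h q r)"
      unfolding path_comp_def by (auto simp: joinpaths_def)
    have h2: "homotopic_paths (Fix (fst a)) (path_comp (g \<otimes> h) (path_comp g p q) r)
        ((p +++ (\<lambda>t. act g (q t))) +++ (\<lambda>t. act g (act h (r t))))"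
      unfolding path_comp_def
    proof (rule homotopic_paths_join)
      show "homotopic_paths (Fix (fst a)) (p +++ (\<lambda>t. act g (q t))) (p +++ (\<lambda>t. act g (q t)))"
        using gh by (simp add: arrow_def path_comp_def)
      have "act g (act h (r t)) = act (g \<otimes> h) (r t)" if "t \<in> {0..1}" for t
        using act_mult[OF G(1,2) Fix_pathD(2)[OF R(2) that]] by simp
      then have "homotopic_paths (Fix (fst a)) (\<lambda>t. act g (act h (r t))) (\<lambda>t. act (g \<otimes> h) (r t))"
        by (intro homotopic_paths_eq[OF ghR]) auto
      then show "homotopic_paths (Fix (fst a)) (\<lambda>t. act (g \<otimes> h) (r t)) (\<lambda>t. act g (act h (r t)))"
        by (rule homotopic_paths_sym)
      show "pathfinish (p +++ (\<lambda>t. act g (q t))) = pathstart (\<lambda>t. act (g \<otimes> h) (r t))"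
        using gh R(3) by (simp add: arrow_def path_comp_def pathstart_def)
    qed
    have "homotopic_paths (Fix (fst a)) (path_comp (g \<otimes> h) (path_comp g p q) r) (path_comp g p (path_comp h q r))"
      using homotopic_paths_trans[OF h2 h1] unfolding e1 .
    then have "arrow_rel a d (g \<otimes> h \<otimes> k) (path_comp (g \<otimes> h) (path_comp g p q) r) (g \<otimes> (h \<otimes> k)) (path_comp g p (path_comp h q r))"
      using G by (intro arrow_rel_of_homotopic[OF a l]) (simp_all add: m_assoc)
    then show "Comp (Pi_d G X act) a c d (Comp (Pi_d G X act) a b c u v) w =
        Comp (Pi_d G X act) a b d u (Comp (Pi_d G X act) b c d v w)"
      using Comp_cls[OF a b c g(1) h(1)] Comp_cls[OF b c d h(1) k(1)] Comp_cls[OF a c d gh k(1)]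
        Comp_cls[OF a b d g(1) hk] cls_eq_iff[OF a d l r] g(2) h(2) k(2) by simp
  qed
qed

end

section \<open>Essential equivalences\<close>

text \<open>
  The function \<open>\<delta>\<close> inverts \<open>g \<mapsto> (x, g x, \<phi> g)\<close>. Local sections of \<open>(h, x) \<mapsto> h f(x)\<close> are required to be
  equivariant for \<open>k \<cdot> (h, x) = (\<phi>(k) h \<phi>(\<rho> k)\<^sup>-\<^sup>1, \<rho>(k) x)\<close>, where \<open>\<rho>\<close> is any homomorphism from \<open>K\<close>.
\<close>

locale action_equivalence =
  GX: finite_isotropy_action G X actX + HY: finite_isotropy_action H Y actY
  for G :: "('g::topological_space, 'z) monoid_scheme" (structure)
    and X :: "'x::topological_space set" and actX
    and H :: "('h::topological_space, 'w) monoid_scheme" (structure)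
    and Y :: "'y::topological_space set" and actY +
  fixes \<phi> :: "'g \<Rightarrow> 'h" and f :: "'x \<Rightarrow> 'y" and \<delta> :: "'x \<Rightarrow> 'x \<Rightarrow> 'h \<Rightarrow> 'g"
  assumes hom: "\<phi> \<in> hom G H" and cont_\<phi>: "continuous_on (carrier G) \<phi>"
    and cont_f: "continuous_on X f" and f_closed [simp]: "x \<in> X \<Longrightarrow> f x \<in> Y"
    and f_act: "g \<in> carrier G \<Longrightarrow> x \<in> X \<Longrightarrow> f (actX g x) = actY (\<phi> g) (f x)"
    and surj: "y \<in> Y \<Longrightarrow> \<exists>h\<in>carrier H. \<exists>x\<in>X. actY h (f x) = y"
    and \<delta>: "\<lbrakk>x \<in> X; x' \<in> X; h \<in> carrier H; actY h (f x) = f x'\<rbrakk> \<Longrightarrow>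
      \<delta> x x' h \<in> carrier G \<and> actX (\<delta> x x' h) x = x' \<and> \<phi> (\<delta> x x' h) = h"
    and unique: "\<lbrakk>g \<in> carrier G; g' \<in> carrier G; x \<in> X; actX g x = actX g' x; \<phi> g = \<phi> g'\<rbrakk> \<Longrightarrow> g = g'"
    and cont_\<delta>: "continuous_on {(x, x', h). x \<in> X \<and> x' \<in> X \<and> h \<in> carrier H \<and> actY h (f x) = f x'}
      (\<lambda>(x, x', h). \<delta> x x' h)"
    and local_section: "\<lbrakk>subgroup K G; finite K; \<rho> \<in> hom (G\<lparr>carrier := K\<rparr>) G; h0 \<in> carrier H; x0 \<in> X;
        \<And>k. k \<in> K \<Longrightarrow> \<phi> k \<otimes>\<^bsub>H\<^esub> h0 = h0 \<otimes>\<^bsub>H\<^esub> \<phi> (\<rho> k); \<And>k. k \<in> K \<Longrightarrow> actX (\<rho> k) x0 = x0\<rbrakk> \<Longrightarrow>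
      \<exists>V s. openin (top_of_set Y) V \<and> actY h0 (f x0) \<in> V \<and> continuous_on V s \<and>
        (\<forall>q\<in>V. fst (s q) \<in> carrier H \<and> snd (s q) \<in> X \<and> actY (fst (s q)) (f (snd (s q))) = q \<and>
           ((\<forall>k\<in>K. actY (\<phi> k) q = q) \<longrightarrow>
            (\<forall>k\<in>K. \<phi> k \<otimes>\<^bsub>H\<^esub> fst (s q) = fst (s q) \<otimes>\<^bsub>H\<^esub> \<phi> (\<rho> k) \<and> actX (\<rho> k) (snd (s q)) = snd (s q))))"
begin

sublocale \<phi>: group_hom G H \<phi>
  by (unfold_locales) (rule hom)

section \<open>The principal bundle over \<open>Y\<close> and its sections\<close>

lemma image_subgroup: "subgroup K G \<Longrightarrow> subgroup (\<phi> ` K) H"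
  by (rule \<phi>.subgroup_img_is_subgroup)

lemma f_Fix:
  assumes "x \<in> GX.Fix K" "K \<subseteq> carrier G"
  shows "f x \<in> HY.Fix (\<phi> ` K)"
proof -
  have "actY (\<phi> k) (f x) = f x" if "k \<in> K" for k
    using f_act[of k x] GX.FixD[OF assms(1)] assms(2) that by auto
  then show ?thesis using GX.FixD(1)[OF assms(1)] by (auto simp: fixed_points_def)
qed

text \<open>\<open>\<phi>\<close> is injective on the isotropy group of \<open>y\<close>. An element
  of that group can therefore be recognized as a member of \<open>L\<close> by its image, which is
  how conditions on cosets come back from \<open>H\<close> to \<open>G\<close>.\<close>

lemma stabilizer_inj:
  assumes "g \<in> carrier G" "l \<in> L" "L \<subseteq> carrier G" "y \<in> GX.Fix L" "actX g y = y" "\<phi> g = \<phi> l"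
  shows "g \<in> L"
  using unique[of g l y] assms GX.FixD[of y L] by auto

text \<open>The fibre over \<open>q\<close> of the part of \<open>H \<times> X\<close> fixed by \<open>K\<close>, which acts on \<open>X\<close> through \<open>\<rho>\<close>.\<close>

definition fibre :: "'g set \<Rightarrow> ('g \<Rightarrow> 'g) \<Rightarrow> 'y \<Rightarrow> ('h \<times> 'x) set" where
  "fibre K \<rho> q = {(h, x). h \<in> carrier H \<and> x \<in> X \<and> actY h (f x) = q \<and>
     (\<forall>k\<in>K. \<rho> k \<in> carrier G \<and> \<phi> k \<otimes>\<^bsub>H\<^esub> h = h \<otimes>\<^bsub>H\<^esub> \<phi> (\<rho> k) \<and> actX (\<rho> k) x = x)}"

text \<open>The element of \<open>G\<close> that takes \<open>z\<close> to \<open>z'\<close> under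
  the principal action g (h, x) = (h \<phi>(g)^-1, g x), for \<open>z\<close> and \<open>z'\<close>
  over the same point.\<close>

definition division :: "'h \<times> 'x \<Rightarrow> 'h \<times> 'x \<Rightarrow> 'g" where
  "division z z' = \<delta> (snd z) (snd z') (inv\<^bsub>H\<^esub> (fst z') \<otimes>\<^bsub>H\<^esub> fst z)"

text \<open>The principal action of that element on \<open>w\<close>; this is the operation
  \<open>T\<close> of \<open>section_on_square\<close>.\<close>

definition transport :: "'h \<times> 'x \<Rightarrow> 'h \<times> 'x \<Rightarrow> 'h \<times> 'x \<Rightarrow> 'h \<times> 'x" where
  "transport z z' w = (fst w \<otimes>\<^bsub>H\<^esub> inv\<^bsub>H\<^esub> \<phi> (division z z'), actX (division z z') (snd w))"

lemma fibreD:
  assumes "z \<in> fibre K \<rho> q"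
  shows "fst z \<in> carrier H" "snd z \<in> X" "actY (fst z) (f (snd z)) = q"
    "k \<in> K \<Longrightarrow> \<rho> k \<in> carrier G" "k \<in> K \<Longrightarrow> \<phi> k \<otimes>\<^bsub>H\<^esub> fst z = fst z \<otimes>\<^bsub>H\<^esub> \<phi> (\<rho> k)"
    "k \<in> K \<Longrightarrow> actX (\<rho> k) (snd z) = snd z"
  using assms by (auto simp: fibre_def)

lemma division:
  assumes z: "z \<in> fibre K \<rho> q" and z': "z' \<in> fibre K \<rho>' q"
  shows "division z z' \<in> carrier G" "actX (division z z') (snd z) = snd z'"
    "\<phi> (division z z') = inv\<^bsub>H\<^esub> (fst z') \<otimes>\<^bsub>H\<^esub> fst z"
    "actY (inv\<^bsub>H\<^esub> (fst z') \<otimes>\<^bsub>H\<^esub> fst z) (f (snd z)) = f (snd z')"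
proof -
  note zD = fibreD[OF z] and zD' = fibreD[OF z']
  have "actY (inv\<^bsub>H\<^esub> (fst z') \<otimes>\<^bsub>H\<^esub> fst z) (f (snd z)) = actY (inv\<^bsub>H\<^esub> (fst z')) (actY (fst z) (f (snd z)))"
    using zD(1,2) zD'(1) by (intro HY.act_mult) auto
  also have "actY (fst z) (f (snd z)) = actY (fst z') (f (snd z'))" using zD(3) zD'(3) by simp
  finally show eq: "actY (inv\<^bsub>H\<^esub> (fst z') \<otimes>\<^bsub>H\<^esub> fst z) (f (snd z)) = f (snd z')" using zD'(1,2) by simp
  show "division z z' \<in> carrier G" "actX (division z z') (snd z) = snd z'"
    "\<phi> (division z z') = inv\<^bsub>H\<^esub> (fst z') \<otimes>\<^bsub>H\<^esub> fst z"
    using \<delta>[OF zD(2) zD'(2) _ eq] zD(1) zD'(1) unfolding division_def by auto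
qed

text \<open>Both sides take \<open>snd z\<close> to \<open>snd z'\<close> and have the same image
  under \<open>\<phi>\<close>, so \<open>unique\<close> applies. The structure group thus conjugates
  the type \<open>\<rho>\<close> into \<open>\<rho>'\<close>, which allows sections of different
  types to be glued.\<close>

lemma division_conj:
  assumes K: "K \<subseteq> carrier G" and z: "z \<in> fibre K \<rho> q" and z': "z' \<in> fibre K \<rho>' q" and k: "k \<in> K"
  shows "\<rho>' k \<otimes> division z z' = division z z' \<otimes> \<rho> k"
proof (rule unique[where x = "snd z"])
  note zD = fibreD[OF z] and zD' = fibreD[OF z'] and d = division[OF z z']
  have kc: "k \<in> carrier G" using K k by blast
  show "\<rho>' k \<otimes> division z z' \<in> carrier G" "division z z' \<otimes> \<rho> k \<in> carrier G" "snd z \<in> X"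
    using zD(2) zD(4)[OF k] zD'(4)[OF k] d(1) by auto
  show "actX (\<rho>' k \<otimes> division z z') (snd z) = actX (division z z' \<otimes> \<rho> k) (snd z)"
    using GX.act_mult[OF zD'(4)[OF k] d(1) zD(2)] GX.act_mult[OF d(1) zD(4)[OF k] zD(2)]
      d(2) zD(6)[OF k] zD'(6)[OF k] by simp
  have "\<phi> (\<rho>' k) \<otimes>\<^bsub>H\<^esub> (inv\<^bsub>H\<^esub> (fst z') \<otimes>\<^bsub>H\<^esub> fst z) = inv\<^bsub>H\<^esub> (fst z') \<otimes>\<^bsub>H\<^esub> (fst z' \<otimes>\<^bsub>H\<^esub> \<phi> (\<rho>' k)) \<otimes>\<^bsub>H\<^esub> (inv\<^bsub>H\<^esub> (fst z') \<otimes>\<^bsub>H\<^esub> fst z)"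
    using zD(1) zD'(1) zD'(4)[OF k] by (simp add: HY.m_assoc)
  also have "fst z' \<otimes>\<^bsub>H\<^esub> \<phi> (\<rho>' k) = \<phi> k \<otimes>\<^bsub>H\<^esub> fst z'" using zD'(5)[OF k] by simp
  also have "inv\<^bsub>H\<^esub> (fst z') \<otimes>\<^bsub>H\<^esub> (\<phi> k \<otimes>\<^bsub>H\<^esub> fst z') \<otimes>\<^bsub>H\<^esub> (inv\<^bsub>H\<^esub> (fst z') \<otimes>\<^bsub>H\<^esub> fst z) = inv\<^bsub>H\<^esub> (fst z') \<otimes>\<^bsub>H\<^esub> (\<phi> k \<otimes>\<^bsub>H\<^esub> fst z)"
    using zD(1) zD'(1) kc by (simp add: HY.m_assoc)
  also have "\<phi> k \<otimes>\<^bsub>H\<^esub> fst z = fst z \<otimes>\<^bsub>H\<^esub> \<phi> (\<rho> k)" using zD(5)[OF k] .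
  also have "inv\<^bsub>H\<^esub> (fst z') \<otimes>\<^bsub>H\<^esub> (fst z \<otimes>\<^bsub>H\<^esub> \<phi> (\<rho> k)) = inv\<^bsub>H\<^esub> (fst z') \<otimes>\<^bsub>H\<^esub> fst z \<otimes>\<^bsub>H\<^esub> \<phi> (\<rho> k)"
    using zD(1) zD'(1) zD(4)[OF k] by (simp add: HY.m_assoc)
  finally show "\<phi> (\<rho>' k \<otimes> division z z') = \<phi> (division z z' \<otimes> \<rho> k)"
    using d(1,3) zD(4)[OF k] zD'(4)[OF k] by simp
qed

lemma transport_mem:
  assumes K: "K \<subseteq> carrier G" and z: "z \<in> fibre K \<rho> q" and z': "z' \<in> fibre K \<rho>' q" and w: "w \<in> fibre K \<rho> r"
  shows "transport z z' w \<in> fibre K \<rho>' r"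
proof -
  note d = division[OF z z'] and wD = fibreD[OF w] and zD' = fibreD[OF z']
  define g where "g = division z z'"
  have g: "g \<in> carrier G" using d(1) by (simp add: g_def)
  have "actY (fst w \<otimes>\<^bsub>H\<^esub> inv\<^bsub>H\<^esub> \<phi> g) (f (actX g (snd w))) = actY (fst w) (actY (inv\<^bsub>H\<^esub> \<phi> g) (f (actX g (snd w))))"
    using g wD(1,2) by (intro HY.act_mult) auto
  also have "\<dots> = r" using g wD(1-3) by (simp add: f_act)
  finally have 1: "actY (fst w \<otimes>\<^bsub>H\<^esub> inv\<^bsub>H\<^esub> \<phi> g) (f (actX g (snd w))) = r" .
  have 2: "\<phi> k \<otimes>\<^bsub>H\<^esub> (fst w \<otimes>\<^bsub>H\<^esub> inv\<^bsub>H\<^esub> \<phi> g) = fst w \<otimes>\<^bsub>H\<^esub> inv\<^bsub>H\<^esub> \<phi> g \<otimes>\<^bsub>H\<^esub> \<phi> (\<rho>' k) \<and> actX (\<rho>' k) (actX g (snd w)) = actX g (snd w)"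
    if k: "k \<in> K" for k
  proof
    have kc: "k \<in> carrier G" using K k by blast
    note rk = wD(4)[OF k] and rk' = zD'(4)[OF k]
    have c: "\<rho>' k \<otimes> g = g \<otimes> \<rho> k" using division_conj[OF K z z' k] by (simp add: g_def)
    then have c': "\<phi> (\<rho>' k) \<otimes>\<^bsub>H\<^esub> \<phi> g = \<phi> g \<otimes>\<^bsub>H\<^esub> \<phi> (\<rho> k)" using g rk rk' \<phi>.hom_mult by metis
    have "fst w \<otimes>\<^bsub>H\<^esub> inv\<^bsub>H\<^esub> \<phi> g \<otimes>\<^bsub>H\<^esub> \<phi> (\<rho>' k) = fst w \<otimes>\<^bsub>H\<^esub> inv\<^bsub>H\<^esub> \<phi> g \<otimes>\<^bsub>H\<^esub> (\<phi> (\<rho>' k) \<otimes>\<^bsub>H\<^esub> \<phi> g) \<otimes>\<^bsub>H\<^esub> inv\<^bsub>H\<^esub> \<phi> g"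
      using g rk' wD(1) by (simp add: HY.m_assoc)
    also have "\<dots> = (fst w \<otimes>\<^bsub>H\<^esub> \<phi> (\<rho> k)) \<otimes>\<^bsub>H\<^esub> inv\<^bsub>H\<^esub> \<phi> g"
      unfolding c' using g rk wD(1) by (simp add: HY.m_assoc)
    also have "\<dots> = \<phi> k \<otimes>\<^bsub>H\<^esub> (fst w \<otimes>\<^bsub>H\<^esub> inv\<^bsub>H\<^esub> \<phi> g)"
      unfolding wD(5)[OF k, symmetric] using g kc wD(1) by (simp add: HY.m_assoc)
    finally show "\<phi> k \<otimes>\<^bsub>H\<^esub> (fst w \<otimes>\<^bsub>H\<^esub> inv\<^bsub>H\<^esub> \<phi> g) = fst w \<otimes>\<^bsub>H\<^esub> inv\<^bsub>H\<^esub> \<phi> g \<otimes>\<^bsub>H\<^esub> \<phi> (\<rho>' k)" by (rule sym)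
    have "actX (\<rho>' k) (actX g (snd w)) = actX (g \<otimes> \<rho> k) (snd w)"
      using GX.act_mult[OF rk' g wD(2)] c by simp
    then show "actX (\<rho>' k) (actX g (snd w)) = actX g (snd w)"
      using GX.act_mult[OF g rk wD(2)] wD(6)[OF k] by simp
  qed
  show ?thesis
    unfolding fibre_def transport_def using 1 2 g wD(1,2) zD'(4) by (simp add: g_def)
qed

lemma transport_eq:
  assumes z: "z \<in> fibre K \<rho> q" and z': "z' \<in> fibre K \<rho>' q"
  shows "transport z z' z = z'"
  unfolding transport_def division(2,3)[OF z z'] using fibreD(1)[OF z] fibreD(1)[OF z']
  by (simp add: HY.inv_mult_group prod_eq_iff)

lemma continuous_division:
  assumes "continuous_on S a" "continuous_on S b"
    and ab: "\<And>t. t \<in> S \<Longrightarrow> \<exists>\<rho> \<rho>' q. a t \<in> fibre K \<rho> q \<and> b t \<in> fibre K \<rho>' q"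
  shows "continuous_on S (\<lambda>t. division (a t) (b t))"
proof -
  have c: "continuous_on S (\<lambda>t. fst (a t))" "continuous_on S (\<lambda>t. snd (a t))"
    "continuous_on S (\<lambda>t. fst (b t))" "continuous_on S (\<lambda>t. snd (b t))"
    using assms(1,2) by (auto intro: continuous_on_fst continuous_on_snd)
  have mem: "(\<lambda>t. fst (a t)) ` S \<subseteq> carrier H" "(\<lambda>t. fst (b t)) ` S \<subseteq> carrier H"
    using ab fibreD(1) by blast+
  have "continuous_on S (\<lambda>t. (snd (a t), snd (b t), inv\<^bsub>H\<^esub> (fst (b t)) \<otimes>\<^bsub>H\<^esub> fst (a t)))"
    using mem by (intro continuous_on_Pair c HY.continuous_mult HY.continuous_inv) auto
  moreover have "(\<lambda>t. (snd (a t), snd (b t), inv\<^bsub>H\<^esub> (fst (b t)) \<otimes>\<^bsub>H\<^esub> fst (a t))) ` S \<subseteq>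
     {(x, x', h). x \<in> X \<and> x' \<in> X \<and> h \<in> carrier H \<and> actY h (f x) = f x'}"
  proof (rule image_subsetI)
    fix t assume "t \<in> S"
    then obtain \<rho> \<rho>' q where "a t \<in> fibre K \<rho> q" "b t \<in> fibre K \<rho>' q" using ab by blast
    then show "(snd (a t), snd (b t), inv\<^bsub>H\<^esub> (fst (b t)) \<otimes>\<^bsub>H\<^esub> fst (a t)) \<in>
      {(x, x', h). x \<in> X \<and> x' \<in> X \<and> h \<in> carrier H \<and> actY h (f x) = f x'}"
      using fibreD(1,2)[of "a t"] fibreD(1,2)[of "b t"] division(4)[of "a t" K \<rho> q "b t" \<rho>'] by auto
  qed
  ultimately have "continuous_on S ((\<lambda>(x, x', h). \<delta> x x' h) \<circ> (\<lambda>t. (snd (a t), snd (b t), inv\<^bsub>H\<^esub> (fst (b t)) \<otimes>\<^bsub>H\<^esub> fst (a t))))"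
    by (intro continuous_on_compose continuous_on_subset[OF cont_\<delta>])
  then show ?thesis by (simp add: o_def division_def)
qed

lemma continuous_transport:
  assumes a: "continuous_on S a" and b: "continuous_on S b" and c: "continuous_on S c"
    and ab: "\<And>t. t \<in> S \<Longrightarrow> \<exists>\<rho> \<rho>' q r. a t \<in> fibre K \<rho> q \<and> b t \<in> fibre K \<rho>' q \<and> c t \<in> fibre K \<rho> r"
  shows "continuous_on S (\<lambda>t. transport (a t) (b t) (c t))"
proof -
  have d: "continuous_on S (\<lambda>t. division (a t) (b t))" using ab by (intro continuous_division[OF a b, of K]) blast
  have d': "(\<lambda>t. division (a t) (b t)) ` S \<subseteq> carrier G" using ab division(1) by blast
  have c': "(\<lambda>t. fst (c t)) ` S \<subseteq> carrier H" "(\<lambda>t. snd (c t)) ` S \<subseteq> X" using ab fibreD(1,2) by blast+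
  have "continuous_on S (\<lambda>t. \<phi> (division (a t) (b t)))" by (rule continuous_on_compose2[OF cont_\<phi> d d'])
  then show ?thesis unfolding transport_def
    using c' d' by (intro continuous_on_Pair HY.continuous_mult HY.continuous_inv GX.continuous_act d
        continuous_on_fst[OF c] continuous_on_snd[OF c]) auto
qed

text \<open>For any \<open>(h0, x0)\<close> over \<open>y\<close>, the conjugate of
  \<open>\<phi> k\<close> by \<open>h0\<close> fixes \<open>f x0\<close>, so it comes from a unique
  element \<open>\<rho> k\<close> of the isotropy group of \<open>x0\<close>; uniqueness makes
  \<open>\<rho>\<close> a homomorphism. The section through \<open>(h0, x0)\<close> has this type,
  which depends on the choice of \<open>(h0, x0)\<close>.\<close>

lemma fibre_local_section:
  assumes K: "subgroup K G" "finite K" and y: "y \<in> HY.Fix (\<phi> ` K)"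
  shows "\<exists>V \<rho> s. openin (top_of_set Y) V \<and> y \<in> V \<and> continuous_on V s \<and>
    (\<forall>q\<in>V \<inter> HY.Fix (\<phi> ` K). s q \<in> fibre K \<rho> q)"
proof -
  have Kc: "k \<in> carrier G" if "k \<in> K" for k using subgroup.mem_carrier[OF K(1) that] .
  obtain h0 x0 where h0: "h0 \<in> carrier H" "x0 \<in> X" "actY h0 (f x0) = y"
    using surj HY.FixD(1)[OF y] by blast
  define \<rho> where "\<rho> k = \<delta> x0 x0 (inv\<^bsub>H\<^esub> h0 \<otimes>\<^bsub>H\<^esub> \<phi> k \<otimes>\<^bsub>H\<^esub> h0)" for k
  have \<rho>: "\<rho> k \<in> carrier G" "actX (\<rho> k) x0 = x0" "\<phi> (\<rho> k) = inv\<^bsub>H\<^esub> h0 \<otimes>\<^bsub>H\<^esub> \<phi> k \<otimes>\<^bsub>H\<^esub> h0" if k: "k \<in> K" for k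
  proof -
    have "actY (inv\<^bsub>H\<^esub> h0 \<otimes>\<^bsub>H\<^esub> \<phi> k \<otimes>\<^bsub>H\<^esub> h0) (f x0) = actY (inv\<^bsub>H\<^esub> h0) (actY (\<phi> k) (actY h0 (f x0)))"
      using h0 Kc[OF k] HY.FixD(1)[OF y] by (simp add: HY.act_mult)
    also have "actY (\<phi> k) (actY h0 (f x0)) = actY h0 (f x0)" using HY.FixD(2)[OF y, of "\<phi> k"] k h0(3) by simp
    also have "actY (inv\<^bsub>H\<^esub> h0) (actY h0 (f x0)) = f x0" using h0(1,2) by simp
    finally show "\<rho> k \<in> carrier G" "actX (\<rho> k) x0 = x0" "\<phi> (\<rho> k) = inv\<^bsub>H\<^esub> h0 \<otimes>\<^bsub>H\<^esub> \<phi> k \<otimes>\<^bsub>H\<^esub> h0"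
      using \<delta>[of x0 x0 "inv\<^bsub>H\<^esub> h0 \<otimes>\<^bsub>H\<^esub> \<phi> k \<otimes>\<^bsub>H\<^esub> h0"] h0 Kc[OF k] unfolding \<rho>_def by auto
  qed
  have "\<rho> \<in> hom (G\<lparr>carrier := K\<rparr>) G"
  proof (rule homI)
    show "\<rho> k \<in> carrier G" if "k \<in> carrier (G\<lparr>carrier := K\<rparr>)" for k using \<rho>(1) that by simp
    fix k l assume "k \<in> carrier (G\<lparr>carrier := K\<rparr>)" "l \<in> carrier (G\<lparr>carrier := K\<rparr>)"
    then have kl: "k \<in> K" "l \<in> K" "k \<otimes> l \<in> K" using subgroup.m_closed[OF K(1)] by auto
    have "\<rho> (k \<otimes> l) = \<rho> k \<otimes> \<rho> l"
    proof (rule unique[where x = x0])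
      show "actX (\<rho> (k \<otimes> l)) x0 = actX (\<rho> k \<otimes> \<rho> l) x0"
        using \<rho>(1,2)[OF kl(1)] \<rho>(1,2)[OF kl(2)] \<rho>(2)[OF kl(3)] h0(2) by (simp add: GX.act_mult)
      show "\<phi> (\<rho> (k \<otimes> l)) = \<phi> (\<rho> k \<otimes> \<rho> l)"
        using \<rho>(1,3)[OF kl(1)] \<rho>(1,3)[OF kl(2)] \<rho>(3)[OF kl(3)] h0(1) Kc[OF kl(1)] Kc[OF kl(2)]
        by (simp add: HY.m_assoc)
    qed (use \<rho>(1) kl h0(2) in auto)
    then show "\<rho> (k \<otimes>\<^bsub>G\<lparr>carrier := K\<rparr>\<^esub> l) = \<rho> k \<otimes> \<rho> l" by simp
  qed
  moreover have "\<phi> k \<otimes>\<^bsub>H\<^esub> h0 = h0 \<otimes>\<^bsub>H\<^esub> \<phi> (\<rho> k)" if "k \<in> K" for k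
    using \<rho>(3)[OF that] h0(1) Kc[OF that] by (simp add: HY.m_assoc)
  ultimately obtain V s where V: "openin (top_of_set Y) V" "actY h0 (f x0) \<in> V" "continuous_on V s"
    and s: "\<forall>q\<in>V. fst (s q) \<in> carrier H \<and> snd (s q) \<in> X \<and> actY (fst (s q)) (f (snd (s q))) = q \<and>
           ((\<forall>k\<in>K. actY (\<phi> k) q = q) \<longrightarrow>
            (\<forall>k\<in>K. \<phi> k \<otimes>\<^bsub>H\<^esub> fst (s q) = fst (s q) \<otimes>\<^bsub>H\<^esub> \<phi> (\<rho> k) \<and> actX (\<rho> k) (snd (s q)) = snd (s q)))"
    using local_section[OF K, of \<rho> h0 x0] h0(1,2) \<rho>(2) by blast
  have "s q \<in> fibre K \<rho> q" if q: "q \<in> V" "q \<in> HY.Fix (\<phi> ` K)" for q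
  proof -
    have "\<forall>k\<in>K. actY (\<phi> k) q = q" using HY.FixD(2)[OF q(2)] by blast
    then show ?thesis using s q(1) \<rho>(1) unfolding fibre_def case_prod_unfold mem_Collect_eq by blast
  qed
  then show ?thesis using V h0(3) by blast
qed

lemma square_lift:
  fixes \<Gamma> :: "real \<times> real \<Rightarrow> 'y"
  defines "Q \<equiv> {0..1} \<times> {0..1}"
  assumes K: "subgroup K G" and x: "x \<in> GX.Fix K"
    and \<Gamma>: "continuous_on Q \<Gamma>" "\<And>v. v \<in> Q \<Longrightarrow> \<Gamma> v \<in> HY.Fix (\<phi> ` K)" "\<Gamma> (0, 0) = f x"
  shows "\<exists>\<Lambda>. continuous_on Q \<Lambda> \<and> (\<forall>v\<in>Q. \<Lambda> v \<in> fibre K (\<lambda>k. k) (\<Gamma> v)) \<and> \<Lambda> (0, 0) = (\<one>\<^bsub>H\<^esub>, x)"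
proof -
  have fin: "finite K" using GX.subgroup_finite[OF K x] .
  have Kc: "K \<subseteq> carrier G" using subgroup.subset[OF K] .
  have "\<exists>\<rho> s. continuous_on Q s \<and> (\<forall>v\<in>Q. s v \<in> fibre K \<rho> (\<Gamma> v))"
  proof (rule section_on_square[where T = transport and F = "\<lambda>\<rho> v. fibre K \<rho> (\<Gamma> v)", folded Q_def])
    fix v assume v: "v \<in> Q"
    obtain V \<rho> s where V: "openin (top_of_set Y) V" "\<Gamma> v \<in> V" "continuous_on V s"
      "\<forall>q\<in>V \<inter> HY.Fix (\<phi> ` K). s q \<in> fibre K \<rho> q"
      using fibre_local_section[OF K fin \<Gamma>(2)[OF v]] by blast
    have "openin (top_of_set Q) (Q \<inter> \<Gamma> -` V)"
      using \<Gamma>(1) HY.FixD(1)[OF \<Gamma>(2)] by (intro continuous_openin_preimage[OF _ _ V(1)]) auto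
    then obtain N where N: "open N" "Q \<inter> \<Gamma> -` V = Q \<inter> N" by (auto simp: openin_open)
    have NV: "\<Gamma> w \<in> V" if "w \<in> N \<inter> Q" for w using N(2) that by blast
    have "continuous_on (N \<inter> Q) (\<lambda>w. s (\<Gamma> w))"
      by (rule continuous_on_compose2[OF V(3) continuous_on_subset[OF \<Gamma>(1)]]) (use NV in auto)
    moreover have "s (\<Gamma> w) \<in> fibre K \<rho> (\<Gamma> w)" if "w \<in> N \<inter> Q" for w
      using V(4) NV[OF that] \<Gamma>(2)[of w] that by blast
    moreover have "v \<in> N" using v V(2) N(2) by blast
    ultimately show "\<exists>N \<rho> s. open N \<and> v \<in> N \<and> continuous_on (N \<inter> Q) s \<and> (\<forall>w\<in>N \<inter> Q. s w \<in> fibre K \<rho> (\<Gamma> w))"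
      using N(1) by blast
  next
    show "continuous_on {(z, z', w). \<exists>\<rho> \<rho>' u v. u \<in> Q \<and> v \<in> Q \<and> z \<in> fibre K \<rho> (\<Gamma> u) \<and> z' \<in> fibre K \<rho>' (\<Gamma> u) \<and>
        w \<in> fibre K \<rho> (\<Gamma> v)} (\<lambda>(z, z', w). transport z z' w)"
      unfolding case_prod_unfold
      by (rule continuous_transport[where K = K]) (intro continuous_on_fst continuous_on_snd continuous_on_id | blast)+
  qed (use transport_mem[OF Kc] transport_eq in blast)+
  then obtain \<rho> s where s: "continuous_on Q s" "\<And>v. v \<in> Q \<Longrightarrow> s v \<in> fibre K \<rho> (\<Gamma> v)" by blast
  have x0: "(\<one>\<^bsub>H\<^esub>, x) \<in> fibre K (\<lambda>k. k) (\<Gamma> (0, 0))"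
    using x \<Gamma>(3) Kc GX.FixD[OF x] by (auto simp: fibre_def)
  have Q0: "(0, 0) \<in> Q" by (simp add: Q_def)
  define \<Lambda> where "\<Lambda> v = transport (s (0, 0)) (\<one>\<^bsub>H\<^esub>, x) (s v)" for v
  show ?thesis
  proof (intro exI conjI ballI)
    show "continuous_on Q \<Lambda>" unfolding \<Lambda>_def
      using s(2)[OF Q0] x0 s(2) by (intro continuous_transport[where K = K] continuous_intros s(1)) blast
    show "\<Lambda> v \<in> fibre K (\<lambda>k. k) (\<Gamma> v)" if "v \<in> Q" for v
      unfolding \<Lambda>_def by (rule transport_mem[OF Kc s(2)[OF Q0] x0 s(2)[OF that]])
    show "\<Lambda> (0, 0) = (\<one>\<^bsub>H\<^esub>, x)" unfolding \<Lambda>_def by (rule transport_eq[OF s(2)[OF Q0] x0])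
  qed
qed

lemma fibre_idD:
  assumes "z \<in> fibre K (\<lambda>k. k) q"
  shows "snd z \<in> GX.Fix K" "fst z \<in> HY.centr (\<phi> ` K)"
  using fibreD[OF assms] unfolding fixed_points_def HY.centr_def by auto

text \<open>When both types are the inclusion, \<open>division_conj\<close> is commutation with
  \<open>K\<close>. Two lifts into \<open>X^K\<close> of the same path thus differ by the
  centralizer.\<close>

lemma division_centr:
  assumes "K \<subseteq> carrier G" "z \<in> fibre K (\<lambda>k. k) q" "z' \<in> fibre K (\<lambda>k. k) q"
  shows "division z z' \<in> GX.centr K"
  using division_conj[OF assms] division(1)[OF assms(2,3)] by (simp add: GX.centr_def)

section \<open>The induced functor\<close>

lemma image_lcoset: "g \<in> carrier G \<Longrightarrow> L \<subseteq> carrier G \<Longrightarrow> \<phi> ` (g <# L) = \<phi> g <#\<^bsub>H\<^esub> (\<phi> ` L)"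
  unfolding l_coset_def by (auto simp: subset_iff image_iff)

lemma Pi_d_obj_eq: "Pi_d_obj \<phi> f a = (\<phi> ` fst a, f (snd a))"
  by (simp add: Pi_d_obj_def case_prod_unfold)

lemma Pi_d_obj_closed:
  assumes "a \<in> Pi_obj G X actX"
  shows "Pi_d_obj \<phi> f a \<in> Pi_obj H Y actY"
  unfolding Pi_d_obj_eq using GX.Pi_objD[OF assms]
  by (intro HY.Pi_objI image_subgroup f_Fix)

lemma map_path:
  assumes "K \<subseteq> carrier G" "path p" "path_image p \<subseteq> GX.Fix K"
  shows "path (f \<circ> p)" "path_image (f \<circ> p) \<subseteq> HY.Fix (\<phi> ` K)"
proof -
  show "path (f \<circ> p)"
    using assms(2,3) GX.FixD(1)[of _ K]
    by (intro path_continuous_image continuous_on_subset[OF cont_f]) auto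
  show "path_image (f \<circ> p) \<subseteq> HY.Fix (\<phi> ` K)"
    using assms(3) f_Fix[OF _ assms(1)] by (auto simp: path_image_def)
qed

lemma map_homotopic:
  assumes "K \<subseteq> carrier G" "homotopic_paths (GX.Fix K) p q"
  shows "homotopic_paths (HY.Fix (\<phi> ` K)) (f \<circ> p) (f \<circ> q)"
  using assms(2)
proof (rule homotopic_paths_continuous_image)
  show "continuous_on (GX.Fix K) f" using GX.FixD(1) by (intro continuous_on_subset[OF cont_f]) blast
  show "f \<in> GX.Fix K \<rightarrow> HY.Fix (\<phi> ` K)" using f_Fix[OF _ assms(1)] by blast
qed

lemma map_arrow:
  assumes a: "a \<in> Pi_obj G X actX" and b: "b \<in> Pi_obj G X actX" and g: "GX.arrow a b g p"
  shows "HY.arrow (Pi_d_obj \<phi> f a) (Pi_d_obj \<phi> f b) (\<phi> g) (f \<circ> p)"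
proof -
  note A = GX.Pi_objD[OF a] and B = GX.Pi_objD[OF b]
  have gG: "g \<in> carrier G" and gK: "\<And>k. k \<in> fst a \<Longrightarrow> inv g \<otimes> k \<otimes> g \<in> fst b"
    and p: "path p" "path_image p \<subseteq> GX.Fix (fst a)" "pathstart p = snd a" "pathfinish p = actX g (snd b)"
    using g by (auto simp: GX.arrow_def)
  have "inv\<^bsub>H\<^esub> \<phi> g \<otimes>\<^bsub>H\<^esub> \<phi> k \<otimes>\<^bsub>H\<^esub> \<phi> g \<in> \<phi> ` fst b" if k: "k \<in> fst a" for k
  proof -
    have "k \<in> carrier G" using k A(4) by blast
    then have "inv\<^bsub>H\<^esub> \<phi> g \<otimes>\<^bsub>H\<^esub> \<phi> k \<otimes>\<^bsub>H\<^esub> \<phi> g = \<phi> (inv g \<otimes> k \<otimes> g)" using gG by simp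
    then show ?thesis using gK[OF k] by simp
  qed
  then show ?thesis
    unfolding HY.arrow_def Pi_d_obj_eq
    using map_path[OF A(4) p(1,2)] gG p(3,4) B(5) by (auto simp: pathstart_compose pathfinish_compose f_act)
qed

lemma map_centr_path:
  assumes c: "GX.centr_path K c" and K: "K \<subseteq> carrier G"
  shows "HY.centr_path (\<phi> ` K) (\<phi> \<circ> c)"
proof -
  have c': "path c" "path_image c \<subseteq> carrier G" "pathstart c = \<one>" "path_image c \<subseteq> GX.centr K"
    using c GX.centrD(1) by (auto simp: GX.centr_path_def)
  have "\<phi> d \<in> HY.centr (\<phi> ` K)" if "d \<in> GX.centr K" for d
  proof -
    have "\<phi> d \<otimes>\<^bsub>H\<^esub> \<phi> k = \<phi> k \<otimes>\<^bsub>H\<^esub> \<phi> d" if k: "k \<in> K" for k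
      using GX.centrD[OF \<open>d \<in> GX.centr K\<close>] k K \<phi>.hom_mult by (metis subset_iff)
    then show ?thesis using GX.centrD(1)[OF that] by (auto simp: HY.centr_def)
  qed
  then show ?thesis
    using c' path_continuous_image[OF c'(1) continuous_on_subset[OF cont_\<phi> c'(2)]]
    unfolding HY.centr_path_def by (auto simp: path_image_compose pathstart_compose)
qed

lemma map_arrow_rel:
  assumes a: "a \<in> Pi_obj G X actX" and b: "b \<in> Pi_obj G X actX"
    and g: "GX.arrow a b g p" and g': "GX.arrow a b g' p'" and r: "GX.arrow_rel a b g p g' p'"
  shows "HY.arrow_rel (Pi_d_obj \<phi> f a) (Pi_d_obj \<phi> f b) (\<phi> g) (f \<circ> p) (\<phi> g') (f \<circ> p')"
proof -
  note A = GX.Pi_objD[OF a] and B = GX.Pi_objD[OF b]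
  obtain c where c: "GX.centr_path (fst a) c" "(pathfinish c \<otimes> g) <# fst b = g' <# fst b"
    "homotopic_paths (GX.Fix (fst a)) (\<lambda>t. actX (c t) (p t)) p'" using r unfolding GX.arrow_rel_def by blast
  have gG: "g \<in> carrier G" "g' \<in> carrier G" and p: "path p" "path_image p \<subseteq> GX.Fix (fst a)"
    using g g' by (auto simp: GX.arrow_def)
  have c1: "pathfinish c \<in> carrier G" using GX.centr_pathD(2)[OF c(1), of 1] by (simp add: pathfinish_def)
  note mc = map_centr_path[OF c(1) A(4)]
  have K': "\<phi> ` fst a \<subseteq> carrier H" using A(4) by auto
  have "homotopic_paths (HY.Fix (\<phi> ` fst a)) (\<lambda>t. actY ((\<phi> \<circ> c) t) ((f \<circ> p) t)) (f \<circ> (\<lambda>t. actX (c t) (p t)))"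
  proof (rule homotopic_paths_eq)
    show "path (\<lambda>t. actY ((\<phi> \<circ> c) t) ((f \<circ> p) t))" "path_image (\<lambda>t. actY ((\<phi> \<circ> c) t) ((f \<circ> p) t)) \<subseteq> HY.Fix (\<phi> ` fst a)"
      using HY.path_act_centr[OF K' _ _ map_path[OF A(4) p], of "\<phi> \<circ> c"] mc
      by (auto simp: HY.centr_path_def)
    show "actY ((\<phi> \<circ> c) t) ((f \<circ> p) t) = (f \<circ> (\<lambda>t. actX (c t) (p t))) t" if "t \<in> {0..1}" for t
      using f_act[OF GX.centr_pathD(2)[OF c(1) that] GX.Fix_pathD(2)[OF p(2) that]] by simp
  qed
  then have "homotopic_paths (HY.Fix (\<phi> ` fst a)) (\<lambda>t. actY ((\<phi> \<circ> c) t) ((f \<circ> p) t)) (f \<circ> p')"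
    using map_homotopic[OF A(4) c(3)] by (rule homotopic_paths_trans)
  moreover have "(pathfinish (\<phi> \<circ> c) \<otimes>\<^bsub>H\<^esub> \<phi> g) <#\<^bsub>H\<^esub> (\<phi> ` fst b) = \<phi> g' <#\<^bsub>H\<^esub> (\<phi> ` fst b)"
    using image_lcoset[of "pathfinish c \<otimes> g" "fst b"] image_lcoset[of g' "fst b"] c(2) c1 gG B(4)
    by (simp add: pathfinish_compose)
  ultimately show ?thesis using mc unfolding HY.arrow_rel_def Pi_d_obj_eq by auto
qed

text \<open>The functor too is a union over representatives; \<open>map_arrow_rel\<close> makes all
  sets in it equal to the class on the right.\<close>

lemma Pi_d_arr_cls:
  assumes a: "a \<in> Pi_obj G X actX" and b: "b \<in> Pi_obj G X actX" and g: "GX.arrow a b g p"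
  shows "Pi_d_arr H Y actY \<phi> f a b (GX.cls a b g p) =
    HY.cls (Pi_d_obj \<phi> f a) (Pi_d_obj \<phi> f b) (\<phi> g) (f \<circ> p)"
proof -
  note A = GX.Pi_objD[OF a] and B = GX.Pi_objD[OF b]
  note a' = Pi_d_obj_closed[OF a] and b' = Pi_d_obj_closed[OF b]
  have "Pi_rel H Y actY (Pi_d_obj \<phi> f a) (Pi_d_obj \<phi> f b) ``
        {(\<phi> ` fst u, \<Union>p\<in>snd u. path_class (HY.Fix (\<phi> ` fst a)) (f \<circ> p))} =
      HY.cls (Pi_d_obj \<phi> f a) (Pi_d_obj \<phi> f b) (\<phi> g) (f \<circ> p)"
    if u: "u \<in> GX.cls a b g p" for u
  proof -
    obtain g' p' where g': "GX.arrow a b g' p'" "u = GX.arr a b g' p'" "GX.arrow_rel a b g p g' p'"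
      using u GX.mem_cls_iff[OF a b g] by blast
    have gG: "g' \<in> carrier G" and p': "path p'" "path_image p' \<subseteq> GX.Fix (fst a)"
      using g'(1) by (auto simp: GX.arrow_def)
    have "path_class (HY.Fix (\<phi> ` fst a)) (f \<circ> q) = path_class (HY.Fix (\<phi> ` fst a)) (f \<circ> p')"
      if "q \<in> path_class (GX.Fix (fst a)) p'" for q
      using map_homotopic[OF A(4), of p' q] that path_class_eq[of _ "f \<circ> p'" "f \<circ> q"] by (simp add: path_class_def[of "GX.Fix (fst a)"])
    moreover have "p' \<in> path_class (GX.Fix (fst a)) p'" using p' by (simp add: path_class_def)
    ultimately have "(\<Union>q\<in>path_class (GX.Fix (fst a)) p'. path_class (HY.Fix (\<phi> ` fst a)) (f \<circ> q)) =
        path_class (HY.Fix (\<phi> ` fst a)) (f \<circ> p')" by blast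
    then have "(\<phi> ` fst u, \<Union>p\<in>snd u. path_class (HY.Fix (\<phi> ` fst a)) (f \<circ> p)) =
        HY.arr (Pi_d_obj \<phi> f a) (Pi_d_obj \<phi> f b) (\<phi> g') (f \<circ> p')"
      using image_lcoset[OF gG B(4)] by (simp add: g'(2) GX.arr_def HY.arr_def Pi_d_obj_eq)
    moreover have "HY.cls (Pi_d_obj \<phi> f a) (Pi_d_obj \<phi> f b) (\<phi> g) (f \<circ> p) =
        HY.cls (Pi_d_obj \<phi> f a) (Pi_d_obj \<phi> f b) (\<phi> g') (f \<circ> p')"
      using HY.cls_eq_iff[OF a' b' map_arrow[OF a b g] map_arrow[OF a b g'(1)]] map_arrow_rel[OF a b g g'(1,3)] by simp
    ultimately show ?thesis by (simp add: HY.cls_def)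
  qed
  moreover note GX.arr_mem_cls[OF a b g]
  ultimately have "(\<Union>u\<in>GX.cls a b g p. Pi_rel H Y actY (Pi_d_obj \<phi> f a) (Pi_d_obj \<phi> f b) ``
        {(\<phi> ` fst u, \<Union>p\<in>snd u. path_class (HY.Fix (\<phi> ` fst a)) (f \<circ> p))}) =
      HY.cls (Pi_d_obj \<phi> f a) (Pi_d_obj \<phi> f b) (\<phi> g) (f \<circ> p)" by blast
  then show ?thesis unfolding Pi_d_arr_def case_prod_unfold .
qed

lemma Obj_Pi_d [simp]: "Obj (Pi_d G' X' act') = Pi_obj G' X' act'"
  by (simp add: Pi_d_def)

lemma is_functor_Pi_d_arr:
  "is_functor (Pi_d G X actX) (Pi_d H Y actY) (Pi_d_obj \<phi> f) (Pi_d_arr H Y actY \<phi> f)"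
  unfolding is_functor_def Obj_Pi_d
proof (intro conjI ballI GX.is_category_Pi_d HY.is_category_Pi_d)
  fix a assume a: "a \<in> Pi_obj G X actX"
  note a' = Pi_d_obj_closed[OF a]
  show "Pi_d_obj \<phi> f a \<in> Pi_obj H Y actY" by (rule a')
  show "Pi_d_arr H Y actY \<phi> f a a (Ident (Pi_d G X actX) a) = Ident (Pi_d H Y actY) (Pi_d_obj \<phi> f a)"
    unfolding GX.Ident_cls[OF a] HY.Ident_cls[OF a'] Pi_d_arr_cls[OF a a GX.arrow_one[OF a]]
    by (simp add: Pi_d_obj_eq o_def)
  fix b assume b: "b \<in> Pi_obj G X actX"
  note b' = Pi_d_obj_closed[OF b]
  {
    fix u assume "u \<in> Hom (Pi_d G X actX) a b"
    then obtain g p where g: "GX.arrow a b g p" "u = GX.cls a b g p" using GX.Hom_iff[OF a b] by blast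
    show "Pi_d_arr H Y actY \<phi> f a b u \<in> Hom (Pi_d H Y actY) (Pi_d_obj \<phi> f a) (Pi_d_obj \<phi> f b)"
      unfolding HY.Hom_iff[OF a' b'] g(2) Pi_d_arr_cls[OF a b g(1)] using map_arrow[OF a b g(1)] by blast
  }
  fix c assume c: "c \<in> Pi_obj G X actX"
  note c' = Pi_d_obj_closed[OF c]
  fix u assume "u \<in> Hom (Pi_d G X actX) a b"
  then obtain g p where g: "GX.arrow a b g p" "u = GX.cls a b g p" using GX.Hom_iff[OF a b] by blast
  fix v assume "v \<in> Hom (Pi_d G X actX) b c"
  then obtain h q where h: "GX.arrow b c h q" "v = GX.cls b c h q" using GX.Hom_iff[OF b c] by blast
  note gh = GX.arrow_comp[OF a b c g(1) h(1)]
  note A = GX.Pi_objD[OF a]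
  have G: "g \<in> carrier G" "h \<in> carrier G" and q: "path_image q \<subseteq> GX.Fix (fst b)"
    using g(1) h(1) by (auto simp: GX.arrow_def)
  note mgh = map_arrow[OF a c gh] and mm = HY.arrow_comp[OF a' b' c' map_arrow[OF a b g(1)] map_arrow[OF b c h(1)]]
  have "HY.path_comp (\<phi> g) (f \<circ> p) (f \<circ> q) t = (f \<circ> GX.path_comp g p q) t" if t: "t \<in> {0..1}" for t
  proof (cases "t \<le> 1/2")
    case False
    then have "q (2 * t - 1) \<in> X" using GX.Fix_pathD(2)[OF q, of "2 * t - 1"] t by auto
    then show ?thesis using False f_act[OF G(1)] by (simp add: GX.path_comp_def HY.path_comp_def joinpaths_def)
  qed (simp add: GX.path_comp_def HY.path_comp_def joinpaths_def)
  then have "homotopic_paths (HY.Fix (\<phi> ` fst a)) (HY.path_comp (\<phi> g) (f \<circ> p) (f \<circ> q)) (f \<circ> GX.path_comp g p q)"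
    using mm by (intro homotopic_paths_eq) (auto simp: HY.arrow_def Pi_d_obj_eq)
  then have "HY.arrow_rel (Pi_d_obj \<phi> f a) (Pi_d_obj \<phi> f c) (\<phi> g \<otimes>\<^bsub>H\<^esub> \<phi> h) (HY.path_comp (\<phi> g) (f \<circ> p) (f \<circ> q))
      (\<phi> (g \<otimes> h)) (f \<circ> GX.path_comp g p q)"
    using G by (intro HY.arrow_rel_of_homotopic[OF a' mm]) (simp_all add: Pi_d_obj_eq)
  then show "Pi_d_arr H Y actY \<phi> f a c (Comp (Pi_d G X actX) a b c u v) =
      Comp (Pi_d H Y actY) (Pi_d_obj \<phi> f a) (Pi_d_obj \<phi> f b) (Pi_d_obj \<phi> f c)
        (Pi_d_arr H Y actY \<phi> f a b u) (Pi_d_arr H Y actY \<phi> f b c v)"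
    unfolding g(2) h(2) GX.Comp_cls[OF a b c g(1) h(1)] Pi_d_arr_cls[OF a b g(1)] Pi_d_arr_cls[OF b c h(1)]
      Pi_d_arr_cls[OF a c gh] HY.Comp_cls[OF a' b' c' map_arrow[OF a b g(1)] map_arrow[OF b c h(1)]]
    using HY.cls_eq_iff[OF a' c' mm mgh] by simp
qed

section \<open>Fullness, faithfulness and essential surjectivity\<close>

lemma full:
  assumes a: "a \<in> Pi_obj G X actX" and b: "b \<in> Pi_obj G X actX"
    and w: "w \<in> Hom (Pi_d H Y actY) (Pi_d_obj \<phi> f a) (Pi_d_obj \<phi> f b)"
  shows "\<exists>u\<in>Hom (Pi_d G X actX) a b. Pi_d_arr H Y actY \<phi> f a b u = w"
proof -
  note A = GX.Pi_objD[OF a] and B = GX.Pi_objD[OF b]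
  note a' = Pi_d_obj_closed[OF a] and b' = Pi_d_obj_closed[OF b]
  obtain \<beta> \<gamma> where \<beta>: "HY.arrow (Pi_d_obj \<phi> f a) (Pi_d_obj \<phi> f b) \<beta> \<gamma>"
    "w = HY.cls (Pi_d_obj \<phi> f a) (Pi_d_obj \<phi> f b) \<beta> \<gamma>"
    using w HY.Hom_iff[OF a' b'] by blast
  have \<beta>H: "\<beta> \<in> carrier H" and \<beta>K: "\<And>k. k \<in> fst a \<Longrightarrow> inv\<^bsub>H\<^esub> \<beta> \<otimes>\<^bsub>H\<^esub> \<phi> k \<otimes>\<^bsub>H\<^esub> \<beta> \<in> \<phi> ` fst b"
    and \<gamma>: "path \<gamma>" "path_image \<gamma> \<subseteq> HY.Fix (\<phi> ` fst a)" "pathstart \<gamma> = f (snd a)" "pathfinish \<gamma> = actY \<beta> (f (snd b))"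
    using \<beta>(1) unfolding HY.arrow_def Pi_d_obj_eq by auto
  \<comment> \<open>The path as a square that is constant in the first coordinate.\<close>
  have cont\<gamma>: "continuous_on ({0..1 :: real} \<times> {0..1}) (\<lambda>v. \<gamma> (snd v))"
    using \<gamma>(1) unfolding path_def
    by (rule continuous_on_compose2) (auto intro!: continuous_intros)
  have "\<exists>\<Lambda>. continuous_on ({0..1 :: real} \<times> {0..1}) \<Lambda> \<and>
    (\<forall>v\<in>{0..1} \<times> {0..1}. \<Lambda> v \<in> fibre (fst a) (\<lambda>k. k) (\<gamma> (snd v))) \<and> \<Lambda> (0, 0) = (\<one>\<^bsub>H\<^esub>, snd a)"
  proof (rule square_lift[OF A(1,2) cont\<gamma>])
    show "\<gamma> (snd v) \<in> HY.Fix (\<phi> ` fst a)" if "v \<in> {0..1} \<times> {0..1}" for v :: "real \<times> real"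
      using HY.Fix_pathD(1)[OF \<gamma>(2), of "snd v"] that by auto
    show "\<gamma> (snd (0 :: real, 0)) = f (snd a)" using \<gamma>(3) by (simp add: pathstart_def)
  qed
  then obtain \<Lambda> where \<Lambda>: "continuous_on ({0..1 :: real} \<times> {0..1}) \<Lambda>"
    "\<And>v. v \<in> {0..1} \<times> {0..1} \<Longrightarrow> \<Lambda> v \<in> fibre (fst a) (\<lambda>k. k) (\<gamma> (snd v))" "\<Lambda> (0, 0) = (\<one>\<^bsub>H\<^esub>, snd a)"
    by blast
  define h where "h t = fst (\<Lambda> (0, t))" for t
  define p where "p t = snd (\<Lambda> (0, t))" for t
  have \<Lambda>t: "\<Lambda> (0, t) \<in> fibre (fst a) (\<lambda>k. k) (\<gamma> t)" if "t \<in> {0..1}" for t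
    using \<Lambda>(2)[of "(0, t)"] that by simp
  have cont: "continuous_on {0..1} (\<lambda>t. \<Lambda> (0, t))"
    by (rule continuous_on_compose2[OF \<Lambda>(1)]) (auto intro!: continuous_intros)
  have ht: "h t \<in> HY.centr (\<phi> ` fst a)" "h t \<in> carrier H" "p t \<in> GX.Fix (fst a)" "p t \<in> X" "actY (h t) (f (p t)) = \<gamma> t"
    if "t \<in> {0..1}" for t
    using fibre_idD[OF \<Lambda>t[OF that]] fibreD(1-3)[OF \<Lambda>t[OF that]] by (auto simp: h_def p_def)
  have h: "HY.centr_path (\<phi> ` fst a) h"
    unfolding HY.centr_path_def path_def path_image_def pathstart_def
    using ht(1) \<Lambda>(3) continuous_on_fst[OF cont] by (auto simp: h_def)
  have p: "path p" "path_image p \<subseteq> GX.Fix (fst a)" "pathstart p = snd a"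
    unfolding path_def path_image_def pathstart_def
    using ht(3) \<Lambda>(3) continuous_on_snd[OF cont] by (auto simp: p_def)
  note h1 = ht[of 1, simplified]
  define g where "g = \<delta> (snd b) (p 1) (inv\<^bsub>H\<^esub> (h 1) \<otimes>\<^bsub>H\<^esub> \<beta>)"
  have "actY (inv\<^bsub>H\<^esub> (h 1) \<otimes>\<^bsub>H\<^esub> \<beta>) (f (snd b)) = actY (inv\<^bsub>H\<^esub> (h 1)) (actY \<beta> (f (snd b)))"
    using h1(2) \<beta>H B(5) by (intro HY.act_mult) auto
  also have "actY \<beta> (f (snd b)) = actY (h 1) (f (p 1))" using h1(5) \<gamma>(4) by (simp add: pathfinish_def)
  finally have "actY (inv\<^bsub>H\<^esub> (h 1) \<otimes>\<^bsub>H\<^esub> \<beta>) (f (snd b)) = f (p 1)" using h1(2,4) by simp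
  then have g: "g \<in> carrier G" "actX g (snd b) = p 1" "\<phi> g = inv\<^bsub>H\<^esub> (h 1) \<otimes>\<^bsub>H\<^esub> \<beta>"
    using \<delta>[OF B(5) h1(4)] h1(2) \<beta>H by (auto simp: g_def)
  have "inv g \<otimes> k \<otimes> g \<in> fst b" if k: "k \<in> fst a" for k
  proof -
    have kc: "k \<in> carrier G" using k A(4) by blast
    have "\<phi> (inv g \<otimes> k \<otimes> g) = inv\<^bsub>H\<^esub> \<beta> \<otimes>\<^bsub>H\<^esub> (h 1 \<otimes>\<^bsub>H\<^esub> \<phi> k) \<otimes>\<^bsub>H\<^esub> inv\<^bsub>H\<^esub> (h 1) \<otimes>\<^bsub>H\<^esub> \<beta>"
      using g(1,3) kc h1(2) \<beta>H by (simp add: HY.inv_mult_group HY.m_assoc)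
    also have "h 1 \<otimes>\<^bsub>H\<^esub> \<phi> k = \<phi> k \<otimes>\<^bsub>H\<^esub> h 1" using HY.centrD(2)[OF h1(1)] k by blast
    also have "inv\<^bsub>H\<^esub> \<beta> \<otimes>\<^bsub>H\<^esub> (\<phi> k \<otimes>\<^bsub>H\<^esub> h 1) \<otimes>\<^bsub>H\<^esub> inv\<^bsub>H\<^esub> (h 1) \<otimes>\<^bsub>H\<^esub> \<beta> = inv\<^bsub>H\<^esub> \<beta> \<otimes>\<^bsub>H\<^esub> \<phi> k \<otimes>\<^bsub>H\<^esub> \<beta>"
      using kc h1(2) \<beta>H by (simp add: HY.m_assoc)
    finally obtain l where l: "l \<in> fst b" "\<phi> (inv g \<otimes> k \<otimes> g) = \<phi> l" using \<beta>K[OF k] by auto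
    have "actX (inv g \<otimes> k \<otimes> g) (snd b) = actX (inv g) (actX k (actX g (snd b)))"
      using g(1) kc B(5) by (simp add: GX.act_mult)
    also have "\<dots> = actX (inv g) (actX g (snd b))" using g(2) GX.FixD(2)[OF h1(3) k] by simp
    also have "\<dots> = snd b" using g(1) B(5) by simp
    finally show ?thesis using stabilizer_inj[OF _ l(1) B(4,2) _ l(2)] g(1) kc by simp
  qed
  then have arrow: "GX.arrow a b g p"
    unfolding GX.arrow_def using g p by (simp add: pathfinish_def)
  have "homotopic_paths (HY.Fix (\<phi> ` fst a)) \<gamma> (\<lambda>t. actY (h t) ((f \<circ> p) t))"
    using ht(5) by (intro homotopic_paths_eq[OF \<gamma>(1,2)]) simp
  then have "homotopic_paths (HY.Fix (\<phi> ` fst a)) (\<lambda>t. actY (h t) ((f \<circ> p) t)) \<gamma>" by (rule homotopic_paths_sym)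
  moreover have "pathfinish h \<otimes>\<^bsub>H\<^esub> \<phi> g = \<beta>" using g(3) h1(2) \<beta>H by (simp add: pathfinish_def)
  ultimately have "HY.arrow_rel (Pi_d_obj \<phi> f a) (Pi_d_obj \<phi> f b) (\<phi> g) (f \<circ> p) \<beta> \<gamma>"
    using h unfolding HY.arrow_rel_def Pi_d_obj_eq fst_conv by (intro exI[of _ h]) simp
  then have "Pi_d_arr H Y actY \<phi> f a b (GX.cls a b g p) = w"
    unfolding Pi_d_arr_cls[OF a b arrow] \<beta>(2) using HY.cls_eq_iff[OF a' b' map_arrow[OF a b arrow] \<beta>(1)] by simp
  then show ?thesis using GX.Hom_iff[OF a b] arrow by blast
qed

text \<open>
  A homotopy between the images is lifted to the square, and compared along the four sides with the
  obvious lifts. This gives elements \<open>A\<close>, \<open>B\<close>, \<open>C\<close>, \<open>D\<close> of the centralizer of \<open>K\<close>; \<open>W\<close> runs through those of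
  three sides, and is extended over the square to correct the lift there.
\<close>

lemma faithful_aux:
  assumes a: "a \<in> Pi_obj G X actX" and b: "b \<in> Pi_obj G X actX"
    and g: "GX.arrow a b g p" and g': "GX.arrow a b g' p'"
    and r: "HY.arrow_rel (Pi_d_obj \<phi> f a) (Pi_d_obj \<phi> f b) (\<phi> g) (f \<circ> p) (\<phi> g') (f \<circ> p')"
  shows "GX.arrow_rel a b g p g' p'"
proof -
  note OA = GX.Pi_objD[OF a] and OB = GX.Pi_objD[OF b]
  let ?K = "fst a" and ?I = "{0..1 :: real}"
  let ?F = "fibre ?K (\<lambda>k. k)"
  have gG: "g \<in> carrier G" "g' \<in> carrier G"
    and p: "path p" "path_image p \<subseteq> GX.Fix ?K" "p 0 = snd a" "p 1 = actX g (snd b)"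
    and p': "path p'" "path_image p' \<subseteq> GX.Fix ?K" "p' 0 = snd a" "p' 1 = actX g' (snd b)"
    using g g' by (auto simp: GX.arrow_def pathstart_def pathfinish_def)
  obtain c where c: "HY.centr_path (\<phi> ` ?K) c" "(pathfinish c \<otimes>\<^bsub>H\<^esub> \<phi> g) <#\<^bsub>H\<^esub> (\<phi> ` fst b) = \<phi> g' <#\<^bsub>H\<^esub> (\<phi> ` fst b)"
    "homotopic_paths (HY.Fix (\<phi> ` ?K)) (\<lambda>t. actY (c t) ((f \<circ> p) t)) (f \<circ> p')"
    using r unfolding HY.arrow_rel_def Pi_d_obj_eq by auto
  note ct = HY.centr_pathD[OF c(1)]
  have c0: "c 0 = \<one>\<^bsub>H\<^esub>" and cc: "continuous_on ?I c"
    using c(1) by (auto simp: HY.centr_path_def pathstart_def path_def)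
  have cp: "continuous_on ?I p" "continuous_on ?I p'" using p(1) p'(1) by (auto simp: path_def)
  \<comment> \<open>In \<open>\<Gamma> (s, t)\<close> the homotopy parameter is \<open>s\<close>. On
    the side \<open>s = 0\<close> it is the path moved by \<open>c\<close>; the sides
    \<open>t = 0\<close> and \<open>t = 1\<close> are constant.\<close>
  obtain \<Gamma> where \<Gamma>: "continuous_on (?I \<times> ?I) \<Gamma>" "\<Gamma> \<in> (?I \<times> ?I) \<rightarrow> HY.Fix (\<phi> ` ?K)"
    "\<And>t. t \<in> ?I \<Longrightarrow> \<Gamma> (0, t) = actY (c t) (f (p t))" "\<And>t. t \<in> ?I \<Longrightarrow> \<Gamma> (1, t) = f (p' t)"
    "\<And>s. s \<in> ?I \<Longrightarrow> \<Gamma> (s, 0) = \<Gamma> (0, 0)" "\<And>s. s \<in> ?I \<Longrightarrow> \<Gamma> (s, 1) = \<Gamma> (1, 1)"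
  proof -
    obtain \<Gamma> where \<Gamma>: "continuous_on (?I \<times> ?I) \<Gamma>" "\<Gamma> \<in> (?I \<times> ?I) \<rightarrow> HY.Fix (\<phi> ` ?K)"
      "\<forall>t\<in>?I. \<Gamma> (0, t) = actY (c t) ((f \<circ> p) t)" "\<forall>t\<in>?I. \<Gamma> (1, t) = (f \<circ> p') t"
      "\<forall>s\<in>?I. pathstart (\<Gamma> \<circ> Pair s) = pathstart (\<lambda>t. actY (c t) ((f \<circ> p) t)) \<and>
          pathfinish (\<Gamma> \<circ> Pair s) = pathfinish (\<lambda>t. actY (c t) ((f \<circ> p) t))"
      using c(3) unfolding homotopic_paths by blast
    have s0: "\<Gamma> (s, 0) = actY (c 0) (f (p 0))" "\<Gamma> (s, 1) = actY (c 1) (f (p 1))" if "s \<in> ?I" for s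
      using \<Gamma>(5) that by (auto simp: pathstart_def pathfinish_def)
    show thesis
    proof (rule that[OF \<Gamma>(1,2)])
      show "\<Gamma> (s, 0) = \<Gamma> (0, 0)" "\<Gamma> (s, 1) = \<Gamma> (1, 1)" if "s \<in> ?I" for s
        using s0[OF that] s0(1)[of 0] s0(2)[of 1] by simp_all
    qed (use \<Gamma>(3,4) in auto)
  qed
  have fx: "\<Gamma> (0, 0) = f (snd a)" using \<Gamma>(3)[of 0] c0 p(3) OA(5) by simp
  have "\<exists>\<Lambda>. continuous_on (?I \<times> ?I) \<Lambda> \<and> (\<forall>v\<in>?I \<times> ?I. \<Lambda> v \<in> ?F (\<Gamma> v)) \<and> \<Lambda> (0, 0) = (\<one>\<^bsub>H\<^esub>, snd a)"
    using \<Gamma>(2) by (intro square_lift[OF OA(1,2) \<Gamma>(1) _ fx]) auto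
  then obtain \<Lambda> where \<Lambda>: "continuous_on (?I \<times> ?I) \<Lambda>" "\<And>v. v \<in> ?I \<times> ?I \<Longrightarrow> \<Lambda> v \<in> ?F (\<Gamma> v)" "\<Lambda> (0, 0) = (\<one>\<^bsub>H\<^esub>, snd a)"
    by blast
  have one_fibre: "(\<one>\<^bsub>H\<^esub>, x) \<in> ?F (f x)" if "x \<in> GX.Fix ?K" for x
    using GX.FixD[OF that] OA(4) by (auto simp: fibre_def)
  note pt = GX.Fix_pathD[OF p(2)] and p't = GX.Fix_pathD[OF p'(2)]
  have c_fibre: "(c t, p t) \<in> ?F (\<Gamma> (0, t))" if "t \<in> ?I" for t
    unfolding fibre_def using HY.centrD(2)[OF ct(1)[OF that]] ct(2)[OF that] pt[OF that] \<Gamma>(3)[OF that] OA(4)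
      GX.FixD(2)[OF pt(1)[OF that]] by auto
  have side0: "\<Lambda> (0, t) \<in> ?F (\<Gamma> (0, t))" and side1: "\<Lambda> (1, t) \<in> ?F (f (p' t))"
    and sideB: "\<Lambda> (t, 0) \<in> ?F (f (snd a))" and sideD: "\<Lambda> (t, 1) \<in> ?F (f (p' 1))" if "t \<in> ?I" for t
    using \<Lambda>(2)[of "(0, t)"] \<Lambda>(2)[of "(1, t)"] \<Lambda>(2)[of "(t, 0)"] \<Lambda>(2)[of "(t, 1)"] \<Gamma>(4)[OF that] \<Gamma>(5)[OF that]
      \<Gamma>(6)[OF that] \<Gamma>(4)[of 1] fx that by auto
  have one1: "(\<one>\<^bsub>H\<^esub>, p' t) \<in> ?F (f (p' t))" if "t \<in> ?I" for t using one_fibre[OF p't(1)[OF that]] .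
  have oneB: "(\<one>\<^bsub>H\<^esub>, snd a) \<in> ?F (f (snd a))" using one_fibre[OF OA(2)] .
  have oneD: "(\<one>\<^bsub>H\<^esub>, p' 1) \<in> ?F (f (p' 1))" using one1[of 1] by simp
  \<comment> \<open>\<open>A\<close> belongs to the side \<open>s = 1\<close>, \<open>B\<close> to
    \<open>t = 0\<close>, \<open>C\<close> to \<open>s = 0\<close> and \<open>D\<close> to
    \<open>t = 1\<close>; each takes the obvious lift to \<open>\<Lambda>\<close>. For
    \<open>C\<close> the obvious lift is \<open>(c t, p t)\<close>; the others have first component
    one.\<close>
  define A where "A t = division (\<one>\<^bsub>H\<^esub>, p' t) (\<Lambda> (1, t))" for t
  define B where "B s = division (\<one>\<^bsub>H\<^esub>, snd a) (\<Lambda> (s, 0))" for s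
  define C where "C t = division (c t, p t) (\<Lambda> (0, t))" for t
  define D where "D s = division (\<one>\<^bsub>H\<^esub>, p' 1) (\<Lambda> (s, 1))" for s
  have centr: "A t \<in> GX.centr ?K" "B t \<in> GX.centr ?K" "C t \<in> GX.centr ?K" "D t \<in> GX.centr ?K" if "t \<in> ?I" for t
    unfolding A_def B_def C_def D_def
    using division_centr[OF OA(4) one1[OF that] side1[OF that]] division_centr[OF OA(4) oneB sideB[OF that]]
      division_centr[OF OA(4) c_fibre[OF that] side0[OF that]] division_centr[OF OA(4) oneD sideD[OF that]] by auto
  have move: "actX (A t) (p' t) = snd (\<Lambda> (1, t))" "actX (B t) (snd a) = snd (\<Lambda> (t, 0))"
    "actX (C t) (p t) = snd (\<Lambda> (0, t))" "actX (D t) (p' 1) = snd (\<Lambda> (t, 1))" if "t \<in> ?I" for t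
    unfolding A_def B_def C_def D_def
    using division(2)[OF one1[OF that] side1[OF that]] division(2)[OF oneB sideB[OF that]]
      division(2)[OF c_fibre[OF that] side0[OF that]] division(2)[OF oneD sideD[OF that]] by auto
  have cont\<Lambda>: "continuous_on ?I (\<lambda>t. \<Lambda> (1, t))" "continuous_on ?I (\<lambda>t. \<Lambda> (0, t))"
    "continuous_on ?I (\<lambda>t. \<Lambda> (t, 0))" "continuous_on ?I (\<lambda>t. \<Lambda> (t, 1))"
    by (rule continuous_on_compose2[OF \<Lambda>(1)]; force intro!: continuous_intros)+
  have cont: "continuous_on ?I A" "continuous_on ?I B" "continuous_on ?I C" "continuous_on ?I D"
  proof -
    show "continuous_on ?I A" unfolding A_def using one1 side1
      by (intro continuous_division[where K = ?K] cont\<Lambda> continuous_on_Pair continuous_on_const cp) blast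
    show "continuous_on ?I B" unfolding B_def using oneB sideB
      by (intro continuous_division[where K = ?K] cont\<Lambda> continuous_on_const) blast
    show "continuous_on ?I C" unfolding C_def using c_fibre side0
      by (intro continuous_division[where K = ?K] cont\<Lambda> continuous_on_Pair cc cp) blast
    show "continuous_on ?I D" unfolding D_def using oneD sideD
      by (intro continuous_division[where K = ?K] cont\<Lambda> continuous_on_const) blast
  qed
  have corner: "B 1 = A 0" "A 1 = D 1" "C 0 = B 0"
    using c0 p(3) p'(3) by (simp_all add: A_def B_def C_def D_def)
  \<comment> \<open>Runs from the corner (0, 0) through (1, 0) and (1, 1) to (0, 1), in unit speed
    on [-1, 2]: \<open>B\<close>, then \<open>A\<close>, then \<open>D\<close> backwards. The side
    \<open>s = 0\<close> is left free; the 2-cell is found there.\<close>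
  define W where "W u = (if u \<le> 0 then B (u + 1) else if u \<le> 1 then A u else D (2 - u))" for u
  have W: "W (s - 1) = B s" "W s = A s" "W (2 - s) = D s" if "s \<in> ?I" for s
    using that corner by (auto simp: W_def)
  have contW: "continuous_on {-1..2} W"
    unfolding W_def
  proof (intro continuous_on_cases_le[where h = "\<lambda>u. u"] continuous_on_id)
    show "continuous_on {u \<in> {-1..2}. u \<le> 0} (\<lambda>u. B (u + 1))"
      by (rule continuous_on_compose2[OF cont(2)]) (auto intro!: continuous_intros)
    show "continuous_on {u \<in> {u \<in> {-1..2}. 0 \<le> u}. u \<le> 1} A"
      by (rule continuous_on_subset[OF cont(1)]) auto
    show "continuous_on {u \<in> {u \<in> {-1..2}. 0 \<le> u}. 1 \<le> u} (\<lambda>u. D (2 - u))"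
      by (rule continuous_on_compose2[OF cont(4)]) (auto intro!: continuous_intros)
  qed (use corner in auto)
  have Wc: "W u \<in> GX.centr ?K" if "u \<in> {-1..2}" for u
    using centr(2)[of "u + 1"] centr(1)[of u] centr(4)[of "2 - u"] that by (auto simp: W_def)
  have invW: "inv (W u) \<in> GX.centr ?K" "W u \<in> carrier G" if "u \<in> {-1..2}" for u
    using subgroup.m_inv_closed[OF GX.centr_subgroup[OF OA(4)] Wc[OF that]] GX.centrD(1)[OF Wc[OF that]] by auto
  \<comment> \<open>The parameter \<open>3 * t - 1\<close> sweeps all of [-1, 2] along the side
    \<open>s = 0\<close>. \<open>C t\<close> takes \<open>p t\<close> to the lift, and the inverse
    of \<open>W\<close> corrects the lift; at \<open>t = 0\<close> they cancel because
    \<open>C 0 = B 0\<close>.\<close>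
  define e where "e t = inv (W (3 * t - 1)) \<otimes> C t" for t
  have e: "GX.centr_path ?K e"
    unfolding GX.centr_path_def
  proof (intro conjI)
    have cW: "continuous_on ?I (\<lambda>t. W (3 * t - 1))"
      by (rule continuous_on_compose2[OF contW]) (auto intro!: continuous_intros)
    have "(\<lambda>t. W (3 * t - 1)) ` ?I \<subseteq> carrier G" using invW(2) by auto
    moreover have "C ` ?I \<subseteq> carrier G" using centr(3) GX.centrD(1) by blast
    ultimately show "path e" unfolding path_def e_def
      by (intro GX.continuous_mult GX.continuous_inv cW cont(3)) (auto simp: image_subset_iff)
    show "path_image e \<subseteq> GX.centr ?K"
      using subgroup.m_closed[OF GX.centr_subgroup[OF OA(4)] invW(1) centr(3)]
      by (auto simp: path_image_def e_def)
    show "pathstart e = \<one>" using W(1)[of 0] corner(3) GX.centrD(1)[OF centr(3)[of 0]]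
      by (simp add: pathstart_def e_def)
  qed
  \<comment> \<open>For fixed \<open>s\<close> the argument of \<open>W\<close> runs linearly from
    \<open>s - 1\<close> to \<open>2 - s\<close>. Hence \<open>E\<close> is \<open>B\<close> at
    \<open>t = 0\<close>, \<open>D\<close> at \<open>t = 1\<close> and \<open>A\<close> at
    \<open>s = 1\<close>, while at \<open>s = 0\<close> it is the factor
    \<open>W (3 * t - 1)\<close> in \<open>e\<close>.\<close>
  define E where "E v = W (fst v - 1 + snd v * (3 - 2 * fst v))" for v :: "real \<times> real"
  have range: "fst v - 1 + snd v * (3 - 2 * fst v) \<in> {-1..2}" if v: "v \<in> ?I \<times> ?I" for v
  proof -
    obtain s t where st: "v = (s, t)" "0 \<le> s" "s \<le> 1" "0 \<le> t" "t \<le> 1" using v by auto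
    have lo: "0 \<le> t * (3 - 2 * s)" using st by (intro mult_nonneg_nonneg) auto
    have hi: "t * (3 - 2 * s) \<le> 3 - 2 * s" using mult_right_mono[of t 1 "3 - 2 * s"] st by simp
    have "-1 \<le> s - 1 + t * (3 - 2 * s)" using lo st(2) by linarith
    moreover have "s - 1 + t * (3 - 2 * s) \<le> 2" using hi st(2) by linarith
    ultimately show ?thesis using st(1) by simp
  qed
  have contE: "continuous_on (?I \<times> ?I) E" unfolding E_def
    by (rule continuous_on_compose2[OF contW]) (use range in \<open>auto intro!: continuous_intros\<close>)
  have EG: "E v \<in> carrier G" "inv (E v) \<in> GX.centr ?K" if "v \<in> ?I \<times> ?I" for v
    using invW[OF range[OF that]] by (auto simp: E_def)
  note \<Lambda>X = fibre_idD(1)[OF \<Lambda>(2)]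
  have H0: "actX (inv (E (0, t))) (snd (\<Lambda> (0, t))) = actX (e t) (p t)" if t: "t \<in> ?I" for t
  proof -
    have "inv (W (3 * t - 1)) \<in> carrier G" "C t \<in> carrier G"
      using invW(2)[of "3 * t - 1"] GX.centrD(1)[OF centr(3)[OF t]] t by auto
    then have "actX (e t) (p t) = actX (inv (W (3 * t - 1))) (snd (\<Lambda> (0, t)))"
      using move(3)[OF t] pt(2)[OF t] by (simp add: e_def GX.act_mult)
    moreover have "E (0, t) = W (3 * t - 1)" by (simp add: E_def algebra_simps)
    ultimately show ?thesis by simp
  qed
  have H1: "actX (inv (E (1, t))) (snd (\<Lambda> (1, t))) = p' t" if t: "t \<in> ?I" for t
    using W(2)[OF t] p't(2)[OF t] GX.centrD(1)[OF centr(1)[OF t]] by (simp add: E_def flip: move(1)[OF t])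
  have HB: "actX (inv (E (s, 0))) (snd (\<Lambda> (s, 0))) = snd a" if s: "s \<in> ?I" for s
    using W(1)[OF s] OA(5) GX.centrD(1)[OF centr(2)[OF s]] by (simp add: E_def flip: move(2)[OF s])
  have HD: "actX (inv (E (s, 1))) (snd (\<Lambda> (s, 1))) = p' 1" if s: "s \<in> ?I" for s
  proof -
    have "s - 1 + (3 - 2 * s) = 2 - s" by simp
    then show ?thesis
      using W(3)[OF s] p't(2)[of 1] GX.centrD(1)[OF centr(4)[OF s]] by (simp add: E_def flip: move(4)[OF s])
  qed
  \<comment> \<open>The lift corrected by the inverse of \<open>E\<close> is constant along
    \<open>t = 0\<close> and \<open>t = 1\<close>, equals \<open>p'\<close> at \<open>s = 1\<close>,
    and is \<open>p\<close> moved by \<open>e\<close> at \<open>s = 0\<close>.\<close>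
  have "homotopic_paths (GX.Fix ?K) (\<lambda>t. actX (e t) (p t)) p'"
    unfolding homotopic_paths
  proof (intro exI conjI ballI)
    show "continuous_on (?I \<times> ?I) (\<lambda>v. actX (inv (E v)) (snd (\<Lambda> v)))"
    proof (intro GX.continuous_act GX.continuous_inv contE continuous_on_snd[OF \<Lambda>(1)])
      show "E ` (?I \<times> ?I) \<subseteq> carrier G" using EG(1) by blast
      then show "(\<lambda>v. inv (E v)) ` (?I \<times> ?I) \<subseteq> carrier G" by auto
      show "(\<lambda>v. snd (\<Lambda> v)) ` (?I \<times> ?I) \<subseteq> X" using GX.FixD(1)[OF \<Lambda>X] by blast
    qed
    show "(\<lambda>v. actX (inv (E v)) (snd (\<Lambda> v))) \<in> (?I \<times> ?I) \<rightarrow> GX.Fix ?K"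
      using GX.act_centr[OF EG(2) OA(4) \<Lambda>X] by blast
    fix s assume s: "s \<in> ?I"
    show "actX (inv (E (0, s))) (snd (\<Lambda> (0, s))) = actX (e s) (p s)" using H0[OF s] .
    show "actX (inv (E (1, s))) (snd (\<Lambda> (1, s))) = p' s" using H1[OF s] .
    show "pathstart ((\<lambda>v. actX (inv (E v)) (snd (\<Lambda> v))) \<circ> Pair s) = pathstart (\<lambda>t. actX (e t) (p t))"
      using HB[OF s] HB[of 0] H0[of 0] by (simp add: pathstart_def)
    show "pathfinish ((\<lambda>v. actX (inv (E v)) (snd (\<Lambda> v))) \<circ> Pair s) = pathfinish (\<lambda>t. actX (e t) (p t))"
      using HD[OF s] HD[of 0] H0[of 1] by (simp add: pathfinish_def)
  qed
  moreover have "(pathfinish e \<otimes> g) <# fst b = g' <# fst b"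
  proof -
    have D0: "D 0 \<in> carrier G" and C1: "C 1 \<in> carrier G" using GX.centrD(1) centr[of 0] centr[of 1] by auto
    have c1: "c 1 \<in> carrier H" and \<Lambda>1: "fst (\<Lambda> (0, 1)) \<in> carrier H" using ct(2)[of 1] fibreD(1)[OF side0[of 1]] by auto
    have e1: "e 1 = inv (D 0) \<otimes> C 1" using W(3)[of 0] by (simp add: e_def)
    have eG: "e 1 \<in> carrier G" using D0 C1 e1 by simp
    have "\<phi> (D 0) = inv\<^bsub>H\<^esub> fst (\<Lambda> (0, 1))" "\<phi> (C 1) = inv\<^bsub>H\<^esub> fst (\<Lambda> (0, 1)) \<otimes>\<^bsub>H\<^esub> c 1"
      unfolding C_def D_def using division(3)[OF oneD sideD[of 0]] division(3)[OF c_fibre[of 1] side0[of 1]] \<Lambda>1 by auto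
    then have "\<phi> (e 1) = c 1" using D0 C1 e1 c1 \<Lambda>1 by simp
    then have \<phi>u: "\<phi> (inv g' \<otimes> (e 1 \<otimes> g)) = inv\<^bsub>H\<^esub> \<phi> g' \<otimes>\<^bsub>H\<^esub> (c 1 \<otimes>\<^bsub>H\<^esub> \<phi> g)" using gG eG by simp
    have "inv\<^bsub>H\<^esub> \<phi> g' \<otimes>\<^bsub>H\<^esub> (c 1 \<otimes>\<^bsub>H\<^esub> \<phi> g) \<in> \<phi> ` fst b"
      using c(2) HY.lcoset_eq_iff[OF image_subgroup[OF OB(1)], of "\<phi> g'" "c 1 \<otimes>\<^bsub>H\<^esub> \<phi> g"] gG c1
      by (simp add: pathfinish_def)
    then obtain l where l: "l \<in> fst b" "\<phi> (inv g' \<otimes> (e 1 \<otimes> g)) = \<phi> l" using \<phi>u by auto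
    have "actX (e 1) (p 1) = p' 1" using H0[of 1] HD[of 0] by simp
    then have "actX (inv g' \<otimes> (e 1 \<otimes> g)) (snd b) = snd b"
      using gG eG OB(5) p(4) p'(4) by (simp add: GX.act_mult)
    then have "inv g' \<otimes> (e 1 \<otimes> g) \<in> fst b"
      using stabilizer_inj[OF _ l(1) OB(4,2) _ l(2)] gG eG by simp
    then show ?thesis
      using GX.lcoset_eq_iff[OF OB(1), of g' "e 1 \<otimes> g"] gG eG by (simp add: pathfinish_def)
  qed
  ultimately show ?thesis unfolding GX.arrow_rel_def using e by blast
qed

text \<open>Write \<open>y = actY h (f x)\<close>. As \<open>M\<close> fixes \<open>y\<close>, its
  conjugate by the inverse of \<open>h\<close> fixes \<open>f x\<close> and so comes from the
  isotropy group of \<open>x\<close>; \<open>K\<close> is the part that corresponds to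
  \<open>M\<close>. Hence \<open>\<phi>(K)\<close> is that conjugate of \<open>M\<close>, and
  \<open>h\<close> with constant paths is an isomorphism.\<close>

lemma essentially_surjective:
  assumes d: "d \<in> Pi_obj H Y actY"
  shows "\<exists>a\<in>Pi_obj G X actX. isomorphic_objects (Pi_d H Y actY) (Pi_d_obj \<phi> f a) d"
proof -
  obtain M y where dMy: "d = (M, y)" by fastforce
  note D = HY.Pi_objD[OF d, unfolded dMy fst_conv snd_conv]
  obtain h x where h: "h \<in> carrier H" "x \<in> X" "actY h (f x) = y" using surj[OF D(5)] by blast
  define K where "K = {g \<in> carrier G. actX g x = x \<and> h \<otimes>\<^bsub>H\<^esub> \<phi> g \<otimes>\<^bsub>H\<^esub> inv\<^bsub>H\<^esub> h \<in> M}"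
  have K: "subgroup K G"
  proof (rule GX.subgroupI)
    show "K \<subseteq> carrier G" by (auto simp: K_def)
    have "\<one> \<in> K" using h HY.subgroup_self subgroup.one_closed[OF D(1)] by (simp add: K_def)
    then show "K \<noteq> {}" by blast
    fix k assume k: "k \<in> K"
    have kx: "k \<in> carrier G" "actX k x = x" using k by (auto simp: K_def)
    have "actX (inv k) x = x" using GX.act_inv[OF kx(1) h(2)] unfolding kx(2) .
    moreover have "h \<otimes>\<^bsub>H\<^esub> \<phi> (inv k) \<otimes>\<^bsub>H\<^esub> inv\<^bsub>H\<^esub> h = inv\<^bsub>H\<^esub> (h \<otimes>\<^bsub>H\<^esub> \<phi> k \<otimes>\<^bsub>H\<^esub> inv\<^bsub>H\<^esub> h)"
      using k h(1) by (simp add: K_def HY.inv_mult_group HY.m_assoc)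
    ultimately show "inv k \<in> K" using k subgroup.m_inv_closed[OF D(1)] by (simp add: K_def)
    fix l assume l: "l \<in> K"
    have "h \<otimes>\<^bsub>H\<^esub> \<phi> (k \<otimes> l) \<otimes>\<^bsub>H\<^esub> inv\<^bsub>H\<^esub> h = (h \<otimes>\<^bsub>H\<^esub> \<phi> k \<otimes>\<^bsub>H\<^esub> inv\<^bsub>H\<^esub> h) \<otimes>\<^bsub>H\<^esub> (h \<otimes>\<^bsub>H\<^esub> \<phi> l \<otimes>\<^bsub>H\<^esub> inv\<^bsub>H\<^esub> h)"
      using k l h(1) by (simp add: K_def HY.m_assoc)
    then show "k \<otimes> l \<in> K" using k l h(2) subgroup.m_closed[OF D(1)] by (simp add: K_def GX.act_mult)
  qed
  have xK: "x \<in> GX.Fix K" using h(2) by (simp add: fixed_points_def K_def)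
  have \<phi>K: "inv\<^bsub>H\<^esub> h \<otimes>\<^bsub>H\<^esub> m \<otimes>\<^bsub>H\<^esub> h \<in> \<phi> ` K" if m: "m \<in> M" for m
  proof -
    have mc: "m \<in> carrier H" using m D(4) by blast
    have "actY (inv\<^bsub>H\<^esub> h \<otimes>\<^bsub>H\<^esub> m \<otimes>\<^bsub>H\<^esub> h) (f x) = actY (inv\<^bsub>H\<^esub> h) (actY m (actY h (f x)))"
      using h(1,2) mc by (simp add: HY.act_mult)
    also have "actY m (actY h (f x)) = actY h (f x)" using HY.FixD(2)[OF D(2) m] h(3) by simp
    finally have "actY (inv\<^bsub>H\<^esub> h \<otimes>\<^bsub>H\<^esub> m \<otimes>\<^bsub>H\<^esub> h) (f x) = f x" using h(1,2) by simp
    from \<delta>[OF h(2) h(2) _ this] h(1) mc obtain g where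
      g: "g \<in> carrier G" "actX g x = x" "\<phi> g = inv\<^bsub>H\<^esub> h \<otimes>\<^bsub>H\<^esub> m \<otimes>\<^bsub>H\<^esub> h" by auto
    have "h \<otimes>\<^bsub>H\<^esub> \<phi> g \<otimes>\<^bsub>H\<^esub> inv\<^bsub>H\<^esub> h = m" using g(3) h(1) mc by (simp add: HY.m_assoc)
    then have "g \<in> K" using g(1,2) m by (simp add: K_def)
    then show ?thesis using g(3) by (metis imageI)
  qed
  define a where "a = (K, x)"
  have a: "a \<in> Pi_obj G X actX" unfolding a_def by (rule GX.Pi_objI[OF K xK])
  note a' = Pi_d_obj_closed[OF a]
  have Fa: "Pi_d_obj \<phi> f a = (\<phi> ` K, f x)" by (simp add: Pi_d_obj_eq a_def)
  have fx: "f x \<in> HY.Fix (\<phi> ` K)" using HY.Pi_objD(2)[OF a'] by (simp add: Fa)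
  have hy: "actY (inv\<^bsub>H\<^esub> h) y = f x" using h by (simp flip: h(3))
  have u: "HY.arrow (Pi_d_obj \<phi> f a) d (inv\<^bsub>H\<^esub> h) (\<lambda>_. f x)"
    unfolding HY.arrow_def Fa dMy using h(1) hy fx
    by (auto simp: path_def path_image_def pathstart_def pathfinish_def K_def)
  have v: "HY.arrow d (Pi_d_obj \<phi> f a) h (\<lambda>_. y)"
    unfolding HY.arrow_def Fa dMy using h(1,3) D(2) \<phi>K
    by (auto simp: path_def path_image_def pathstart_def pathfinish_def)
  have c: "HY.path_comp (inv\<^bsub>H\<^esub> h) (\<lambda>_. f x) (\<lambda>_. y) = (\<lambda>_. f x)" "HY.path_comp h (\<lambda>_. y) (\<lambda>_. f x) = (\<lambda>_. y)"
    using hy h(3) by (auto simp: HY.path_comp_def joinpaths_def)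
  show ?thesis
  proof (intro bexI[OF _ a], unfold isomorphic_objects_def, intro bexI conjI)
    show "HY.cls (Pi_d_obj \<phi> f a) d (inv\<^bsub>H\<^esub> h) (\<lambda>_. f x) \<in> Hom (Pi_d H Y actY) (Pi_d_obj \<phi> f a) d"
      using HY.Hom_iff[OF a' d] u by blast
    show "HY.cls d (Pi_d_obj \<phi> f a) h (\<lambda>_. y) \<in> Hom (Pi_d H Y actY) d (Pi_d_obj \<phi> f a)"
      using HY.Hom_iff[OF d a'] v by blast
    show "Comp (Pi_d H Y actY) (Pi_d_obj \<phi> f a) d (Pi_d_obj \<phi> f a)
        (HY.cls (Pi_d_obj \<phi> f a) d (inv\<^bsub>H\<^esub> h) (\<lambda>_. f x)) (HY.cls d (Pi_d_obj \<phi> f a) h (\<lambda>_. y)) =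
      Ident (Pi_d H Y actY) (Pi_d_obj \<phi> f a)"
      unfolding HY.Comp_cls[OF a' d a' u v] HY.Ident_cls[OF a'] c using h(1) by (simp add: Fa)
    show "Comp (Pi_d H Y actY) d (Pi_d_obj \<phi> f a) d
        (HY.cls d (Pi_d_obj \<phi> f a) h (\<lambda>_. y)) (HY.cls (Pi_d_obj \<phi> f a) d (inv\<^bsub>H\<^esub> h) (\<lambda>_. f x)) =
      Ident (Pi_d H Y actY) d"
      unfolding HY.Comp_cls[OF d a' d v u] HY.Ident_cls[OF d] c using h(1) by (simp add: dMy)
  qed
qed

lemma faithful:
  assumes a: "a \<in> Pi_obj G X actX" and b: "b \<in> Pi_obj G X actX"
  shows "inj_on (Pi_d_arr H Y actY \<phi> f a b) (Hom (Pi_d G X actX) a b)"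
proof (rule inj_onI)
  note a' = Pi_d_obj_closed[OF a] and b' = Pi_d_obj_closed[OF b]
  fix u v assume uv: "u \<in> Hom (Pi_d G X actX) a b" "v \<in> Hom (Pi_d G X actX) a b"
    "Pi_d_arr H Y actY \<phi> f a b u = Pi_d_arr H Y actY \<phi> f a b v"
  obtain g p where g: "GX.arrow a b g p" "u = GX.cls a b g p" using uv(1) GX.Hom_iff[OF a b] by blast
  obtain g' p' where g': "GX.arrow a b g' p'" "v = GX.cls a b g' p'" using uv(2) GX.Hom_iff[OF a b] by blast
  have "HY.arrow_rel (Pi_d_obj \<phi> f a) (Pi_d_obj \<phi> f b) (\<phi> g) (f \<circ> p) (\<phi> g') (f \<circ> p')"
    using uv(3) HY.cls_eq_iff[OF a' b' map_arrow[OF a b g(1)] map_arrow[OF a b g'(1)]]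
    unfolding g(2) g'(2) Pi_d_arr_cls[OF a b g(1)] Pi_d_arr_cls[OF a b g'(1)] by simp
  then have "GX.arrow_rel a b g p g' p'" by (rule faithful_aux[OF a b g(1) g'(1)])
  then show "u = v" using GX.cls_eq_iff[OF a b g(1) g'(1)] g(2) g'(2) by simp
qed

theorem weak_equivalence_Pi_d:
  "weak_equivalence (Pi_d G X actX) (Pi_d H Y actY) (Pi_d_obj \<phi> f) (Pi_d_arr H Y actY \<phi> f)"
  unfolding weak_equivalence_def Obj_Pi_d
  using is_functor_Pi_d_arr full faithful essentially_surjective by blast

end

section \<open>From manifolds to topological actions\<close>

lemma finite_isotropy_action_of_smooth_action:
  fixes G :: "('g::topological_space, 'd::euclidean_space) lie_group"
    and X :: "('x::topological_space, 'e::euclidean_space) manifold"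
  assumes G: "is_lie_group G" and act: "smooth_action G X act"
    and fin: "\<And>x. x \<in> points X \<Longrightarrow> finite (stabilizer G act x)"
  shows "finite_isotropy_action G (points X) act"
proof -
  interpret group G using G by (simp add: is_lie_group_def)
  interpret A: group_action G "points X" act using act by (simp add: smooth_action_def)
  show ?thesis
  proof
    fix g x assume "g \<in> carrier G" "x \<in> points X"
    then show "act g x \<in> points X" using A.element_image by blast
  next
    fix g h x assume "g \<in> carrier G" "h \<in> carrier G" "x \<in> points X"
    then show "act (g \<otimes>\<^bsub>G\<^esub> h) x = act g (act h x)" by (intro A.composition_rule)
  next
    fix x assume x: "x \<in> points X"
    show "act \<one>\<^bsub>G\<^esub> x = x" using x fun_cong[OF A.id_eq_one, of x] by simp
    show "finite {g \<in> carrier G. act g x = x}" using fin[OF x] by (simp add: stabilizer_def)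
  next
    show "continuous_on (carrier G \<times> points X) (\<lambda>(g, x). act g x)"
      using act by (simp add: smooth_action_def smooth_map_on_def prod_manifold_def group_manifold_def)
    show "continuous_on (carrier G \<times> carrier G) (\<lambda>(g, h). g \<otimes>\<^bsub>G\<^esub> h)" "continuous_on (carrier G) (\<lambda>g. inv\<^bsub>G\<^esub> g)"
      using G by (simp_all add: is_lie_group_def smooth_map_on_def prod_manifold_def group_manifold_def)
    show "t1_space (top_of_set (carrier G))"
      using G by (simp add: is_lie_group_def smooth_manifold_def group_manifold_def Hausdorff_imp_t1_space)
  qed
qed

text \<open>The pullback condition gives \<open>\<delta>\<close> with its uniqueness and continuity,
  as a component of the inverse diffeomorphism. The submersion gives the local sections, by
  \<open>equivariant_local_section\<close> for a finite subgroup acting on H \<times> X.\<close>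

lemma action_equivalence_of_essential_equivalence:
  fixes G :: "('g::topological_space, 'd::euclidean_space) lie_group"
    and H :: "('h::topological_space, 'b::euclidean_space) lie_group"
    and X :: "('x::topological_space, 'e::euclidean_space) manifold"
    and Y :: "('y::topological_space, 'c::euclidean_space) manifold"
  assumes G: "is_lie_group G" and H: "is_lie_group H"
    and X: "smooth_manifold X" and Y: "smooth_manifold Y"
    and actX: "smooth_action G X actX" and actY: "smooth_action H Y actY"
    and finX: "\<And>x. x \<in> points X \<Longrightarrow> finite (stabilizer G actX x)"
    and finY: "\<And>y. y \<in> points Y \<Longrightarrow> finite (stabilizer H actY y)"
    and eq: "equivariant_essential_equivalence G X actX H Y actY \<phi> f"
  shows "action_equivalence G (points X) actX H (points Y) actY \<phi> f
    (\<lambda>x x' h. fst (inv_into (carrier G \<times> points X) (\<lambda>(g, x). (x, actX g x, \<phi> g)) (x, x', h)))"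
proof -
  interpret GX: finite_isotropy_action G "points X" actX
    by (rule finite_isotropy_action_of_smooth_action[OF G actX finX])
  interpret HY: finite_isotropy_action H "points Y" actY
    by (rule finite_isotropy_action_of_smooth_action[OF H actY finY])
  have em: "equivariant_map G X actX H Y actY \<phi> f"
    and subm: "submersion (prod_manifold (group_manifold H) X) Y (\<lambda>(h, x). actY h (f x))"
    and onto: "(\<lambda>(h, x). actY h (f x)) ` (carrier H \<times> points X) = points Y"
    and diffeo: "diffeomorphism_onto (prod_manifold (group_manifold G) X)
       (prod_manifold X (prod_manifold X (group_manifold H)))
       {(x, x', h). x \<in> points X \<and> x' \<in> points X \<and> h \<in> carrier H \<and> actY h (f x) = f x'}
       (\<lambda>(g, x). (x, actX g x, \<phi> g))"
    using eq by (auto simp: equivariant_essential_equivalence_def)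
  have hom: "\<phi> \<in> hom G H" and cont_\<phi>: "continuous_on (carrier G) \<phi>"
    and f: "continuous_on (points X) f" "f ` points X \<subseteq> points Y"
    and f_act: "\<And>g x. g \<in> carrier G \<Longrightarrow> x \<in> points X \<Longrightarrow> f (actX g x) = actY (\<phi> g) (f x)"
    using em by (auto simp: equivariant_map_def smooth_map_on_def group_manifold_def)
  interpret \<phi>: group_hom G H \<phi> by unfold_locales (rule hom)
  let ?E = "{(x, x', h). x \<in> points X \<and> x' \<in> points X \<and> h \<in> carrier H \<and> actY h (f x) = f x'}"
  let ?F = "\<lambda>(g, x). (x, actX g x, \<phi> g)"
  have bij: "bij_betw ?F (carrier G \<times> points X) ?E"
    and cont_inv: "continuous_on ?E (inv_into (carrier G \<times> points X) ?F)"
    using diffeo by (simp_all add: diffeomorphism_onto_def smooth_map_on_def prod_manifold_def group_manifold_def)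
  define \<delta> where "\<delta> x x' h = fst (inv_into (carrier G \<times> points X) ?F (x, x', h))" for x x' h
  have cH: "charted (group_manifold H)" and cX: "charted X" and cY: "charted Y"
    using H X Y by (auto simp: is_lie_group_def intro: smooth_manifold_imp_charted)
  have cG: "charted (group_manifold G)" using G by (auto simp: is_lie_group_def intro: smooth_manifold_imp_charted)
  have C1X: "C1_map X X (actX g)" if "g \<in> carrier G" for g
  proof (rule C1_map_curry_left[OF _ cG])
    show "C1_map (prod_manifold (group_manifold G) X) X (\<lambda>(g, x). actX g x)"
      using actX by (intro smooth_map_imp_C1_map charted_prod cG cX) (simp add: smooth_action_def)
  qed (use that in \<open>simp add: group_manifold_def\<close>)
  have C1Y: "C1_map Y Y (actY h)" if "h \<in> carrier H" for h
  proof (rule C1_map_curry_left[OF _ cH])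
    show "C1_map (prod_manifold (group_manifold H) Y) Y (\<lambda>(h, y). actY h y)"
      using actY by (intro smooth_map_imp_C1_map charted_prod cH cY) (simp add: smooth_action_def)
  qed (use that in \<open>simp add: group_manifold_def\<close>)
  have C1_mult: "C1_map (prod_manifold (group_manifold H) (group_manifold H)) (group_manifold H) (\<lambda>(h, h'). h \<otimes>\<^bsub>H\<^esub> h')"
    using H by (intro smooth_map_imp_C1_map charted_prod cH) (simp add: is_lie_group_def)
  have C1H: "C1_map (group_manifold H) (group_manifold H) (\<lambda>h. h1 \<otimes>\<^bsub>H\<^esub> h \<otimes>\<^bsub>H\<^esub> h2)"
    if "h1 \<in> carrier H" "h2 \<in> carrier H" for h1 h2
    using C1_map_compose[OF C1_map_curry_left[OF C1_mult cH] C1_map_curry_right[OF C1_mult cH] cH] that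
    by (simp add: group_manifold_def)
  show ?thesis
    unfolding \<delta>_def[symmetric]
  proof (unfold_locales)
    show "\<phi> \<in> hom G H" "continuous_on (carrier G) \<phi>" "continuous_on (points X) f" by fact+
    show "f x \<in> points Y" if "x \<in> points X" for x using f(2) that by blast
    show "f (actX g x) = actY (\<phi> g) (f x)" if "g \<in> carrier G" "x \<in> points X" for g x using f_act[OF that] .
    show "\<exists>h\<in>carrier H. \<exists>x\<in>points X. actY h (f x) = y" if "y \<in> points Y" for y
      using that unfolding onto[symmetric] by auto
    show "\<delta> x x' h \<in> carrier G \<and> actX (\<delta> x x' h) x = x' \<and> \<phi> (\<delta> x x' h) = h"
      if "x \<in> points X" "x' \<in> points X" "h \<in> carrier H" "actY h (f x) = f x'" for x x' h
    proof -
      have E: "(x, x', h) \<in> ?F ` (carrier G \<times> points X)"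
        using bij that by (simp add: bij_betw_def)
      define q where "q = inv_into (carrier G \<times> points X) ?F (x, x', h)"
      have "?F q = (x, x', h)" "q \<in> carrier G \<times> points X"
        using f_inv_into_f[OF E] inv_into_into[OF E] by (auto simp: q_def)
      then show ?thesis by (auto simp: \<delta>_def simp flip: q_def)
    qed
    show "g = g'" if "g \<in> carrier G" "g' \<in> carrier G" "x \<in> points X" "actX g x = actX g' x" "\<phi> g = \<phi> g'" for g g' x
      using inj_onD[OF bij_betw_imp_inj_on[OF bij], of "(g, x)" "(g', x)"] that by auto
    have "continuous_on ?E (\<lambda>v. fst (inv_into (carrier G \<times> points X) ?F v))"
      by (rule continuous_on_fst[OF cont_inv])
    then show "continuous_on ?E (\<lambda>(x, x', h). \<delta> x x' h)" by (simp add: \<delta>_def case_prod_unfold)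
    fix K \<rho> h0 x0
    assume K: "subgroup K G" "finite K" and \<rho>: "\<rho> \<in> hom (G\<lparr>carrier := K\<rparr>) G" and h0: "h0 \<in> carrier H" and x0: "x0 \<in> points X"
      and \<phi>h0: "\<And>k. k \<in> K \<Longrightarrow> \<phi> k \<otimes>\<^bsub>H\<^esub> h0 = h0 \<otimes>\<^bsub>H\<^esub> \<phi> (\<rho> k)" and \<rho>x0: "\<And>k. k \<in> K \<Longrightarrow> actX (\<rho> k) x0 = x0"
    let ?K = "G\<lparr>carrier := K\<rparr>" and ?M = "prod_manifold (group_manifold H) X"
    have gK: "group ?K" using subgroup.subgroup_is_group[OF K(1) GX.is_group] .
    interpret \<rho>: group_hom ?K G \<rho>
      using gK \<rho> by (simp add: group_hom_def group_hom_axioms_def GX.is_group)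
    have Kc: "k \<in> carrier G" "\<phi> k \<in> carrier H" "\<rho> k \<in> carrier G" "\<phi> (\<rho> k) \<in> carrier H" if "k \<in> K" for k
      using subgroup.mem_carrier[OF K(1) that] \<rho>.hom_closed[of k] that by auto
    \<comment> \<open>Left translation by \<open>\<phi> k\<close> combined with the principal action
      of \<open>\<rho> k\<close>. The two actions commute, so \<open>a\<close> is an action of
      \<open>K\<close>; it covers \<open>actY (\<phi> k)\<close>, and \<open>\<phi>h0\<close>
      together with \<open>\<rho>x0\<close> says that it fixes \<open>(h0, x0)\<close>.\<close>
    define a where "a k = map_prod (\<lambda>h. \<phi> k \<otimes>\<^bsub>H\<^esub> h \<otimes>\<^bsub>H\<^esub> inv\<^bsub>H\<^esub> \<phi> (\<rho> k)) (actX (\<rho> k))" for k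
    have M: "points ?M = carrier H \<times> points X" by (simp add: prod_manifold_def group_manifold_def)
    have "\<exists>V s. openin (top_of_set (points Y)) V \<and> (\<lambda>(h, x). actY h (f x)) (h0, x0) \<in> V \<and> continuous_on V s \<and>
      (\<forall>q\<in>V. s q \<in> points ?M \<and> (\<lambda>(h, x). actY h (f x)) (s q) = q \<and>
         ((\<forall>k\<in>carrier ?K. actY (\<phi> k) q = q) \<longrightarrow> (\<forall>k\<in>carrier ?K. a k (s q) = s q)))"
    proof (rule equivariant_local_section[OF charted_prod[OF cH cX] cY subm gK, where a = a and b = "\<lambda>k. actY (\<phi> k)" and ?p0.0 = "(h0, x0)"])
      show "finite (carrier ?K)" using K(2) by simp
      show "C1_map ?M ?M (a k)" if "k \<in> carrier ?K" for k
        unfolding a_def using Kc[of k] that by (intro C1_map_prod C1H C1X) auto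
      show "C1_map Y Y (actY (\<phi> k))" if "k \<in> carrier ?K" for k using Kc(2)[of k] that by (intro C1Y) simp
      show "a (k \<otimes>\<^bsub>?K\<^esub> l) p = a k (a l p)" if klp: "k \<in> carrier ?K" "l \<in> carrier ?K" "p \<in> points ?M" for k l p
      proof -
        have kl: "k \<in> K" "l \<in> K" using klp by auto
        obtain h x where p: "p = (h, x)" "h \<in> carrier H" "x \<in> points X" using klp(3) M by auto
        have "\<rho> (k \<otimes>\<^bsub>G\<^esub> l) = \<rho> k \<otimes>\<^bsub>G\<^esub> \<rho> l" using \<rho>.hom_mult[of k l] kl by simp
        then show ?thesis using Kc[OF kl(1)] Kc[OF kl(2)] p
          by (simp add: a_def GX.act_mult HY.m_assoc HY.inv_mult_group)
      qed
      show "a \<one>\<^bsub>?K\<^esub> p = p" if "p \<in> points ?M" for p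
        using that \<rho>.hom_one unfolding M a_def by auto
      show "(\<lambda>(h, x). actY h (f x)) (a k p) = actY (\<phi> k) ((\<lambda>(h, x). actY h (f x)) p)"
        if kp: "k \<in> carrier ?K" "p \<in> points ?M" for k p
      proof -
        have k: "k \<in> K" using kp by simp
        obtain h x where p: "p = (h, x)" "h \<in> carrier H" "x \<in> points X" using kp(2) M by auto
        have fx: "f x \<in> points Y" using f(2) p(3) by blast
        show ?thesis using Kc[OF k] p fx by (simp add: a_def HY.act_mult f_act)
      qed
      show "(h0, x0) \<in> points ?M" using h0 x0 M by simp
      show "a k (h0, x0) = (h0, x0)" if "k \<in> carrier ?K" for k
        using that \<phi>h0[of k] \<rho>x0[of k] Kc[of k] h0 by (simp add: a_def HY.m_assoc)
    qed
    then obtain V s where V: "openin (top_of_set (points Y)) V" "(\<lambda>(h, x). actY h (f x)) (h0, x0) \<in> V" "continuous_on V s"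
      "\<And>q. q \<in> V \<Longrightarrow> s q \<in> points ?M \<and> (\<lambda>(h, x). actY h (f x)) (s q) = q"
      "\<And>q k. \<lbrakk>q \<in> V; \<forall>k\<in>carrier ?K. actY (\<phi> k) q = q; k \<in> carrier ?K\<rbrakk> \<Longrightarrow> a k (s q) = s q"
      by blast
    show "\<exists>V s. openin (top_of_set (points Y)) V \<and> actY h0 (f x0) \<in> V \<and> continuous_on V s \<and>
        (\<forall>q\<in>V. fst (s q) \<in> carrier H \<and> snd (s q) \<in> points X \<and> actY (fst (s q)) (f (snd (s q))) = q \<and>
           ((\<forall>k\<in>K. actY (\<phi> k) q = q) \<longrightarrow>
            (\<forall>k\<in>K. \<phi> k \<otimes>\<^bsub>H\<^esub> fst (s q) = fst (s q) \<otimes>\<^bsub>H\<^esub> \<phi> (\<rho> k) \<and> actX (\<rho> k) (snd (s q)) = snd (s q))))"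
    proof (intro exI conjI ballI impI)
      show "openin (top_of_set (points Y)) V" "actY h0 (f x0) \<in> V" "continuous_on V s" using V(1-3) by auto
      fix q assume q: "q \<in> V"
      show sq: "fst (s q) \<in> carrier H" "snd (s q) \<in> points X" "actY (fst (s q)) (f (snd (s q))) = q"
        using V(4)[OF q] unfolding M mem_Times_iff case_prod_unfold by blast+
      fix k assume inv_q: "\<forall>k\<in>K. actY (\<phi> k) q = q" and k: "k \<in> K"
      have "a k (s q) = s q" using V(5)[OF q] inv_q k by simp
      then have 1: "\<phi> k \<otimes>\<^bsub>H\<^esub> fst (s q) \<otimes>\<^bsub>H\<^esub> inv\<^bsub>H\<^esub> \<phi> (\<rho> k) = fst (s q)" and 2: "actX (\<rho> k) (snd (s q)) = snd (s q)"
        unfolding a_def by (metis fst_map_prod, metis snd_map_prod)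
      have "\<phi> k \<otimes>\<^bsub>H\<^esub> fst (s q) = \<phi> k \<otimes>\<^bsub>H\<^esub> fst (s q) \<otimes>\<^bsub>H\<^esub> inv\<^bsub>H\<^esub> \<phi> (\<rho> k) \<otimes>\<^bsub>H\<^esub> \<phi> (\<rho> k)"
        using Kc[OF k] sq(1) by (simp add: HY.m_assoc)
      then show "\<phi> k \<otimes>\<^bsub>H\<^esub> fst (s q) = fst (s q) \<otimes>\<^bsub>H\<^esub> \<phi> (\<rho> k)" unfolding 1 .
      show "actX (\<rho> k) (snd (s q)) = snd (s q)" by (rule 2)
    qed
  qed
qed

theorem corollary5p2:
  fixes G :: "('g::topological_space, 'd::euclidean_space) lie_group"
    and H :: "('h::topological_space, 'b::euclidean_space) lie_group"
    and X :: "('x::topological_space, 'e::euclidean_space) manifold"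
    and Y :: "('y::topological_space, 'c::euclidean_space) manifold"
    and actX :: "'g \<Rightarrow> 'x \<Rightarrow> 'x" and actY :: "'h \<Rightarrow> 'y \<Rightarrow> 'y"
    and \<phi> :: "'g \<Rightarrow> 'h" and f :: "'x \<Rightarrow> 'y"
  assumes "is_lie_group G" and "compact (carrier G)"
    and "is_lie_group H" and "compact (carrier H)"
    and "smooth_manifold X" and "smooth_manifold Y"
    and "smooth_action G X actX" and "smooth_action H Y actY"
    and "\<And>x. x \<in> points X \<Longrightarrow> finite (stabilizer G actX x)"
    and "\<And>y. y \<in> points Y \<Longrightarrow> finite (stabilizer H actY y)"
    and "equivariant_essential_equivalence G X actX H Y actY \<phi> f"
  shows "weak_equivalence (Pi_d G (points X) actX) (Pi_d H (points Y) actY)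
           (Pi_d_obj \<phi> f) (Pi_d_arr H (points Y) actY \<phi> f)"
  using action_equivalence_of_essential_equivalence[OF assms(1,3,5-11)]
  by (rule action_equivalence.weak_equivalence_Pi_d)

end
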